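(* Let $X$ be a non-explosive continuous-time Markov process in the countable state space $E\cup\{\partial\}$ with jump rates $(q_{x,y})$, absorbed at $\partial$, as in the context. Assume that there exists a finite subset $D_0$ of $E$ such that $\mathbb{P}_x(X_1=y)>0$ for all $x,y\in D_0$, so that the constant $$\lambda_0:=\inf\left\{\lambda>0:\liminf_{t\to+\infty}e^{\lambda t}\,\mathbb{P}_x(X_t=x)>0\right\}$$ is finite and independent of $x\in D_0$. If in addition there exist constants $C>0$, $\lambda_1>\lambda_0$ and a function $\varphi:E\cup\{\partial\}\to\mathbb{R}_+$ such that $\varphi|_E\ge1$, $\varphi(\partial)=0$, $\sum_{y\in E\setminus\{x\}}q_{x,y}\varphi(y)<\infty$ for all $x\in E$ and $$\mathcal{L}\varphi(x)\le-\lambda_1\varphi(x)+C\mathbf{1}_{x\in D_0},\qquad\forall x\in E,$$ then Assumption (F) (defined in the context) is satisfied with $L=D_0$, $\gamma_1=e^{-\lambda_1}$, any $\gamma_2\in(e^{-\lambda_1},e^{-\lambda_0})$ and $\psi_1=\varphi|_E$. In addition, $\mathbb{P}_{\nu_{QSD}}(t<\tau_\partial)=e^{-\lambda_0t}$ for all $t\ge0$, and the function $\eta(x)=\lim_{t\to+\infty}e^{\lambda_0t}\,\mathbb{P}_x(t<\tau_\partial)$ satisfies $P_t\eta=e^{-\lambda_0t}\eta$ for all $t\ge0$, $\sum_{y\in E\setminus\{x\}}q_{x,y}\eta(y)<\infty$ and $\mathcal{L}\eta(x)=-\lambda_0\eta(x)$ for all $x\in E$.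
   Context: The jump rates satisfy $\sum_{y\in E\cup\{\partial\}\setminus\{x\}}q_{x,y}<\infty$ for all $x\in E$, where $q_{x,y}$ is the jump rate from $x$ to $y\ne x$. The operator $\mathcal{L}$ acts on nonnegative functions $f$ on $E\cup\{\partial\}$ such that $\sum_{y}q_{x,y}f(y)<\infty$ for all $x\in E$ by $\mathcal{L}f(x)=\sum_{y\in E\cup\{\partial\},\,y\ne x}q_{x,y}(f(y)-f(x))$ for $x\in E$ and $\mathcal{L}f(\partial)=0$; the function $\eta$ is extended by $\eta(\partial)=0$. $\tau_\partial=\inf\{t\ge0:X_t=\partial\}$, $P_tf(x)=\mathbb{E}_x(f(X_t)\mathbf{1}_{t<\tau_\partial})$, $\mathbb{P}_x$ is the law started from $x$, $\mathbb{P}_\mu=\int\mathbb{P}_x\,\mu(\mathrm dx)$. Assumption (F) (here with time set $I=[0,+\infty)$). There exist positive real constants $\gamma_1,\gamma_2,c_1,c_2,c_3$, times $t_1,t_2\in I$, a measurable function $\psi_1:E\to[1,+\infty)$ and a probability measure $\nu$ on a measurable subset $L\subset E$ such that: - (F0) With $\tau_L:=\inf\{t\in I:X_t\in L\}$: for all $x\in E$, $X_{\tau_L}\in L$ $\mathbb{P}_x$-a.s. on $\{\tau_L<\infty\}$, and for all $t\in I$ and all measurable $f:E\cup\{\partial\}\to\mathbb{R}_+$, $\mathbb{E}_x[f(X_t)\mathbf{1}_{\tau_L\le t<\tau_\partial}]=\mathbb{E}_x\left[\mathbf{1}_{\tau_L\le t\wedge\tau_\partial}\left.\mathbb{E}_{X_{\tau_L}}[f(X_{t-u})\mathbf{1}_{t-u<\tau_\partial}]\right|_{u=\tau_L}\right]$.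 - (F1) For all $x\in L$, $\mathbb{P}_x(X_{t_1}\in\cdot)\ge c_1\nu(\cdot\cap L)$. - (F2) $\gamma_1<\gamma_2$; $\mathbb{E}_x(\psi_1(X_{t_2})\mathbf{1}_{t_2<\tau_L\wedge\tau_\partial})\le\gamma_1^{t_2}\psi_1(x)$ for all $x\in E$; $\mathbb{E}_x(\psi_1(X_t)\mathbf{1}_{t<\tau_\partial})\le c_2$ for all $x\in L$, $t\in[0,t_2]\cap I$; and $\gamma_2^{-t}\mathbb{P}_x(X_t\in L)\to+\infty$ as $t\to+\infty$ for all $x\in L$. - (F3) $\displaystyle\sup_{t\ge0}\frac{\sup_{y\in L}\mathbb{P}_y(t<\tau_\partial)}{\inf_{y\in L}\mathbb{P}_y(t<\tau_\partial)}\le c_3$. Under Assumption (F), $\nu_{QSD}$ denotes the unique quasi-stationary distribution of $X$ (probability measure $\nu'$ on $E$ with $\mathbb{P}_{\nu'}(X_t\in\cdot\mid t<\tau_\partial)=\nu'$ for all $t\ge0$) such that $\nu_{QSD}(\psi_1)<\infty$ and $\nu_{QSD}(L)>0$; moreover, with $\lambda_0'\ge0$ defined by $\mathbb{P}_{\nu_{QSD}}(t<\tau_\partial)=e^{-\lambda_0't}$, the limit $\lim_{t\to+\infty}e^{\lambda_0't}\,\mathbb{P}_x(t<\tau_\partial)$ exists in $[0,\infty)$ for all $x\in E$. *)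

theory Defs
  imports "HOL-Probability.Probability"
begin

(* The state space is 'a option: the countable set E is the type 'a and None is the cemetery
   point.  A rate q x y is used only for y different from Some x; there are no rates out of
   None.  Times are reals, and only times t >= 0 are ever considered. *)

definition hitting_time :: "(real \<Rightarrow> 'w \<Rightarrow> 's) \<Rightarrow> 's set \<Rightarrow> 'w \<Rightarrow> ereal" where
  "hitting_time X B \<omega> = Inf (ereal ` {t. 0 \<le> t \<and> X t \<omega> \<in> B})"

definition absorption_time :: "(real \<Rightarrow> 'w \<Rightarrow> 'a option) \<Rightarrow> 'w \<Rightarrow> ereal" where
  "absorption_time X = hitting_time X {None}"

definition jump_times :: "(real \<Rightarrow> 'w \<Rightarrow> 's) \<Rightarrow> 'w \<Rightarrow> real set" where
  "jump_times X \<omega> = {s. 0 < s \<and> \<not> (\<forall>\<^sub>F u in at_left s. X u \<omega> = X s \<omega>)}"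

definition past :: "'w measure \<Rightarrow> (real \<Rightarrow> 'w \<Rightarrow> 's) \<Rightarrow> real \<Rightarrow> 'w measure" where
  "past M X s = sigma (space M) {X u -` {y} \<inter> space M | u y. 0 \<le> u \<and> u \<le> s}"

(* P x is the law started from x, on the measurable space of M (the measure M itself plays no
   role).  Right-continuity is for the discrete topology of the state space; together with
   non-explosion and the behaviour of the transition function at time 0 it determines the law of
   the process from the rates q. *)
locale absorbed_markov_jump_process =
  fixes q :: "'a::countable \<Rightarrow> 'a option \<Rightarrow> real"
    and M :: "'w measure"
    and P :: "'a option \<Rightarrow> 'w measure"
    and X :: "real \<Rightarrow> 'w \<Rightarrow> 'a option"
  assumes rates_nonneg: "\<And>x y. y \<noteq> Some x \<Longrightarrow> 0 \<le> q x y"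
    and rates_summable: "\<And>x. q x summable_on (UNIV - {Some x})"
    and laws: "\<And>x. prob_space (P x)" "\<And>x. sets (P x) = sets M"
    and random_variables: "\<And>t. 0 \<le> t \<Longrightarrow> X t \<in> measurable M (count_space UNIV)"
    and start: "\<And>x. AE \<omega> in P x. X 0 \<omega> = x"
    and right_continuous:
      "\<And>\<omega> t. \<omega> \<in> space M \<Longrightarrow> 0 \<le> t \<Longrightarrow> \<forall>\<^sub>F s in at_right t. X s \<omega> = X t \<omega>"
    and non_explosive: "\<And>x. AE \<omega> in P x. \<forall>T. finite (jump_times X \<omega> \<inter> {..T})"
    and absorbed: "\<And>x. AE \<omega> in P x. \<forall>s t. 0 \<le> s \<and> s \<le> t \<and> X s \<omega> = None \<longrightarrow> X t \<omega> = None"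
    and markov: "\<And>x y s t A. 0 \<le> s \<Longrightarrow> 0 \<le> t \<Longrightarrow> A \<in> sets (past M X s) \<Longrightarrow>
      \<P>(\<omega> in P x. \<omega> \<in> A \<and> X (s + t) \<omega> = y) =
      (\<integral>\<omega>. indicator A \<omega> * \<P>(\<omega>' in P (X s \<omega>). X t \<omega>' = y) \<partial>P x)"
    and jump_rates: "\<And>x y. y \<noteq> Some x \<Longrightarrow>
      ((\<lambda>h. \<P>(\<omega> in P (Some x). X h \<omega> = y) / h) \<longlongrightarrow> q x y) (at_right 0)"
    and exit_rates: "\<And>x.
      ((\<lambda>h. (1 - \<P>(\<omega> in P (Some x). X h \<omega> = Some x)) / h)
        \<longlongrightarrow> (\<Sum>\<^sub>\<infinity>y\<in>UNIV - {Some x}. q x y)) (at_right 0)"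

primrec generator :: "('a \<Rightarrow> 'a option \<Rightarrow> real) \<Rightarrow> ('a option \<Rightarrow> real) \<Rightarrow> 'a option \<Rightarrow> real" where
  "generator q f None = 0"
| "generator q f (Some x) = (\<Sum>\<^sub>\<infinity>y\<in>UNIV - {Some x}. q x y * (f y - f (Some x)))"

definition survival ::
    "('a option \<Rightarrow> 'w measure) \<Rightarrow> (real \<Rightarrow> 'w \<Rightarrow> 'a option) \<Rightarrow> real \<Rightarrow> 'a option \<Rightarrow> real" where
  "survival P X t x = \<P>(\<omega> in P x. ereal t < absorption_time X \<omega>)"

(* P_t f for f >= 0; the value of f at None is irrelevant. *)
definition semigroup_op ::
    "('a option \<Rightarrow> 'w measure) \<Rightarrow> (real \<Rightarrow> 'w \<Rightarrow> 'a option) \<Rightarrow> real \<Rightarrow> ('a option \<Rightarrow> real)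
      \<Rightarrow> 'a option \<Rightarrow> ennreal" where
  "semigroup_op P X t f x =
    (\<integral>\<^sup>+\<omega>. (if ereal t < absorption_time X \<omega> then ennreal (f (X t \<omega>)) else 0) \<partial>P x)"

(* The first two clauses are the strong Markov property at the entrance time of L.  The times t1
   and t2 are taken positive: with t2 = 0 the contraction bound on psi would be void.  In the
   integrals, case_option 0 psi is psi extended by 0 to the cemetery point. *)
definition assumption_F ::
    "('a option \<Rightarrow> 'w measure) \<Rightarrow> (real \<Rightarrow> 'w \<Rightarrow> 'a option) \<Rightarrow> 'a set \<Rightarrow> real \<Rightarrow> real
      \<Rightarrow> ('a \<Rightarrow> real) \<Rightarrow> bool" where
  "assumption_F P X L \<gamma>1 \<gamma>2 \<psi> \<longleftrightarrow>
    0 < \<gamma>1 \<and> 0 < \<gamma>2 \<and> (\<forall>x. 1 \<le> \<psi> x) \<and>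
    (\<exists>c1 c2 c3 t1 t2 (\<nu> :: 'a pmf).
      0 < c1 \<and> 0 < c2 \<and> 0 < c3 \<and> 0 < t1 \<and> 0 < t2 \<and> set_pmf \<nu> \<subseteq> L \<and>
      (let \<tau>L = hitting_time X (Some ` L); \<tau> = absorption_time X; \<psi>0 = case_option 0 \<psi> in
        (\<forall>x. AE \<omega> in P (Some x). \<tau>L \<omega> < \<infinity> \<longrightarrow> X (real_of_ereal (\<tau>L \<omega>)) \<omega> \<in> Some ` L) \<and>
        (\<forall>x t f. 0 \<le> t \<and> (\<forall>y. 0 \<le> f y) \<longrightarrow>
          (\<integral>\<^sup>+\<omega>. (if \<tau>L \<omega> \<le> ereal t \<and> ereal t < \<tau> \<omega> then ennreal (f (X t \<omega>)) else 0) \<partial>P (Some x)) =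
          (\<integral>\<^sup>+\<omega>. (if \<tau>L \<omega> \<le> min (ereal t) (\<tau> \<omega>)
                 then let u = real_of_ereal (\<tau>L \<omega>) in semigroup_op P X (t - u) f (X u \<omega>)
                 else 0) \<partial>P (Some x))) \<and>
        (\<forall>x\<in>L. \<forall>A. \<P>(\<omega> in P (Some x). X t1 \<omega> \<in> Some ` A) \<ge> c1 * measure_pmf.prob \<nu> (A \<inter> L)) \<and>
        \<gamma>1 < \<gamma>2 \<and>
        (\<forall>x. (\<integral>\<^sup>+\<omega>. (if ereal t2 < min (\<tau>L \<omega>) (\<tau> \<omega>) then ennreal (\<psi>0 (X t2 \<omega>)) else 0) \<partial>P (Some x))
              \<le> ennreal (\<gamma>1 powr t2 * \<psi> x)) \<and>
        (\<forall>x\<in>L. \<forall>t\<in>{0..t2}. semigroup_op P X t \<psi>0 (Some x) \<le> ennreal c2) \<and>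
        (\<forall>x\<in>L. filterlim (\<lambda>t. \<gamma>2 powr (- t) * \<P>(\<omega> in P (Some x). X t \<omega> \<in> Some ` L))
                  at_top at_top) \<and>
        (SUP t\<in>{0..}. (SUP y\<in>L. ennreal (survival P X t (Some y))) /
                       (INF y\<in>L. ennreal (survival P X t (Some y)))) \<le> ennreal c3))"

(* Probability measures on the countable set E are rendered as pmfs. *)
definition initial_law :: "('a option \<Rightarrow> 'w measure) \<Rightarrow> 'a pmf \<Rightarrow> 'w measure" where
  "initial_law P \<mu> = measure_pmf \<mu> \<bind> (\<lambda>x. P (Some x))"

(* If survival up to time t had probability 0, the conditional probability would be 0 / 0 = 0 for
   every A, contradicting the case A = UNIV; so positivity of survival is implied. *)
definition quasi_stationary ::
    "('a option \<Rightarrow> 'w measure) \<Rightarrow> (real \<Rightarrow> 'w \<Rightarrow> 'a option) \<Rightarrow> 'a pmf \<Rightarrow> bool" where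
  "quasi_stationary P X \<nu> \<longleftrightarrow> (\<forall>t\<ge>0. \<forall>A.
    \<P>(\<omega> in initial_law P \<nu>. X t \<omega> \<in> Some ` A \<bar> ereal t < absorption_time X \<omega>) =
    measure_pmf.prob \<nu> A)"

(* The characterization of nu_QSD relative to the L and psi_1 of Assumption (F). *)
definition is_nu_QSD ::
    "('a option \<Rightarrow> 'w measure) \<Rightarrow> (real \<Rightarrow> 'w \<Rightarrow> 'a option) \<Rightarrow> 'a set \<Rightarrow> ('a \<Rightarrow> real)
      \<Rightarrow> 'a pmf \<Rightarrow> bool" where
  "is_nu_QSD P X L \<psi> \<nu> \<longleftrightarrow> quasi_stationary P X \<nu> \<and>
    (\<integral>\<^sup>+x. ennreal (\<psi> x) \<partial>measure_pmf \<nu>) < \<infinity> \<and> 0 < measure_pmf.prob \<nu> L"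

(* The limit inferior and the infimum are taken in ereal: the limit inferior may be infinite, and
   the infimum is infinite when no exponent a qualifies. *)
definition decay_parameter ::
    "('a option \<Rightarrow> 'w measure) \<Rightarrow> (real \<Rightarrow> 'w \<Rightarrow> 'a option) \<Rightarrow> 'a \<Rightarrow> ereal" where
  "decay_parameter P X x = Inf (ereal ` {a. 0 < a \<and>
    0 < Liminf at_top (\<lambda>t. ereal (exp (a * t) * \<P>(\<omega> in P (Some x). X t \<omega> = Some x)))})"

end

theory Submission
  imports Defs
begin

text \<open>
  Write \<open>P\<^sub>t\<close> for the semigroup of the process killed at the cemetery point, \<open>p\<^sub>t(x,y)\<close> for its
  transition probabilities (the point masses of the kernel \<open>kern t x\<close>), \<open>D\<^sub>0\<close> for the finite set and
  \<open>\<tau>\<close> for the entrance time of \<open>D\<^sub>0\<close>.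

  From the generator to the semigroup.  Let \<open>G\<close> be a finite set of states on which \<open>L w \<le> c w\<close>.  The
  matrix \<open>(p\<^sub>h(x,y))\<close> with \<open>x, y \<in> G\<close> is \<open>1 + h Q + o(h)\<close>, so one step of length \<open>h\<close> multiplies \<open>w\<close>
  by at most \<open>exp ((c + e) h)\<close>; iterating it along the grid of mesh \<open>t / N\<close> bounds the expectation of
  \<open>w(X\<^sub>t)\<close> on the event that the path stays in \<open>G\<close> up to time \<open>t\<close> by \<open>exp ((c + e) t) w\<close>.  A
  non-explosive path visits finitely many states up to time \<open>t\<close>, so \<open>G\<close> may then increase to an
  arbitrary set (\<open>supersolution\<close>).  With \<open>G\<close> the complement of \<open>D\<^sub>0\<close> this gives the contraction of
  \<open>\<phi>\<close> before \<open>\<tau>\<close> (\<open>killed_bound\<close>), and with \<open>G\<close> the whole space it gives the growth bound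
  \<open>P\<^sub>t \<phi> \<le> exp (C t) \<phi>\<close>.  Together with the strong Markov property at \<open>\<tau>\<close>, obtained by discretising
  \<open>\<tau>\<close>, and with the positivity of \<open>p\<^sub>1\<close> on \<open>D\<^sub>0 \<times> D\<^sub>0\<close>, these two bounds yield Assumption (F).

  Growth of the semigroup.  Supermultiplicativity of \<open>t \<mapsto> p\<^sub>t(x,x)\<close> shows that \<open>p\<^sub>n(x,x)\<close> is at most
  \<open>exp (- \<lambda>\<^sub>0 n)\<close>, and at least a multiple of \<open>exp (- g t)\<close> for every \<open>g > \<lambda>\<^sub>0\<close>.  Fix \<open>g\<close> strictly
  between \<open>\<lambda>\<^sub>0\<close> and \<open>\<lambda>\<^sub>1\<close>.  On the one hand \<open>exp (g \<tau>)\<close> has an expectation bounded by a multiple of \<open>\<phi>\<close>,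
  on the other hand shifting time by \<open>u\<close> changes \<open>m(t) = P\<^sub>t \<phi> (x\<^sub>0)\<close> by at most a factor of order
  \<open>exp (g u)\<close>.  Hence \<open>P\<^sub>t \<phi> \<le> K m(t) \<phi>\<close> (\<open>semi_phi_comparison\<close>), which makes \<open>m\<close>
  submultiplicative up to a constant, so that \<open>m(n)\<close> is comparable with \<open>exp (- \<lambda>\<^sub>0 n)\<close>.

  Convergence.  Consequently \<open>T\<^sub>t = exp (\<lambda>\<^sub>0 t) P\<^sub>t\<close> is bounded in the norm weighted by \<open>\<phi>\<close>, and a
  pointwise limit of averages of \<open>T\<^sub>k \<phi>\<close> is a non-trivial function \<open>\<eta>\<close> with \<open>T\<^sub>1 \<eta> = \<eta>\<close>.  Relative to
  \<open>\<eta>\<close> there is a drift \<open>T\<^sub>n \<phi> \<le> r\<^sup>n \<phi> + \<kappa> \<eta>\<close>, and a minorization on the sets \<open>{\<phi> \<le> R \<eta>}\<close>.  Harris'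
  theorem, in the form given to it by Hairer and Mattingly and written without dividing by \<open>\<eta>\<close>
  because \<open>\<eta>\<close> may have zeros, then gives \<open>T\<^sub>t f = c(f) \<eta> + o(1) \<phi>\<close> uniformly for \<open>\<bar>f\<bar> \<le> \<phi>\<close>
  (\<open>exponential_convergence\<close>).

  Conclusions.  The functional \<open>c\<close> is countably additive below \<open>\<phi>\<close>, and normalised it is integration
  against a quasi-stationary distribution.  Any other one with the required integrability must equal
  it, as one sees by integrating the convergence against it.  The limit of \<open>exp (\<lambda>\<^sub>0 t) P\<^sub>t 1\<close> is
  \<open>c(1) \<eta>\<close>.  Its generator equation is the derivative at \<open>0\<close> of \<open>P\<^sub>t \<eta> = exp (- \<lambda>\<^sub>0 t) \<eta>\<close>; the
  derivative may be taken inside the sum because the off-diagonal part of \<open>P\<^sub>t \<phi>\<close> has the right first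
  order (\<open>offdiagonal_bound\<close>).
\<close>

section \<open>Transition kernels, hitting times and the Markov property\<close>

lemma measurable_to_countable:
  fixes f :: "'w \<Rightarrow> 'b::countable"
  shows "f \<in> measurable N (count_space UNIV) \<longleftrightarrow> (\<forall>y. f -` {y} \<inter> space N \<in> sets N)"
  by (subst measurable_count_space_eq_countable) auto

context absorbed_markov_jump_process
begin

text \<open>
  The law of \<open>X t\<close> under \<open>P x\<close> as a probability mass function; all later estimates are about these
  kernels and no longer mention paths, except where an entrance time is involved.
\<close>

definition kern :: "real \<Rightarrow> 'a option \<Rightarrow> 'a option pmf" where
  "kern t x = Abs_pmf (distr (P x) (count_space UNIV) (X t))"

lemma space_P [simp]: "space (P x) = space M"
  using laws(2) by (rule sets_eq_imp_space_eq)

lemma measurable_P_eq: "measurable (P x) N = measurable M N"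
  by (rule measurable_cong_sets) (simp_all add: laws(2))

lemma X_measurable [measurable]:
  "0 \<le> t \<Longrightarrow> X t \<in> measurable M (count_space UNIV)"
  "0 \<le> t \<Longrightarrow> X t \<in> measurable (P x) (count_space UNIV)"
  using random_variables by (simp_all add: measurable_P_eq)

lemma measure_pmf_kern:
  assumes "0 \<le> t"
  shows "measure_pmf (kern t x) = distr (P x) (count_space UNIV) (X t)"
proof -
  interpret prob_space "P x" by (rule laws)
  interpret D: prob_space "distr (P x) (count_space UNIV) (X t)"
    using X_measurable(2)[OF assms, of x] by (rule prob_space_distr)
  have "AE y in distr (P x) (count_space UNIV) (X t).
      measure (distr (P x) (count_space UNIV) (X t)) {y} \<noteq> 0"
    by (subst D.AE_support_countable) (auto intro!: exI[of _ UNIV])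
  then show ?thesis
    unfolding kern_def by (subst Abs_pmf_inverse) (auto simp: D.prob_space_axioms)
qed

lemma nn_integral_kern:
  "0 \<le> t \<Longrightarrow> (\<integral>\<^sup>+y. f y \<partial>kern t x) = (\<integral>\<^sup>+\<omega>. f (X t \<omega>) \<partial>P x)"
  by (simp add: measure_pmf_kern nn_integral_distr)

lemma measure_kern:
  "0 \<le> t \<Longrightarrow> measure (kern t x) A = \<P>(\<omega> in P x. X t \<omega> \<in> A)"
  by (simp add: measure_pmf_kern measure_distr vimage_def Int_def conj_commute)

lemma pmf_kern: "0 \<le> t \<Longrightarrow> pmf (kern t x) y = \<P>(\<omega> in P x. X t \<omega> = y)"
  by (simp add: pmf.rep_eq measure_kern)

lemma kern_eq_return:
  assumes t: "0 \<le> t" and ae: "AE \<omega> in P x. X t \<omega> = z"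
  shows "kern t x = return_pmf z"
proof (rule pmf_eqI)
  fix y
  interpret prob_space "P x" by (rule laws)
  have "X t -` {y} \<inter> space (P x) \<in> events"
    using t by (intro measurable_sets[OF X_measurable(2)]) auto
  then have ev: "{\<omega>\<in>space (P x). X t \<omega> = y} \<in> events"
    by (simp add: vimage_def Int_def conj_commute)
  have "\<P>(\<omega> in P x. X t \<omega> = y) = indicator {z} y"
  proof (cases "y = z")
    case True
    then show ?thesis using ae prob_Collect_eq_1[OF ev] by auto
  next
    case False
    then have "AE \<omega> in P x. X t \<omega> \<noteq> y" using ae by (auto elim: eventually_mono)
    then show ?thesis using False prob_Collect_eq_0[OF ev] by auto
  qed
  then show "pmf (kern t x) y = pmf (return_pmf z) y"
    using t by (simp add: pmf_kern pmf_return indicator_def)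
qed

lemma kern_0: "kern 0 x = return_pmf x"
  using start by (intro kern_eq_return) auto

lemma kern_None: "0 \<le> t \<Longrightarrow> kern t None = return_pmf None"
  using start[of None] absorbed[of None] by (intro kern_eq_return) (auto elim: eventually_elim2)

lemma sets_past: "sets (past M X s) =
    sigma_sets (space M) {X u -` {y} \<inter> space M | u y. 0 \<le> u \<and> u \<le> s}"
  unfolding past_def by (rule sets_measure_of) auto

lemma space_past [simp]: "space (past M X s) = space M"
  unfolding past_def by (rule space_measure_of) auto

lemma sets_past_subset: "sets (past M X s) \<subseteq> sets M"
  unfolding sets_past by (rule sets.sigma_sets_subset) (auto intro!: measurable_sets[OF X_measurable(1)])

lemma X_measurable_past:
  assumes "0 \<le> u" "u \<le> s" shows "X u \<in> measurable (past M X s) (count_space UNIV)"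
  unfolding measurable_to_countable sets_past space_past
  using assms by (auto intro!: sigma_sets.Basic)

lemma markov_pmf:
  assumes "0 \<le> s" "0 \<le> t" "A \<in> sets (past M X s)"
  shows "(\<integral>\<^sup>+\<omega>. indicator A \<omega> * indicator {y} (X (s + t) \<omega>) \<partial>P x) =
    (\<integral>\<^sup>+\<omega>. indicator A \<omega> * ennreal (pmf (kern t (X s \<omega>)) y) \<partial>P x)"
proof -
  interpret prob_space "P x" by (rule laws)
  have [measurable]: "A \<in> sets (P x)" using assms(3) sets_past_subset laws(2) by blast
  have [measurable]: "X s \<in> measurable (P x) (count_space UNIV)"
    "X (s + t) \<in> measurable (P x) (count_space UNIV)"
    using assms by auto
  have sp: "A \<subseteq> space M" using assms(3) sets.sets_into_space by fastforce
  have "A \<inter> (X (s + t) -` {y} \<inter> space (P x)) \<in> events" by measurable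
  moreover have "A \<inter> (X (s + t) -` {y} \<inter> space (P x)) =
      {\<omega>\<in>space (P x). \<omega> \<in> A \<and> X (s + t) \<omega> = y}" using sp by auto
  ultimately have ev: "{\<omega>\<in>space (P x). \<omega> \<in> A \<and> X (s + t) \<omega> = y} \<in> events" by simp
  have "(\<integral>\<^sup>+\<omega>. indicator A \<omega> * indicator {y} (X (s + t) \<omega>) \<partial>P x) =
    (\<integral>\<^sup>+\<omega>. indicator {\<omega>\<in>space (P x). \<omega> \<in> A \<and> X (s + t) \<omega> = y} \<omega> \<partial>P x)"
    using sp by (intro nn_integral_cong) (auto split: split_indicator)
  also have "\<dots> = ennreal (\<P>(\<omega> in P x. \<omega> \<in> A \<and> X (s + t) \<omega> = y))"
    using ev by (subst nn_integral_indicator) (auto simp: emeasure_eq_measure)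
  also have "\<P>(\<omega> in P x. \<omega> \<in> A \<and> X (s + t) \<omega> = y) =
      (\<integral>\<omega>. indicator A \<omega> * pmf (kern t (X s \<omega>)) y \<partial>P x)"
    using markov[OF assms, of x y] by (simp add: pmf_kern assms)
  also have "ennreal \<dots> = (\<integral>\<^sup>+\<omega>. ennreal (indicator A \<omega> * pmf (kern t (X s \<omega>)) y) \<partial>P x)"
    by (intro nn_integral_eq_integral[symmetric] integrable_const_bound[where B=1])
       (auto simp: pmf_le_1 split: split_indicator)
  also have "\<dots> = (\<integral>\<^sup>+\<omega>. indicator A \<omega> * ennreal (pmf (kern t (X s \<omega>)) y) \<partial>P x)"
    by (intro nn_integral_cong) (auto split: split_indicator)
  finally show ?thesis .
qed

lemma nn_integral_as_sum:
  fixes f :: "'a option \<Rightarrow> ennreal"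
  shows "f z = (\<integral>\<^sup>+y. f y * indicator {y} z \<partial>count_space UNIV)"
proof -
  have "(\<integral>\<^sup>+y. f y * indicator {y} z \<partial>count_space UNIV) =
    (\<integral>\<^sup>+y. f y * indicator {z} y \<partial>count_space UNIV)"
    by (intro nn_integral_cong) (auto split: split_indicator)
  then show ?thesis by (simp add: nn_integral_indicator_singleton)
qed

text \<open>
  A nonnegative function of a countable state is a sum of multiples of point indicators, for which the
  identity is the Markov property of the locale; the sum is countable, so it may be exchanged with
  the expectation.
\<close>

lemma markov_nn_integral:
  fixes f :: "'a option \<Rightarrow> ennreal"
  assumes "0 \<le> s" "0 \<le> t" "A \<in> sets (past M X s)"
  shows "(\<integral>\<^sup>+\<omega>. indicator A \<omega> * f (X (s + t) \<omega>) \<partial>P x) =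
    (\<integral>\<^sup>+\<omega>. indicator A \<omega> * (\<integral>\<^sup>+y. f y \<partial>kern t (X s \<omega>)) \<partial>P x)"
proof -
  have [measurable]: "A \<in> sets (P x)" using assms(3) sets_past_subset laws(2) by blast
  have [measurable]: "X s \<in> measurable (P x) (count_space UNIV)"
    "X (s + t) \<in> measurable (P x) (count_space UNIV)"
    using assms by auto
  have "(\<integral>\<^sup>+\<omega>. indicator A \<omega> * f (X (s + t) \<omega>) \<partial>P x) =
    (\<integral>\<^sup>+\<omega>. (\<integral>\<^sup>+y. f y * (indicator A \<omega> * indicator {y} (X (s + t) \<omega>)) \<partial>count_space UNIV) \<partial>P x)"
    by (intro nn_integral_cong, subst nn_integral_as_sum)
       (simp add: nn_integral_cmult[symmetric] mult_ac)
  also have "\<dots> = (\<integral>\<^sup>+y. f y * (\<integral>\<^sup>+\<omega>. indicator A \<omega> * indicator {y} (X (s + t) \<omega>) \<partial>P x) \<partial>count_space UNIV)"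
    by (subst nn_integral_count_space_nn_integral) (auto simp: nn_integral_cmult)
  also have "\<dots> = (\<integral>\<^sup>+y. f y * (\<integral>\<^sup>+\<omega>. indicator A \<omega> * ennreal (pmf (kern t (X s \<omega>)) y) \<partial>P x) \<partial>count_space UNIV)"
    by (simp add: markov_pmf[OF assms])
  also have "\<dots> = (\<integral>\<^sup>+\<omega>. (\<integral>\<^sup>+y. f y * (indicator A \<omega> * ennreal (pmf (kern t (X s \<omega>)) y)) \<partial>count_space UNIV) \<partial>P x)"
    by (subst nn_integral_count_space_nn_integral) (auto simp: nn_integral_cmult)
  also have "\<dots> = (\<integral>\<^sup>+\<omega>. indicator A \<omega> * (\<integral>\<^sup>+y. f y \<partial>kern t (X s \<omega>)) \<partial>P x)"
    by (intro nn_integral_cong)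
       (simp add: nn_integral_measure_pmf nn_integral_cmult[symmetric] mult_ac)
  finally show ?thesis .
qed

lemma kern_add:
  assumes "0 \<le> s" "0 \<le> t"
  shows "kern (s + t) x = bind_pmf (kern s x) (kern t)"
proof (rule pmf_eqI)
  fix y
  interpret prob_space "P x" by (rule laws)
  have "ennreal (pmf (kern (s + t) x) y) = (\<integral>\<^sup>+z. indicator {y} z \<partial>kern (s + t) x)"
    by (simp add: emeasure_pmf_single)
  also have "\<dots> = (\<integral>\<^sup>+\<omega>. indicator (space M) \<omega> * indicator {y} (X (s + t) \<omega>) \<partial>P x)"
    using assms by (subst nn_integral_kern) (auto intro!: nn_integral_cong)
  also have "\<dots> = (\<integral>\<^sup>+\<omega>. indicator (space M) \<omega> * (\<integral>\<^sup>+z. indicator {y} z \<partial>kern t (X s \<omega>)) \<partial>P x)"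
    using assms sets.top[of "past M X s"] by (subst markov_nn_integral) auto
  also have "\<dots> = (\<integral>\<^sup>+\<omega>. ennreal (pmf (kern t (X s \<omega>)) y) \<partial>P x)"
    by (intro nn_integral_cong) (auto simp: emeasure_pmf_single)
  also have "\<dots> = (\<integral>\<^sup>+z. ennreal (pmf (kern t z) y) \<partial>kern s x)"
    using assms by (subst nn_integral_kern) auto
  also have "\<dots> = ennreal (pmf (bind_pmf (kern s x) (kern t)) y)"
    by (simp add: ennreal_pmf_bind)
  finally show "pmf (kern (s + t) x) y = pmf (bind_pmf (kern s x) (kern t)) y"
    by simp
qed

lemma right_cont_interval:
  assumes "\<omega> \<in> space M" "0 \<le> t"
  obtains e where "e > 0" "\<And>s. t \<le> s \<Longrightarrow> s < t + e \<Longrightarrow> X s \<omega> = X t \<omega>"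
proof -
  have "\<forall>\<^sub>F s in at_right t. X s \<omega> = X t \<omega>" using assms by (rule right_continuous)
  then obtain b where b: "b > t" "\<And>y. t < y \<Longrightarrow> y < b \<Longrightarrow> X y \<omega> = X t \<omega>"
    by (auto simp: eventually_at_right_field)
  show thesis
    by (rule that[of "b - t"]) (use b in \<open>force simp: order_le_less\<close>)+
qed

text \<open>
  The infimum is attained: if the path is not in \<open>B\<close> at time \<open>t\<close>, then by right-continuity in the
  discrete topology it stays outside \<open>B\<close> for a while after \<open>t\<close>.
\<close>

lemma hitting_time_le_iff:
  assumes "\<omega> \<in> space M" "0 \<le> t"
  shows "hitting_time X B \<omega> \<le> ereal t \<longleftrightarrow> (\<exists>s\<in>{0..t}. X s \<omega> \<in> B)"
proof
  assume "\<exists>s\<in>{0..t}. X s \<omega> \<in> B"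
  then obtain s where s: "0 \<le> s" "s \<le> t" "X s \<omega> \<in> B" by auto
  then have "hitting_time X B \<omega> \<le> ereal s"
    unfolding hitting_time_def by (intro Inf_lower) auto
  also have "\<dots> \<le> ereal t" using s by simp
  finally show "hitting_time X B \<omega> \<le> ereal t" .
next
  assume le: "hitting_time X B \<omega> \<le> ereal t"
  show "\<exists>s\<in>{0..t}. X s \<omega> \<in> B"
  proof (rule ccontr)
    assume no: "\<not> (\<exists>s\<in>{0..t}. X s \<omega> \<in> B)"
    obtain e where e: "e > 0" "\<And>s. t \<le> s \<Longrightarrow> s < t + e \<Longrightarrow> X s \<omega> = X t \<omega>"
      using right_cont_interval[OF assms] by blast
    have "ereal (t + e) \<le> hitting_time X B \<omega>"
      unfolding hitting_time_def
    proof (rule Inf_greatest, clarsimp)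
      fix s assume s: "0 \<le> s" "X s \<omega> \<in> B"
      with no have "t < s" by force
      show "t + e \<le> s"
        using e(2)[of s] s no \<open>t < s\<close> assms by force
    qed
    then have "ereal (t + e) \<le> ereal t" using le by (rule order_trans)
    with e(1) show False by simp
  qed
qed

lemma hitting_time_attained:
  assumes "\<omega> \<in> space M" "hitting_time X B \<omega> < \<infinity>"
  obtains u where "0 \<le> u" "hitting_time X B \<omega> = ereal u" "X u \<omega> \<in> B"
    "\<And>s. 0 \<le> s \<Longrightarrow> s < u \<Longrightarrow> X s \<omega> \<notin> B"
proof -
  have nn: "0 \<le> hitting_time X B \<omega>"
    unfolding hitting_time_def by (rule Inf_greatest) auto
  then obtain u where u: "hitting_time X B \<omega> = ereal u" "0 \<le> u"
    using assms(2) by (cases "hitting_time X B \<omega>") auto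
  have low: "u \<le> s" if "0 \<le> s" "X s \<omega> \<in> B" for s
    using hitting_time_le_iff[OF assms(1) that(1), of B] that u by auto
  obtain s where "s \<in> {0..u}" "X s \<omega> \<in> B"
    using hitting_time_le_iff[OF assms(1) u(2), of B] u by auto
  with low[of s] have "X u \<omega> \<in> B" by (auto simp: order_antisym)
  then show thesis using that[OF u(2,1)] low by force
qed

lemma absorption_time_le_iff:
  "\<omega> \<in> space M \<Longrightarrow> 0 \<le> t \<Longrightarrow> absorption_time X \<omega> \<le> ereal t \<longleftrightarrow> (\<exists>s\<in>{0..t}. X s \<omega> = None)"
  unfolding absorption_time_def by (simp add: hitting_time_le_iff)

lemma AE_absorption:
  assumes "0 \<le> t"
  shows "AE \<omega> in P x. ereal t < absorption_time X \<omega> \<longleftrightarrow> X t \<omega> \<noteq> None"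
  using absorbed[of x] AE_space
proof eventually_elim
  case (elim \<omega>)
  then have "absorption_time X \<omega> \<le> ereal t \<longleftrightarrow> X t \<omega> = None"
    using absorption_time_le_iff[of \<omega> t] assms by auto
  then show ?case by (simp flip: not_le)
qed

text \<open>
  A right-continuous path that meets \<open>B\<close> before time \<open>t\<close> is in \<open>B\<close> at some rational time before \<open>t\<close>,
  so that countably many times decide the event.
\<close>

lemma hit_in_past:
  assumes "0 \<le> t"
  shows "{\<omega>\<in>space M. \<exists>s\<in>{0..t}. X s \<omega> \<in> B} \<in> sets (past M X t)"
proof -
  let ?D = "insert t (\<rat> \<inter> {0..t})"
  have "{\<omega>\<in>space M. \<exists>s\<in>{0..t}. X s \<omega> \<in> B} = (\<Union>r\<in>?D. X r -` B \<inter> space M)"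
  proof safe
    fix \<omega> s assume w: "\<omega> \<in> space M" and s: "s \<in> {0..t}" "X s \<omega> \<in> B"
    obtain e where e: "e > 0" "\<And>r. s \<le> r \<Longrightarrow> r < s + e \<Longrightarrow> X r \<omega> = X s \<omega>"
      using right_cont_interval[OF w, of s] s by auto
    show "\<omega> \<in> (\<Union>r\<in>?D. X r -` B \<inter> space M)"
    proof (cases "s = t")
      case True then show ?thesis using s w by auto
    next
      case False
      then obtain r where r: "r \<in> \<rat>" "s < r" "r < min t (s + e)"
        using Rats_dense_in_real[of s "min t (s + e)"] s(1) e(1) by (metis atLeastAtMost_iff less_add_same_cancel1 less_le min_less_iff_conj)
      then have "X r \<omega> = X s \<omega>" by (intro e(2)) auto
      then show ?thesis using r s w by (intro UN_I[of r]) auto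
    qed
  next
    fix \<omega> r assume "r \<in> \<rat>" "r \<in> {0..t}" "X r \<omega> \<in> B"
    then show "\<exists>s\<in>{0..t}. X s \<omega> \<in> B" by blast
  qed (use assms in force)+
  also have "\<dots> \<in> sets (past M X t)"
  proof (rule sets.countable_UN'')
    show "countable ?D" by (intro countable_insert countable_Int1 countable_rat)
    fix r assume "r \<in> ?D"
    then have "X r -` B \<inter> space (past M X t) \<in> sets (past M X t)"
      using assms by (intro measurable_sets[OF X_measurable_past]) auto
    then show "X r -` B \<inter> space M \<in> sets (past M X t)" by simp
  qed
  finally show ?thesis .
qed

lemma hitting_time_le_in_past:
  assumes "0 \<le> t"
  shows "{\<omega>\<in>space M. hitting_time X B \<omega> \<le> ereal t} \<in> sets (past M X t)"
proof -
  have "{\<omega>\<in>space M. hitting_time X B \<omega> \<le> ereal t} = {\<omega>\<in>space M. \<exists>s\<in>{0..t}. X s \<omega> \<in> B}"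
    using hitting_time_le_iff[OF _ assms, of _ B] by auto
  then show ?thesis using hit_in_past[OF assms, of B] by simp
qed

lemma sets_past_mono: "s \<le> t \<Longrightarrow> sets (past M X s) \<subseteq> sets (past M X t)"
  unfolding sets_past by (intro sigma_sets_mono') (blast intro: order_trans)

lemma constant_between_jumps:
  assumes w: "\<omega> \<in> space M" and ab: "0 \<le> a" "a \<le> b" and no: "jump_times X \<omega> \<inter> {a<..b} = {}"
  shows "X a \<omega> = X b \<omega>"
proof (rule connected_local_const[where A="{a..b}" and f="\<lambda>t. X t \<omega>"])
  show "\<forall>c\<in>{a..b}. \<forall>\<^sub>F d in at c within {a..b}. X c \<omega> = X d \<omega>"
  proof
    fix c assume c: "c \<in> {a..b}"
    have R: "\<forall>\<^sub>F d in at_right c. X c \<omega> = X d \<omega>"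
      using c ab by (intro eventually_mono[OF right_continuous[OF w, of c]]) auto
    show "\<forall>\<^sub>F d in at c within {a..b}. X c \<omega> = X d \<omega>"
    proof (cases "c = a")
      case True
      show ?thesis
      proof (rule filter_leD[OF _ R])
        have "at c within {a..b} = at c within ({a..b} - {c})"
          by (metis at_within_def Diff_idemp)
        also have "\<dots> \<le> at_right c" using True by (intro at_le) auto
        finally show "at c within {a..b} \<le> at_right c" .
      qed
    next
      case False
      then have "c \<notin> jump_times X \<omega>" "0 < c" using no c ab by auto
      then have "\<forall>\<^sub>F d in at_left c. X d \<omega> = X c \<omega>" by (simp add: jump_times_def)
      then have "\<forall>\<^sub>F d in at_left c. X c \<omega> = X d \<omega>" by (rule eventually_mono) simp
      with R have "\<forall>\<^sub>F d in at c. X c \<omega> = X d \<omega>" by (simp add: eventually_at_split)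
      then show ?thesis by (rule filter_leD[OF at_le[OF subset_UNIV]])
    qed
  qed
qed (use ab in auto)

text \<open>
  Between two consecutive jump times the path is constant, hence every value up to \<open>T\<close> is taken at time
  \<open>0\<close> or at one of the finitely many jump times.
\<close>

lemma finite_range:
  assumes w: "\<omega> \<in> space M" and fin: "finite (jump_times X \<omega> \<inter> {..T})"
  shows "finite ((\<lambda>t. X t \<omega>) ` {0..T})"
proof (rule finite_subset)
  let ?J = "jump_times X \<omega> \<inter> {..T}"
  show "finite ((\<lambda>t. X t \<omega>) ` insert 0 ?J)" using fin by simp
  show "(\<lambda>t. X t \<omega>) ` {0..T} \<subseteq> (\<lambda>t. X t \<omega>) ` insert 0 ?J"
  proof safe
    fix t assume t: "t \<in> {0..T}"
    let ?S = "insert 0 (jump_times X \<omega> \<inter> {..t})"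
    have S: "finite ?S" by (rule finite_subset[of _ "insert 0 ?J"]) (use fin t in auto)
    have mem: "Max ?S \<in> ?S" using S by (intro Max_in) auto
    have "X (Max ?S) \<omega> = X t \<omega>"
    proof (rule constant_between_jumps[OF w])
      show "0 \<le> Max ?S" using S by (intro Max_ge) auto
      show "Max ?S \<le> t" using mem t by auto
      show "jump_times X \<omega> \<inter> {Max ?S<..t} = {}"
        using Max_ge[OF S] by force
    qed
    then show "X t \<omega> \<in> (\<lambda>t. X t \<omega>) ` insert 0 ?J"
      using mem t by (intro image_eqI[of _ _ "Max ?S"]) auto
  qed
qed

end

section \<open>The strong Markov property at a hitting time\<close>

context absorbed_markov_jump_process
begin

lemma kern_self_tendsto: "((\<lambda>h. pmf (kern h x) x) \<longlongrightarrow> 1) (at_right 0)"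
proof (cases x)
  case None
  have "\<forall>\<^sub>F h in at_right (0::real). pmf (kern h x) x = 1"
    using eventually_at_right_less[of 0] by eventually_elim (simp add: None kern_None)
  then show ?thesis by (rule tendsto_eventually)
next
  case (Some a)
  have pos: "\<forall>\<^sub>F h in at_right (0::real). 0 < h" by (rule eventually_at_right_less)
  have "((\<lambda>h. (1 - \<P>(\<omega> in P (Some a). X h \<omega> = Some a)) / h * h) \<longlongrightarrow>
      (\<Sum>\<^sub>\<infinity>y\<in>UNIV - {Some a}. q a y) * 0) (at_right 0)"
    by (intro tendsto_mult exit_rates tendsto_ident_at)
  then have "((\<lambda>h. 1 - (1 - \<P>(\<omega> in P (Some a). X h \<omega> = Some a)) / h * h) \<longlongrightarrow> 1 - 0) (at_right 0)"
    by (intro tendsto_diff) auto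
  moreover have "\<forall>\<^sub>F h in at_right 0. 1 - (1 - \<P>(\<omega> in P (Some a). X h \<omega> = Some a)) / h * h = pmf (kern h x) x"
    using pos by eventually_elim (simp add: Some pmf_kern)
  ultimately show ?thesis by (simp add: tendsto_cong)
qed

lemma kern_self_continuous: "continuous (at 0 within {0..}) (\<lambda>h. pmf (kern h x) x)"
  using kern_self_tendsto[of x]
  by (simp add: continuous_within at_within_Ici_at_right kern_0)

text \<open>
  Conditioning on the state at time \<open>h\<close>, the two transition probabilities differ only if the process has
  left \<open>x\<close> by then.  This makes \<open>t \<mapsto> p\<^sub>t(x,y)\<close> uniformly continuous.
\<close>

lemma pmf_kern_diff:
  assumes "0 \<le> s" "0 \<le> h"
  shows "\<bar>pmf (kern (h + s) x) y - pmf (kern s x) y\<bar> \<le> 1 - pmf (kern h x) x"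
proof -
  let ?E = "measure_pmf.expectation (kern h x)"
  have "pmf (kern (h + s) x) y = ?E (\<lambda>z. pmf (kern s z) y)"
    using assms by (simp add: kern_add pmf_bind)
  moreover have int: "integrable (kern h x) (\<lambda>z. pmf (kern s z) y)"
    by (intro measure_pmf.integrable_const_bound[where B = 1]) (auto simp: pmf_le_1)
  ultimately have "pmf (kern (h + s) x) y - pmf (kern s x) y =
      ?E (\<lambda>z. pmf (kern s z) y - pmf (kern s x) y)"
    by (subst Bochner_Integration.integral_diff) auto
  also have "\<bar>\<dots>\<bar> \<le> ?E (\<lambda>z. \<bar>pmf (kern s z) y - pmf (kern s x) y\<bar>)"
    using integral_norm_bound[of "kern h x" "\<lambda>z. pmf (kern s z) y - pmf (kern s x) y"] by simp
  also have "\<dots> \<le> ?E (\<lambda>z. indicator (- {x}) z)"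
  proof (rule integral_mono_AE')
    show "AE z in kern h x. \<bar>pmf (kern s z) y - pmf (kern s x) y\<bar> \<le> indicator (- {x}) z"
    proof (rule AE_I2)
      fix z
      show "\<bar>pmf (kern s z) y - pmf (kern s x) y\<bar> \<le> indicator (- {x}) z"
        using pmf_le_1[of "kern s z" y] pmf_le_1[of "kern s x" y]
          pmf_nonneg[of "kern s z" y] pmf_nonneg[of "kern s x" y]
        by (cases "z = x") (simp, simp del: pmf_nonneg pmf_le_1 add: abs_if)
    qed
  qed (auto intro!: measure_pmf.integrable_const_bound[where B = 1])
  also have "\<dots> = 1 - pmf (kern h x) x"
    using measure_pmf.prob_compl[of "{x}" "kern h x"]
    by (simp add: Compl_eq_Diff_UNIV measure_pmf_single)
  finally show ?thesis .
qed

lemma kern_tendsto_before: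
  assumes lim: "\<sigma> \<longlonglongrightarrow> u" and bounds: "\<And>n::nat. u \<le> \<sigma> n" "\<And>n. \<sigma> n \<le> t"
  shows "(\<lambda>n. pmf (kern (t - \<sigma> n) x) y) \<longlonglongrightarrow> pmf (kern (t - u) x) y"
proof -
  have "(\<lambda>n. pmf (kern (\<sigma> n - u) x) x) \<longlonglongrightarrow> pmf (kern 0 x) x"
  proof (rule continuous_within_tendsto_compose'[OF kern_self_continuous])
    have "(\<lambda>n. \<sigma> n - u) \<longlonglongrightarrow> u - u" by (intro tendsto_intros lim)
    then show "(\<lambda>n. \<sigma> n - u) \<longlonglongrightarrow> 0" by simp
  qed (use bounds in auto)
  then have "(\<lambda>n. 1 - pmf (kern (\<sigma> n - u) x) x) \<longlonglongrightarrow> 1 - pmf (kern 0 x) x"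
    by (intro tendsto_intros)
  then have *: "(\<lambda>n. 1 - pmf (kern (\<sigma> n - u) x) x) \<longlonglongrightarrow> 0"
    by (simp add: kern_0)
  have "(\<lambda>n. pmf (kern (t - \<sigma> n) x) y - pmf (kern (t - u) x) y) \<longlonglongrightarrow> 0"
  proof (rule Lim_null_comparison[OF always_eventually *], rule allI)
    fix n
    show "norm (pmf (kern (t - \<sigma> n) x) y - pmf (kern (t - u) x) y) \<le> 1 - pmf (kern (\<sigma> n - u) x) x"
      using pmf_kern_diff[of "t - \<sigma> n" "\<sigma> n - u" x y] bounds(1)[of n] bounds(2)[of n] by simp
  qed
  then show ?thesis by (rule LIM_zero_cancel)
qed

text \<open>
  The hitting time \<open>\<tau>\<close> is rounded up to the grid of mesh \<open>t / (n + 1)\<close>.  A grid that ends exactly at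
  \<open>t\<close> keeps the rounded time below \<open>t\<close> whenever \<open>\<tau> \<le> t\<close>.  At the rounded time the ordinary Markov property applies
  on each of the events \<open>A n k\<close>.  As \<open>n\<close> grows the rounded times decrease to \<open>\<tau>\<close>, the state at the
  rounded time is eventually the state at \<open>\<tau>\<close> by right-continuity, and transition probabilities are
  continuous in time.
\<close>

lemma strong_markov_pmf:
  fixes B :: "'a option set" and y :: "'a option" and t :: real
  defines "\<tau> \<equiv> hitting_time X B"
  defines "v \<equiv> \<lambda>\<omega>. if \<tau> \<omega> \<le> ereal t
    then ennreal (pmf (kern (t - real_of_ereal (\<tau> \<omega>)) (X (real_of_ereal (\<tau> \<omega>)) \<omega>)) y) else 0"
  assumes t: "0 \<le> t"
  shows "v \<in> borel_measurable (P x)"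
    and "(\<integral>\<^sup>+\<omega>. (if \<tau> \<omega> \<le> ereal t then indicator {y} (X t \<omega>) else 0) \<partial>P x) = (\<integral>\<^sup>+\<omega>. v \<omega> \<partial>P x)"
proof -
  interpret prob_space "P x" by (rule laws)
  define \<delta> where "\<delta> n = t / real (Suc n)" for n
  define H where "H n k = {\<omega>\<in>space M. \<tau> \<omega> \<le> ereal (real k * \<delta> n)}" for n k
  define A where "A n k = H n k - (if k = 0 then {} else H n (k - 1))" for n k
  define c where "c n k \<omega> = ennreal (pmf (kern (t - real k * \<delta> n) (X (real k * \<delta> n) \<omega>)) y)" for n k \<omega>
  define g where "g n \<omega> = (\<Sum>k\<le>Suc n. indicator (A n k) \<omega> * c n k \<omega>)" for n \<omega>
  have \<delta>: "0 \<le> \<delta> n" "real (Suc n) * \<delta> n = t" for n using t by (auto simp: \<delta>_def)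
  have H: "H n k \<in> sets (past M X (real k * \<delta> n))" for n k
    unfolding H_def \<tau>_def using \<delta> by (intro hitting_time_le_in_past) auto
  have A: "A n k \<in> sets (past M X (real k * \<delta> n))" for n k
  proof -
    have "H n (k - 1) \<in> sets (past M X (real k * \<delta> n))" if "k \<noteq> 0"
    proof (rule subsetD[OF sets_past_mono H])
      show "real (k - 1) * \<delta> n \<le> real k * \<delta> n" using \<delta>(1) by (intro mult_right_mono) auto
    qed
    then show ?thesis using H[of n k] by (auto simp: A_def)
  qed
  have AP [measurable]: "A n k \<in> sets (P x)" for n k
    using A sets_past_subset laws(2) by blast
  have kt: "real k * \<delta> n \<le> t" if "k \<le> Suc n" for n k
    using mult_right_mono[of "real k" "real (Suc n)" "\<delta> n"] that \<delta>[of n] by simp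
  have [measurable]: "c n k \<in> borel_measurable (P x)" for n k
  proof -
    have [measurable]: "X (real k * \<delta> n) \<in> measurable (P x) (count_space UNIV)"
      using \<delta>(1)[of n] by (intro X_measurable(2)) simp
    show ?thesis unfolding c_def by measurable
  qed
  have gm: "g n \<in> borel_measurable (P x)" for n
    unfolding g_def by measurable
  \<comment> \<open>The rounded value of the hitting time exists and is unique once B is reached by time t.\<close>
  have single: "\<exists>k\<le>Suc n. u \<le> real k * \<delta> n \<and> real k * \<delta> n \<le> u + \<delta> n \<and>
      (\<forall>j. indicator (A n j) \<omega> = (if j = k then 1 else 0 :: ennreal))"
    if w: "\<omega> \<in> space M" and u: "\<tau> \<omega> = ereal u" "0 \<le> u" "u \<le> t" for n \<omega> u
  proof -
    define k where "k = (LEAST k. u \<le> real k * \<delta> n)"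
    have ex: "u \<le> real (Suc n) * \<delta> n" using \<delta> u by simp
    have k: "u \<le> real k * \<delta> n" unfolding k_def by (rule LeastI[of _ "Suc n"]) (use ex in simp)
    have "k \<le> Suc n" unfolding k_def by (rule Least_le) (use ex in simp)
    have below: "real j * \<delta> n < u" if "j < k" for j
      using not_less_Least[OF that[unfolded k_def]] by simp
    have above: "u \<le> real j * \<delta> n" if "k \<le> j" for j
      using k mult_right_mono[of "real k" "real j" "\<delta> n"] that \<delta>(1)[of n] by simp
    have iff: "u \<le> real j * \<delta> n \<longleftrightarrow> k \<le> j" for j using below[of j] above[of j] by force
    have "real k * \<delta> n \<le> u + \<delta> n"
    proof (cases k)
      case 0 then show ?thesis using u \<delta>(1)[of n] by simp
    next
      case (Suc i)
      then show ?thesis using below[of i] by (simp add: algebra_simps)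
    qed
    moreover have "indicator (A n j) \<omega> = (if j = k then 1 else 0 :: ennreal)" for j
    proof -
      have memH: "\<omega> \<in> H n j \<longleftrightarrow> k \<le> j" for j using w u(1) by (simp add: H_def iff)
      have "\<omega> \<in> A n j \<longleftrightarrow> j = k"
      proof (cases j)
        case (Suc i)
        then show ?thesis using memH[of i] memH[of j] by (simp add: A_def) linarith
      qed (use memH[of 0] in \<open>simp add: A_def\<close>)
      then show ?thesis by (simp add: indicator_def)
    qed
    ultimately show ?thesis using \<open>k \<le> Suc n\<close> k by blast
  qed
  have none: "indicator (A n k) \<omega> = (0::ennreal)"
    if "\<not> \<tau> \<omega> \<le> ereal t" "k \<le> Suc n" for n k \<omega>
  proof -
    have "ereal (real k * \<delta> n) \<le> ereal t" using that kt[of k n] by simp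
    then have "\<omega> \<notin> H n k" using that(1) order_trans[of "\<tau> \<omega>"] by (auto simp: H_def)
    then show ?thesis by (simp add: A_def)
  qed
  have nonneg: "0 \<le> \<tau> \<omega>" for \<omega>
    unfolding \<tau>_def hitting_time_def by (rule Inf_greatest) auto
  have fin: "\<exists>u. \<tau> \<omega> = ereal u \<and> 0 \<le> u \<and> u \<le> t" if "\<tau> \<omega> \<le> ereal t" for \<omega>
    using that nonneg[of \<omega>] by (cases "\<tau> \<omega>") auto
  have g_int: "(\<integral>\<^sup>+\<omega>. g n \<omega> \<partial>P x) =
      (\<integral>\<^sup>+\<omega>. (if \<tau> \<omega> \<le> ereal t then indicator {y} (X t \<omega>) else 0) \<partial>P x)" for n
  proof -
    have "(\<integral>\<^sup>+\<omega>. g n \<omega> \<partial>P x) = (\<Sum>k\<le>Suc n. \<integral>\<^sup>+\<omega>. indicator (A n k) \<omega> * c n k \<omega> \<partial>P x)"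
      unfolding g_def by (rule nn_integral_sum) measurable
    also have "\<dots> = (\<Sum>k\<le>Suc n. \<integral>\<^sup>+\<omega>. indicator (A n k) \<omega> * indicator {y} (X t \<omega>) \<partial>P x)"
    proof (rule sum.cong[OF refl])
      fix k assume "k \<in> {..Suc n}"
      then show "(\<integral>\<^sup>+\<omega>. indicator (A n k) \<omega> * c n k \<omega> \<partial>P x) =
          (\<integral>\<^sup>+\<omega>. indicator (A n k) \<omega> * indicator {y} (X t \<omega>) \<partial>P x)"
        using markov_pmf[OF _ _ A[of n k], where t = "t - real k * \<delta> n" and y = y and x = x] kt[of k n] \<delta>(1)[of n]
        by (simp add: c_def)
    qed
    also have "\<dots> = (\<integral>\<^sup>+\<omega>. (\<Sum>k\<le>Suc n. indicator (A n k) \<omega> * indicator {y} (X t \<omega>)) \<partial>P x)"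
      using t by (intro nn_integral_sum[symmetric]) measurable
    also have "\<dots> = (\<integral>\<^sup>+\<omega>. (if \<tau> \<omega> \<le> ereal t then indicator {y} (X t \<omega>) else 0) \<partial>P x)"
    proof (rule nn_integral_cong)
      fix \<omega> assume "\<omega> \<in> space (P x)"
      then have w: "\<omega> \<in> space M" by simp
      show "(\<Sum>k\<le>Suc n. indicator (A n k) \<omega> * indicator {y} (X t \<omega>)) =
          (if \<tau> \<omega> \<le> ereal t then indicator {y} (X t \<omega>) else 0 :: ennreal)"
      proof (cases "\<tau> \<omega> \<le> ereal t")
        case True
        then obtain u where u: "\<tau> \<omega> = ereal u" "0 \<le> u" "u \<le> t" using fin by blast
        obtain k where "k \<le> Suc n" "\<And>j. indicator (A n j) \<omega> = (if j = k then 1 else 0 :: ennreal)"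
          using single[OF w u, of n] by blast
        then show ?thesis using True by (simp add: if_distrib[of "\<lambda>z. z * _"] cong: if_cong)
      qed (simp add: none)
    qed
    finally show ?thesis .
  qed
  have g_lim: "(\<lambda>n. g n \<omega>) \<longlonglongrightarrow> v \<omega>" if "\<omega> \<in> space (P x)" for \<omega>
  proof (cases "\<tau> \<omega> \<le> ereal t")
    case False
    then show ?thesis by (simp add: g_def v_def none)
  next
    case True
    have w: "\<omega> \<in> space M" using that by simp
    obtain u where u: "\<tau> \<omega> = ereal u" "0 \<le> u" "u \<le> t" using fin True by blast
    have "\<forall>n. \<exists>k. k\<le>Suc n \<and> u \<le> real k * \<delta> n \<and> real k * \<delta> n \<le> u + \<delta> n \<and>
      (\<forall>j. indicator (A n j) \<omega> = (if j = k then 1 else 0 :: ennreal))"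
      using single[OF w u] by blast
    then obtain k where k: "\<And>n. k n \<le> Suc n" "\<And>n. u \<le> real (k n) * \<delta> n"
        "\<And>n. real (k n) * \<delta> n \<le> u + \<delta> n"
        "\<And>n j. indicator (A n j) \<omega> = (if j = k n then 1 else 0 :: ennreal)"
      by metis
    define \<sigma> where "\<sigma> n = real (k n) * \<delta> n" for n
    have geq: "g n \<omega> = ennreal (pmf (kern (t - \<sigma> n) (X (\<sigma> n) \<omega>)) y)" for n
      using k(1)[of n] unfolding g_def
      by (simp add: k(4) c_def \<sigma>_def if_distrib[of "\<lambda>z. z * _"] cong: if_cong)
    have \<delta>0: "\<delta> \<longlonglongrightarrow> 0" unfolding \<delta>_def
      using tendsto_mult[OF tendsto_const[of t] LIMSEQ_inverse_real_of_nat] by (simp add: divide_inverse)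
    have \<sigma>: "\<sigma> \<longlonglongrightarrow> u"
    proof (rule tendsto_sandwich[of "\<lambda>_. u" _ _ "\<lambda>n. u + \<delta> n"])
      show "(\<lambda>n. u + \<delta> n) \<longlonglongrightarrow> u" using tendsto_add[OF tendsto_const \<delta>0, of u] by simp
    qed (use k in \<open>auto simp: \<sigma>_def\<close>)
    obtain e where e: "e > 0" "\<And>s. u \<le> s \<Longrightarrow> s < u + e \<Longrightarrow> X s \<omega> = X u \<omega>"
      using right_cont_interval[OF w u(2)] by blast
    have "\<forall>\<^sub>F n in sequentially. \<sigma> n < u + e"
      using \<sigma> e(1) by (intro order_tendstoD(2)[OF \<sigma>]) auto
    then have ev: "\<forall>\<^sub>F n in sequentially. ennreal (pmf (kern (t - \<sigma> n) (X u \<omega>)) y) = g n \<omega>"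
    proof eventually_elim
      case (elim n)
      then have "X (\<sigma> n) \<omega> = X u \<omega>" using k(2)[of n] by (intro e(2)) (auto simp: \<sigma>_def)
      then show ?case by (simp add: geq)
    qed
    have "(\<lambda>n. ennreal (pmf (kern (t - \<sigma> n) (X u \<omega>)) y)) \<longlonglongrightarrow> ennreal (pmf (kern (t - u) (X u \<omega>)) y)"
      using k(2) kt[OF k(1)] by (intro tendsto_ennrealI kern_tendsto_before \<sigma>) (auto simp: \<sigma>_def)
    then have "(\<lambda>n. g n \<omega>) \<longlonglongrightarrow> ennreal (pmf (kern (t - u) (X u \<omega>)) y)"
      by (rule Lim_transform_eventually[OF _ ev])
    then show ?thesis using True u by (simp add: v_def)
  qed
  show v: "v \<in> borel_measurable (P x)"
    by (rule borel_measurable_LIMSEQ_order[OF g_lim gm])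
  have "(\<lambda>n. \<integral>\<^sup>+\<omega>. g n \<omega> \<partial>P x) \<longlonglongrightarrow> (\<integral>\<^sup>+\<omega>. v \<omega> \<partial>P x)"
  proof (rule nn_integral_dominated_convergence[where w = "\<lambda>_. 1"])
    fix n
    show "AE \<omega> in P x. g n \<omega> \<le> 1"
    proof (rule AE_I2)
      fix \<omega> assume "\<omega> \<in> space (P x)"
      then have w: "\<omega> \<in> space M" by simp
      show "g n \<omega> \<le> 1"
      proof (cases "\<tau> \<omega> \<le> ereal t")
        case True
        then obtain u where u: "\<tau> \<omega> = ereal u" "0 \<le> u" "u \<le> t" using fin by blast
        obtain k where "k \<le> Suc n" "\<And>j. indicator (A n j) \<omega> = (if j = k then 1 else 0 :: ennreal)"
          using single[OF w u, of n] by blast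
        then have "g n \<omega> = c n k \<omega>" by (simp add: g_def if_distrib[of "\<lambda>z. z * _"] cong: if_cong)
        also have "\<dots> \<le> 1" by (simp add: c_def pmf_le_1)
        finally show ?thesis .
      qed (simp add: g_def none)
    qed
  qed (use v gm g_lim in \<open>auto simp: less_top[symmetric]\<close>)
  then have "(\<lambda>n::nat. \<integral>\<^sup>+\<omega>. (if \<tau> \<omega> \<le> ereal t then indicator {y} (X t \<omega>) else 0) \<partial>P x) \<longlonglongrightarrow> (\<integral>\<^sup>+\<omega>. v \<omega> \<partial>P x)"
    by (simp only: g_int)
  then show "(\<integral>\<^sup>+\<omega>. (if \<tau> \<omega> \<le> ereal t then indicator {y} (X t \<omega>) else 0) \<partial>P x) = (\<integral>\<^sup>+\<omega>. v \<omega> \<partial>P x)"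
    by (rule LIMSEQ_unique[OF tendsto_const])
qed

lemma strong_markov:
  fixes f :: "'a option \<Rightarrow> ennreal" and B :: "'a option set"
  defines "\<tau> \<equiv> hitting_time X B"
  assumes t: "0 \<le> t"
  shows "(\<integral>\<^sup>+\<omega>. (if \<tau> \<omega> \<le> ereal t then f (X t \<omega>) else 0) \<partial>P x) =
    (\<integral>\<^sup>+\<omega>. (if \<tau> \<omega> \<le> ereal t
      then \<integral>\<^sup>+y. f y \<partial>kern (t - real_of_ereal (\<tau> \<omega>)) (X (real_of_ereal (\<tau> \<omega>)) \<omega>) else 0) \<partial>P x)"
proof -
  have ev: "{\<omega>\<in>space M. \<tau> \<omega> \<le> ereal t} \<in> sets (P x)"
    using hitting_time_le_in_past[OF t, of B] sets_past_subset laws(2) unfolding \<tau>_def by blast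
  have [measurable]: "Measurable.pred (P x) (\<lambda>\<omega>. \<tau> \<omega> \<le> ereal t)"
    using ev by (simp add: pred_def)
  note [measurable] = X_measurable(2)[OF t]
  have "(\<integral>\<^sup>+\<omega>. (if \<tau> \<omega> \<le> ereal t then f (X t \<omega>) else 0) \<partial>P x) =
    (\<integral>\<^sup>+\<omega>. (\<integral>\<^sup>+y. f y * (if \<tau> \<omega> \<le> ereal t then indicator {y} (X t \<omega>) else 0) \<partial>count_space UNIV) \<partial>P x)"
    by (intro nn_integral_cong) (auto intro: nn_integral_as_sum)
  also have "\<dots> = (\<integral>\<^sup>+y. f y * (\<integral>\<^sup>+\<omega>. (if \<tau> \<omega> \<le> ereal t then indicator {y} (X t \<omega>) else 0) \<partial>P x) \<partial>count_space UNIV)"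
    by (subst nn_integral_count_space_nn_integral) (auto simp: nn_integral_cmult)
  also have "\<dots> = (\<integral>\<^sup>+y. f y * (\<integral>\<^sup>+\<omega>. (if \<tau> \<omega> \<le> ereal t
    then ennreal (pmf (kern (t - real_of_ereal (\<tau> \<omega>)) (X (real_of_ereal (\<tau> \<omega>)) \<omega>)) y) else 0) \<partial>P x) \<partial>count_space UNIV)"
    unfolding \<tau>_def by (subst strong_markov_pmf(2)[OF t]) simp
  also have "\<dots> = (\<integral>\<^sup>+\<omega>. (\<integral>\<^sup>+y. f y * (if \<tau> \<omega> \<le> ereal t
    then ennreal (pmf (kern (t - real_of_ereal (\<tau> \<omega>)) (X (real_of_ereal (\<tau> \<omega>)) \<omega>)) y) else 0) \<partial>count_space UNIV) \<partial>P x)"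
    using strong_markov_pmf(1)[OF t] unfolding \<tau>_def
    by (subst nn_integral_count_space_nn_integral) (auto simp: nn_integral_cmult)
  also have "\<dots> = (\<integral>\<^sup>+\<omega>. (if \<tau> \<omega> \<le> ereal t
      then \<integral>\<^sup>+y. f y \<partial>kern (t - real_of_ereal (\<tau> \<omega>)) (X (real_of_ereal (\<tau> \<omega>)) \<omega>) else 0) \<partial>P x)"
    by (intro nn_integral_cong) (auto simp: nn_integral_measure_pmf mult.commute)
  finally show ?thesis .
qed

end

section \<open>Drift conditions for processes confined to a set\<close>

context absorbed_markov_jump_process
begin

text \<open>
  The Markov property at the last grid point peels off one step, which costs a factor \<open>r\<close> because the
  process is required to be in \<open>G\<close> both before and after it.
\<close>

lemma skeleton_bound:
  fixes w :: "'a option \<Rightarrow> ennreal"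
  assumes h: "0 \<le> h"
    and step: "\<And>y. y \<in> G \<Longrightarrow> (\<integral>\<^sup>+z. w z * indicator G z \<partial>kern h y) \<le> r * w y"
  shows "(\<integral>\<^sup>+\<omega>. indicator {\<omega>\<in>space M. \<forall>k\<le>N. X (real k * h) \<omega> \<in> G} \<omega> * w (X (real N * h) \<omega>) \<partial>P x)
    \<le> r ^ N * w x"
proof (induction N)
  case 0
  have "(\<integral>\<^sup>+\<omega>. indicator {\<omega>\<in>space M. \<forall>k\<le>0. X (real k * h) \<omega> \<in> G} \<omega> * w (X (real 0 * h) \<omega>) \<partial>P x)
      \<le> (\<integral>\<^sup>+\<omega>. w (X 0 \<omega>) \<partial>P x)"
    by (intro nn_integral_mono) (auto split: split_indicator)
  also have "\<dots> = w x" by (simp flip: nn_integral_kern add: kern_0 nn_integral_return)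
  finally show ?case by simp
next
  case (Suc N)
  define A where "A N = {\<omega>\<in>space M. \<forall>k\<le>N. X (real k * h) \<omega> \<in> G}" for N
  have "A N = space M - (\<Union>k\<le>N. X (real k * h) -` (- G) \<inter> space M)"
    unfolding A_def by auto
  also have "\<dots> \<in> sets (past M X (real N * h))"
  proof (intro sets.Diff sets.finite_UN)
    show "space M \<in> sets (past M X (real N * h))"
      using sets.top[of "past M X (real N * h)"] by simp
    fix k assume k: "k \<in> {..N}"
    have "X (real k * h) -` (- G) \<inter> space (past M X (real N * h)) \<in> sets (past M X (real N * h))"
      using h k by (intro measurable_sets[OF X_measurable_past]) (auto intro: mult_right_mono)
    then show "X (real k * h) -` (- G) \<inter> space M \<in> sets (past M X (real N * h))" by simp
  qed auto
  finally have A: "A N \<in> sets (past M X (real N * h))" .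
  have "(\<integral>\<^sup>+\<omega>. indicator (A (Suc N)) \<omega> * w (X (real (Suc N) * h) \<omega>) \<partial>P x)
    = (\<integral>\<^sup>+\<omega>. indicator (A N) \<omega> * (w (X (real N * h + h) \<omega>) * indicator G (X (real N * h + h) \<omega>)) \<partial>P x)"
    by (intro nn_integral_cong)
       (auto simp: A_def le_Suc_eq algebra_simps split: split_indicator)
  also have "\<dots> = (\<integral>\<^sup>+\<omega>. indicator (A N) \<omega> * (\<integral>\<^sup>+z. w z * indicator G z \<partial>kern h (X (real N * h) \<omega>)) \<partial>P x)"
    using h by (intro markov_nn_integral A) auto
  also have "\<dots> \<le> (\<integral>\<^sup>+\<omega>. r * (indicator (A N) \<omega> * w (X (real N * h) \<omega>)) \<partial>P x)"
  proof (intro nn_integral_mono)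
    fix \<omega>
    show "indicator (A N) \<omega> * (\<integral>\<^sup>+z. w z * indicator G z \<partial>kern h (X (real N * h) \<omega>))
        \<le> r * (indicator (A N) \<omega> * w (X (real N * h) \<omega>))"
      using step[of "X (real N * h) \<omega>"] by (auto simp: A_def split: split_indicator)
  qed
  also have "\<dots> = r * (\<integral>\<^sup>+\<omega>. indicator (A N) \<omega> * w (X (real N * h) \<omega>) \<partial>P x)"
  proof (rule nn_integral_cmult)
    have [measurable]: "A N \<in> sets (P x)" using A sets_past_subset laws(2) by blast
    have [measurable]: "X (real N * h) \<in> measurable (P x) (count_space UNIV)"
      using h by (intro X_measurable(2)) simp
    show "(\<lambda>\<omega>. indicator (A N) \<omega> * w (X (real N * h) \<omega>)) \<in> borel_measurable (P x)"
      by measurable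
  qed
  also have "\<dots> \<le> r * (r ^ N * w x)"
    using Suc.IH unfolding A_def by (intro mult_left_mono) auto
  finally show ?case unfolding A_def by (simp add: mult_ac)
qed

lemma rates_sum_reindex:
  assumes "w None = 0"
  shows "(\<lambda>z. q x (Some z) * w (Some z)) summable_on (UNIV - {x}) \<longleftrightarrow>
      (\<lambda>y. q x y * w y) summable_on (UNIV - {Some x})"
    and "(\<Sum>\<^sub>\<infinity>y\<in>UNIV - {Some x}. q x y * w y) = (\<Sum>\<^sub>\<infinity>z\<in>UNIV - {x}. q x (Some z) * w (Some z))"
proof -
  have inj: "inj_on Some (UNIV - {x})" by simp
  have *: "Some ` (UNIV - {x}) = UNIV - {None, Some x}"
    by (auto simp: image_iff)
  have "(\<lambda>y. q x y * w y) summable_on (UNIV - {Some x}) \<longleftrightarrow>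
      (\<lambda>y. q x y * w y) summable_on (Some ` (UNIV - {x}))"
    unfolding * using assms by (intro summable_on_cong_neutral) auto
  then show "(\<lambda>z. q x (Some z) * w (Some z)) summable_on (UNIV - {x}) \<longleftrightarrow>
      (\<lambda>y. q x y * w y) summable_on (UNIV - {Some x})"
    by (simp add: summable_on_reindex[OF inj] o_def)
  have "(\<Sum>\<^sub>\<infinity>y\<in>UNIV - {Some x}. q x y * w y) = (\<Sum>\<^sub>\<infinity>y\<in>Some ` (UNIV - {x}). q x y * w y)"
    unfolding * using assms by (intro infsum_cong_neutral) auto
  then show "(\<Sum>\<^sub>\<infinity>y\<in>UNIV - {Some x}. q x y * w y) = (\<Sum>\<^sub>\<infinity>z\<in>UNIV - {x}. q x (Some z) * w (Some z))"
    by (simp add: infsum_reindex[OF inj] o_def)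
qed

definition exit_rate :: "'a \<Rightarrow> real" where
  "exit_rate x = (\<Sum>\<^sub>\<infinity>y\<in>UNIV - {Some x}. q x y)"

lemma generator_eq:
  assumes "w None = 0" "(\<lambda>z. q x (Some z) * w (Some z)) summable_on (UNIV - {x})"
  shows "generator q w (Some x) =
    (\<Sum>\<^sub>\<infinity>z\<in>UNIV - {x}. q x (Some z) * w (Some z)) - exit_rate x * w (Some x)"
proof -
  have s: "(\<lambda>y. q x y * w y) summable_on (UNIV - {Some x})"
    using rates_sum_reindex(1)[where w = w and x = x] assms by simp
  have "generator q w (Some x) = (\<Sum>\<^sub>\<infinity>y\<in>UNIV - {Some x}. q x y * w y + q x y * - w (Some x))"
    by (simp add: algebra_simps)
  also have "\<dots> = (\<Sum>\<^sub>\<infinity>y\<in>UNIV - {Some x}. q x y * w y) + (\<Sum>\<^sub>\<infinity>y\<in>UNIV - {Some x}. q x y * - w (Some x))"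
    by (intro infsum_add s summable_on_cmult_left rates_summable)
  also have "(\<Sum>\<^sub>\<infinity>y\<in>UNIV - {Some x}. q x y * - w (Some x)) = exit_rate x * - w (Some x)"
    unfolding exit_rate_def by (rule infsum_cmult_left) (use rates_summable in blast)
  finally show ?thesis using rates_sum_reindex(2)[of w x] assms by simp
qed

lemma rate_tendsto:
  "y \<noteq> Some x \<Longrightarrow> ((\<lambda>h. pmf (kern h (Some x)) y / h) \<longlongrightarrow> q x y) (at_right 0)"
  "((\<lambda>h. (1 - pmf (kern h (Some x)) (Some x)) / h) \<longlongrightarrow> exit_rate x) (at_right 0)"
proof -
  have pos: "\<forall>\<^sub>F h in at_right (0::real). 0 < h" by (rule eventually_at_right_less)
  show "y \<noteq> Some x \<Longrightarrow> ((\<lambda>h. pmf (kern h (Some x)) y / h) \<longlongrightarrow> q x y) (at_right 0)"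
  proof (rule Lim_transform_eventually[OF jump_rates[of y x]])
    show "\<forall>\<^sub>F h in at_right 0. \<P>(\<omega> in P (Some x). X h \<omega> = y) / h = pmf (kern h (Some x)) y / h"
      using pos by eventually_elim (simp add: pmf_kern)
  qed
  show "((\<lambda>h. (1 - pmf (kern h (Some x)) (Some x)) / h) \<longlongrightarrow> exit_rate x) (at_right 0)"
    unfolding exit_rate_def
  proof (rule Lim_transform_eventually[OF exit_rates[of x]])
    show "\<forall>\<^sub>F h in at_right 0. (1 - \<P>(\<omega> in P (Some x). X h \<omega> = Some x)) / h =
        (1 - pmf (kern h (Some x)) (Some x)) / h"
      using pos by eventually_elim (simp add: pmf_kern)
  qed
qed

lemma nn_integral_kern_finite:
  assumes "finite G" "\<And>z. z \<in> G \<Longrightarrow> 0 \<le> w (Some z)"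
  shows "(\<integral>\<^sup>+z. ennreal (w z) * indicator (Some ` G) z \<partial>kern h y) =
    ennreal (\<Sum>z\<in>G. pmf (kern h y) (Some z) * w (Some z))"
proof -
  have "(\<integral>\<^sup>+z. ennreal (w z) * indicator (Some ` G) z \<partial>kern h y) =
      (\<Sum>z\<in>Some ` G. ennreal (w z) * emeasure (kern h y) {z})"
    using assms by (intro nn_integral_indicator_finite) auto
  also have "\<dots> = (\<Sum>z\<in>Some ` G. ennreal (pmf (kern h y) z * w z))"
    using assms by (intro sum.cong refl) (auto simp: emeasure_pmf_single ennreal_mult mult.commute)
  also have "\<dots> = ennreal (\<Sum>z\<in>Some ` G. pmf (kern h y) z * w z)"
    using assms by (intro sum_ennreal) auto
  also have "(\<Sum>z\<in>Some ` G. pmf (kern h y) z * w z) = (\<Sum>z\<in>G. pmf (kern h y) (Some z) * w (Some z))"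
    by (subst sum.reindex) (auto simp: o_def)
  finally show ?thesis .
qed

text \<open>
  Only finitely many entries occur, so the first-order expansion of the transition probabilities
  applies to the whole sum.  The expansion uses the jumps inside \<open>G\<close> only; the jumps leaving \<open>G\<close>
  contribute positively to the generator, so the drift condition is only weakened by dropping them.
\<close>

lemma finite_step_bound:
  assumes G: "finite G" and w: "w None = 0" "\<And>z. 1 \<le> w (Some z)"
    and summ: "\<And>x. (\<lambda>z. q x (Some z) * w (Some z)) summable_on (UNIV - {x})"
    and super: "\<And>y. y \<in> G \<Longrightarrow> generator q w (Some y) \<le> c * w (Some y)"
    and e: "0 < e"
  shows "\<forall>\<^sub>F h in at_right 0. \<forall>y\<in>G.
    (\<integral>\<^sup>+z. ennreal (w z) * indicator (Some ` G) z \<partial>kern h (Some y)) \<le>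
      ennreal (exp ((c + e) * h)) * ennreal (w (Some y))"
proof (subst eventually_ball_finite_distrib[OF G], rule ballI)
  fix y assume y: "y \<in> G"
  have w0: "0 \<le> w (Some z)" for z using w(2)[of z] by simp
  have pos: "\<forall>\<^sub>F h in at_right (0::real). 0 < h" by (rule eventually_at_right_less)
  let ?d = "\<lambda>h. (\<Sum>z\<in>G - {y}. pmf (kern h (Some y)) (Some z) / h * w (Some z)) -
      (1 - pmf (kern h (Some y)) (Some y)) / h * w (Some y)"
  have "(?d \<longlongrightarrow> (\<Sum>z\<in>G - {y}. q y (Some z) * w (Some z)) - exit_rate y * w (Some y)) (at_right 0)"
    by (intro tendsto_intros rate_tendsto) auto
  moreover have "(\<Sum>z\<in>G - {y}. q y (Some z) * w (Some z)) \<le>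
      (\<Sum>\<^sub>\<infinity>z\<in>UNIV - {y}. q y (Some z) * w (Some z))"
    using G w0 by (intro finite_sum_le_infsum summ) (auto intro!: mult_nonneg_nonneg rates_nonneg)
  then have "(\<Sum>z\<in>G - {y}. q y (Some z) * w (Some z)) - exit_rate y * w (Some y) \<le> c * w (Some y)"
    using super[OF y] generator_eq[where w = w and x = y] w(1) summ by simp
  then have "(\<Sum>z\<in>G - {y}. q y (Some z) * w (Some z)) - exit_rate y * w (Some y) < (c + e) * w (Some y)"
    using e w(2)[of y] by (simp add: algebra_simps) (smt (verit) mult_pos_pos)
  ultimately have "\<forall>\<^sub>F h in at_right 0. ?d h < (c + e) * w (Some y)"
    by (rule order_tendstoD(2))
  then show "\<forall>\<^sub>F h in at_right 0.
    (\<integral>\<^sup>+z. ennreal (w z) * indicator (Some ` G) z \<partial>kern h (Some y)) \<le>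
      ennreal (exp ((c + e) * h)) * ennreal (w (Some y))"
    using pos
  proof eventually_elim
    case (elim h)
    let ?S = "\<Sum>z\<in>G - {y}. pmf (kern h (Some y)) (Some z) * w (Some z)"
    have "h * ?d h \<le> h * ((c + e) * w (Some y))" using elim by (intro mult_left_mono) auto
    moreover have "h * ?d h = ?S - (1 - pmf (kern h (Some y)) (Some y)) * w (Some y)"
      using elim by (simp add: right_diff_distrib sum_distrib_left)
    moreover have "(\<Sum>z\<in>G. pmf (kern h (Some y)) (Some z) * w (Some z)) =
        ?S + pmf (kern h (Some y)) (Some y) * w (Some y)"
      using G y by (subst sum.remove[of _ y]) auto
    ultimately have "(\<Sum>z\<in>G. pmf (kern h (Some y)) (Some z) * w (Some z)) \<le> (1 + (c + e) * h) * w (Some y)"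
      by (simp add: algebra_simps)
    also have "\<dots> \<le> exp ((c + e) * h) * w (Some y)"
      by (intro mult_right_mono w0 exp_ge_add_one_self)
    finally show ?case
      using G w0 by (simp add: nn_integral_kern_finite flip: ennreal_mult)
  qed
qed

lemma stay_measurable:
  "0 \<le> t \<Longrightarrow> {\<omega>\<in>space M. \<forall>s\<in>{0..t}. X s \<omega> \<in> G} \<in> sets (P x)"
proof -
  assume t: "0 \<le> t"
  have "{\<omega>\<in>space M. \<forall>s\<in>{0..t}. X s \<omega> \<in> G} = space M - {\<omega>\<in>space M. \<exists>s\<in>{0..t}. X s \<omega> \<in> - G}"
    by auto
  also have "\<dots> \<in> sets M"
    using hit_in_past[OF t, of "- G"] sets_past_subset by blast
  finally show ?thesis by (simp add: laws(2))
qed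

text \<open>
  A path that stays in \<open>G\<close> is in \<open>G\<close> at the grid points, so the bound for the skeleton with a fine
  enough mesh applies.  The loss \<open>e\<close> in the exponent comes from the error of the first-order expansion.
\<close>

lemma supersolution_finite:
  assumes G: "finite G" and w: "w None = 0" "\<And>z. 1 \<le> w (Some z)"
    and summ: "\<And>x. (\<lambda>z. q x (Some z) * w (Some z)) summable_on (UNIV - {x})"
    and super: "\<And>y. y \<in> G \<Longrightarrow> generator q w (Some y) \<le> c * w (Some y)"
    and t: "0 \<le> t"
  shows "(\<integral>\<^sup>+\<omega>. indicator {\<omega>\<in>space M. \<forall>s\<in>{0..t}. X s \<omega> \<in> Some ` G} \<omega> * ennreal (w (X t \<omega>)) \<partial>P (Some x))
    \<le> ennreal (exp (c * t) * w (Some x))" (is "?I \<le> _")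
proof -
  have w0: "0 \<le> w (Some z)" for z using w(2)[of z] by simp
  have eps: "?I \<le> ennreal (exp ((c + e) * t) * w (Some x))" if e: "0 < e" for e
  proof -
    let ?P = "\<lambda>h. \<forall>y\<in>G. (\<integral>\<^sup>+z. ennreal (w z) * indicator (Some ` G) z \<partial>kern h (Some y)) \<le>
      ennreal (exp ((c + e) * h)) * ennreal (w (Some y))"
    obtain b where b: "b > 0" "\<And>h. 0 < h \<Longrightarrow> h < b \<Longrightarrow> ?P h"
      using finite_step_bound[OF G w summ super e] unfolding eventually_at_right_field by auto
    \<comment> \<open>The mesh is taken below the threshold of the one-step bound.\<close>
    obtain N where N: "t / b < real N" using reals_Archimedean2 by blast
    define h where "h = t / real N"
    have hb: "h < b" "0 \<le> h" "t = real N * h"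
    proof -
      have "0 < real N" using N t b(1) by (smt (verit) divide_nonneg_pos)
      then show "h < b" "0 \<le> h" "t = real N * h"
        using N t b(1) by (auto simp: h_def field_simps)
    qed
    have step: "(\<integral>\<^sup>+z. ennreal (w z) * indicator (Some ` G) z \<partial>kern h y) \<le>
        ennreal (exp ((c + e) * h)) * ennreal (w y)" if "y \<in> Some ` G" for y
    proof (cases "h = 0")
      case True
      then show ?thesis using that by (auto simp: kern_0 nn_integral_return)
    next
      case False
      then show ?thesis using that b(2)[of h] hb by auto
    qed
    have "?I \<le> (\<integral>\<^sup>+\<omega>. indicator {\<omega>\<in>space M. \<forall>k\<le>N. X (real k * h) \<omega> \<in> Some ` G} \<omega> *
        ennreal (w (X (real N * h) \<omega>)) \<partial>P (Some x))"
    proof (intro nn_integral_mono mult_mono)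
      fix \<omega>
      have "real k * h \<in> {0..t}" if "k \<le> N" for k
        using that hb by (auto intro: mult_right_mono)
      then show "indicator {\<omega>\<in>space M. \<forall>s\<in>{0..t}. X s \<omega> \<in> Some ` G} \<omega> \<le>
          (indicator {\<omega>\<in>space M. \<forall>k\<le>N. X (real k * h) \<omega> \<in> Some ` G} \<omega> :: ennreal)"
        by (auto simp: indicator_def)
      show "ennreal (w (X t \<omega>)) \<le> ennreal (w (X (real N * h) \<omega>))" by (simp add: hb(3))
    qed auto
    also have "\<dots> \<le> ennreal (exp ((c + e) * h)) ^ N * ennreal (w (Some x))"
      by (rule skeleton_bound[OF hb(2) step])
    also have "\<dots> = ennreal (exp ((c + e) * t) * w (Some x))"
      using w0 by (simp add: ennreal_power ennreal_mult hb(3) algebra_simps flip: exp_of_nat_mult)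
    finally show ?thesis .
  qed
  have lim: "((\<lambda>e. ennreal (exp ((c + e) * t) * w (Some x))) \<longlongrightarrow> ennreal (exp ((c + 0) * t) * w (Some x))) (at_right 0)"
    by (intro tendsto_intros)
  have "?I \<le> ennreal (exp ((c + 0) * t) * w (Some x))"
    by (rule tendsto_lowerbound[OF lim])
       (use eventually_at_right_less[of 0] eps in \<open>auto elim: eventually_mono\<close>)
  then show ?thesis by simp
qed

text \<open>
  This is where non-explosion enters: a path that stays in \<open>G\<close> up to time \<open>t\<close> takes finitely many
  values, so it stays in one of the finite sets of an exhaustion of \<open>G\<close>.  Fatou's lemma does the rest.
\<close>

lemma stay_exhaust:
  fixes v :: "'a option \<Rightarrow> ennreal"
  assumes t: "0 \<le> t"
    and bound: "\<And>F. finite F \<Longrightarrow> F \<subseteq> G \<Longrightarrow>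
      (\<integral>\<^sup>+\<omega>. indicator {\<omega>\<in>space M. \<forall>s\<in>{0..t}. X s \<omega> \<in> Some ` F} \<omega> * v (X t \<omega>) \<partial>P x) \<le> b"
  shows "(\<integral>\<^sup>+\<omega>. indicator {\<omega>\<in>space M. \<forall>s\<in>{0..t}. X s \<omega> \<in> Some ` G} \<omega> * v (X t \<omega>) \<partial>P x) \<le> b"
    (is "?I \<le> b")
proof -
  define F where "F n = {z\<in>G. to_nat z \<le> n}" for n
  have F: "finite (F n)" "F n \<subseteq> G" for n
    by (rule finite_subset[of _ "to_nat -` {..n}"]) (auto simp: F_def intro!: finite_vimageI)
  define J where "J n \<omega> = indicator {\<omega>\<in>space M. \<forall>s\<in>{0..t}. X s \<omega> \<in> Some ` F n} \<omega> * v (X t \<omega>)" for n \<omega>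
  have Jm: "J n \<in> borel_measurable (P x)" for n
  proof -
    note [measurable] = stay_measurable[OF t] X_measurable(2)[OF t]
    show ?thesis unfolding J_def by measurable
  qed
  have "?I \<le> (\<integral>\<^sup>+\<omega>. liminf (\<lambda>n. J n \<omega>) \<partial>P x)"
  proof (rule nn_integral_mono_AE)
    show "AE \<omega> in P x. indicator {\<omega>\<in>space M. \<forall>s\<in>{0..t}. X s \<omega> \<in> Some ` G} \<omega> * v (X t \<omega>)
        \<le> liminf (\<lambda>n. J n \<omega>)"
      using non_explosive[of x] AE_space
    proof eventually_elim
      case (elim \<omega>)
      show ?case
      proof (cases "\<forall>s\<in>{0..t}. X s \<omega> \<in> Some ` G")
        case True
        have fin: "finite ((\<lambda>s. X s \<omega>) ` {0..t})" using elim by (intro finite_range) auto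
        define n0 where "n0 = Max ((\<lambda>s. to_nat (the (X s \<omega>))) ` {0..t})"
        have fin': "finite ((\<lambda>s. to_nat (the (X s \<omega>))) ` {0..t})"
          using finite_imageI[OF fin, of "\<lambda>z. to_nat (the z)"] by (simp add: image_image)
        have "\<forall>s\<in>{0..t}. X s \<omega> \<in> Some ` F n" if "n0 \<le> n" for n
        proof
          fix s assume s: "s \<in> {0..t}"
          then have "X s \<omega> \<in> Some ` G" using True by blast
          then obtain z where z: "X s \<omega> = Some z" "z \<in> G" by auto
          have "to_nat (the (X s \<omega>)) \<le> n0" unfolding n0_def using fin' s by (intro Max_ge) auto
          then show "X s \<omega> \<in> Some ` F n" using z that by (auto simp: F_def)
        qed
        then have "\<forall>\<^sub>F n in sequentially. v (X t \<omega>) \<le> J n \<omega>"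
          using elim unfolding eventually_sequentially by (intro exI[of _ n0]) (auto simp: J_def)
        then have "v (X t \<omega>) \<le> liminf (\<lambda>n. J n \<omega>)"
          by (rule Liminf_bounded)
        then show ?thesis by (auto simp: indicator_def)
      qed (auto simp: indicator_def)
    qed
  qed
  also have "\<dots> \<le> liminf (\<lambda>n. \<integral>\<^sup>+\<omega>. J n \<omega> \<partial>P x)"
    by (rule nn_integral_liminf[OF Jm])
  also have "\<dots> \<le> liminf (\<lambda>n. b)"
    unfolding J_def by (intro Liminf_mono always_eventually allI bound F)
  also have "\<dots> = b" by (simp add: Liminf_const)
  finally show ?thesis .
qed

text \<open>
  A path outside the cemetery point at time \<open>t\<close> has not been there before.
\<close>

lemma nn_integral_kern_stay:
  fixes v :: "'a option \<Rightarrow> ennreal"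
  assumes t: "0 \<le> t" and v: "v None = 0"
  shows "(\<integral>\<^sup>+z. v z \<partial>kern t x) \<le>
    (\<integral>\<^sup>+\<omega>. indicator {\<omega>\<in>space M. \<forall>s\<in>{0..t}. X s \<omega> \<in> Some ` UNIV} \<omega> * v (X t \<omega>) \<partial>P x)"
  unfolding nn_integral_kern[OF t]
proof (rule nn_integral_mono_AE)
  show "AE \<omega> in P x. v (X t \<omega>) \<le>
      indicator {\<omega>\<in>space M. \<forall>s\<in>{0..t}. X s \<omega> \<in> Some ` UNIV} \<omega> * v (X t \<omega>)"
    using absorbed[of x] AE_space
  proof eventually_elim
    case (elim \<omega>)
    show ?case
    proof (cases "X t \<omega>")
      case (Some b)
      then have "\<forall>s\<in>{0..t}. X s \<omega> \<in> Some ` UNIV"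
        using elim by (metis atLeastAtMost_iff notin_range_Some option.distinct(1))
      then show ?thesis using elim by (simp add: indicator_def)
    qed (simp add: v)
  qed
qed

text \<open>
  The comparison principle that replaces Dynkin's formula and optional stopping: a function with
  \<open>L w \<le> c w\<close> on \<open>G\<close> grows at most like \<open>exp (c t)\<close> as long as the process stays in \<open>G\<close>.
\<close>

lemma supersolution:
  assumes w: "w None = 0" "\<And>z. 1 \<le> w (Some z)"
    and summ: "\<And>x. (\<lambda>z. q x (Some z) * w (Some z)) summable_on (UNIV - {x})"
    and super: "\<And>y. y \<in> G \<Longrightarrow> generator q w (Some y) \<le> c * w (Some y)"
    and t: "0 \<le> t"
  shows "(\<integral>\<^sup>+\<omega>. indicator {\<omega>\<in>space M. \<forall>s\<in>{0..t}. X s \<omega> \<in> Some ` G} \<omega> * ennreal (w (X t \<omega>)) \<partial>P (Some x))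
    \<le> ennreal (exp (c * t) * w (Some x))"
proof (rule stay_exhaust[where v = "\<lambda>z. ennreal (w z)", OF t])
  fix F assume "finite F" "F \<subseteq> G"
  then show "(\<integral>\<^sup>+\<omega>. indicator {\<omega>\<in>space M. \<forall>s\<in>{0..t}. X s \<omega> \<in> Some ` F} \<omega> * ennreal (w (X t \<omega>)) \<partial>P (Some x))
      \<le> ennreal (exp (c * t) * w (Some x))"
    using super by (intro supersolution_finite t w summ) blast+
qed

lemma semigroup_growth:
  assumes w: "w None = 0" "\<And>z. 1 \<le> w (Some z)"
    and summ: "\<And>x. (\<lambda>z. q x (Some z) * w (Some z)) summable_on (UNIV - {x})"
    and super: "\<And>y. generator q w (Some y) \<le> c * w (Some y)"
    and t: "0 \<le> t"
  shows "(\<integral>\<^sup>+z. ennreal (w z) \<partial>kern t x) \<le> ennreal (exp (c * t) * w x)"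
proof (cases x)
  case None
  then show ?thesis using t w by (simp add: kern_None nn_integral_return)
next
  case (Some a)
  have "(\<integral>\<^sup>+z. ennreal (w z) \<partial>kern t x) \<le>
      (\<integral>\<^sup>+\<omega>. indicator {\<omega>\<in>space M. \<forall>s\<in>{0..t}. X s \<omega> \<in> Some ` UNIV} \<omega> * ennreal (w (X t \<omega>)) \<partial>P x)"
    using t w(1) by (intro nn_integral_kern_stay) auto
  also have "\<dots> \<le> ennreal (exp (c * t) * w x)"
    unfolding Some by (rule supersolution[OF w summ super t])
  finally show ?thesis .
qed

text \<open>
  If the process starts in \<open>x\<close> and is elsewhere at time \<open>t\<close>, then along any grid it leaves \<open>x\<close> in some
  step, to a state \<open>z\<close> say.  The expected value of \<open>w(X\<^sub>t)\<close> after that step is at most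
  \<open>exp (c t) w(z)\<close>.  Summing over the \<open>N\<close> steps gives \<open>N\<close> times the one-step transition
  probabilities, which tend to \<open>t\<close> times the rates.
\<close>

lemma offdiagonal_finite:
  assumes w: "w None = 0" "\<And>z. 1 \<le> w (Some z)"
    and summ: "\<And>x. (\<lambda>z. q x (Some z) * w (Some z)) summable_on (UNIV - {x})"
    and super: "\<And>y. generator q w (Some y) \<le> c * w (Some y)"
    and c: "0 \<le> c" and t: "0 < t" and F: "finite F"
  shows "(\<integral>\<^sup>+\<omega>. indicator {\<omega>\<in>space M. \<forall>s\<in>{0..t}. X s \<omega> \<in> Some ` F} \<omega> *
      (ennreal (w (X t \<omega>)) * indicator (- {Some x}) (X t \<omega>)) \<partial>P (Some x))
    \<le> ennreal (t * exp (c * t) * (\<Sum>\<^sub>\<infinity>z\<in>UNIV - {x}. q x (Some z) * w (Some z)))"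
    (is "?I \<le> _")
proof -
  interpret prob_space "P (Some x)" by (rule laws)
  have w0: "0 \<le> w z" for z
  proof (cases z)
    case (Some a)
    then show ?thesis using w(2)[of a] by simp
  qed (simp add: w(1))
  let ?S = "\<lambda>\<delta>. \<Sum>z\<in>F - {x}. pmf (kern \<delta> (Some x)) (Some z) * w (Some z)"
  let ?g = "\<lambda>z. ennreal (w z) * indicator (Some ` (F - {x})) z"
  have bound: "?I \<le> ennreal (t * exp (c * t) *
      (\<Sum>z\<in>F - {x}. pmf (kern (t / real (Suc n)) (Some x)) (Some z) / (t / real (Suc n)) * w (Some z)))" for n
  proof -
    define N where "N = Suc n"
    define \<delta> where "\<delta> = t / real N"
    have \<delta>: "0 < \<delta>" "real N * \<delta> = t" using t by (auto simp: \<delta>_def N_def)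
    define B where "B k = {\<omega>\<in>space M. X (real k * \<delta>) \<omega> = Some x \<and> X (real k * \<delta> + \<delta>) \<omega> \<in> Some ` (F - {x})}" for k
    define B0 where "B0 k = {\<omega>\<in>space M. X (real k * \<delta>) \<omega> = Some x}" for k
    have B0: "B0 k \<in> sets (past M X (real k * \<delta>))" for k
    proof -
      have "X (real k * \<delta>) -` {Some x} \<inter> space (past M X (real k * \<delta>)) \<in> sets (past M X (real k * \<delta>))"
        using \<delta> by (intro measurable_sets[OF X_measurable_past]) auto
      then show ?thesis by (simp add: B0_def vimage_def Int_def conj_commute)
    qed
    have B: "B k \<in> sets (past M X (real k * \<delta> + \<delta>))" for k
    proof -
      let ?M = "past M X (real k * \<delta> + \<delta>)"
      have "(X (real k * \<delta>) -` {Some x} \<inter> space ?M) \<inter> (X (real k * \<delta> + \<delta>) -` (Some ` (F - {x})) \<inter> space ?M) \<in> sets ?M"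
        using \<delta> by (intro sets.Int measurable_sets[OF X_measurable_past]) auto
      moreover have "(X (real k * \<delta>) -` {Some x} \<inter> space ?M) \<inter> (X (real k * \<delta> + \<delta>) -` (Some ` (F - {x})) \<inter> space ?M) = B k"
        by (auto simp: B_def)
      ultimately show ?thesis by simp
    qed
    have [measurable]: "B k \<in> sets (P (Some x))" for k
      using B sets_past_subset laws(2) by blast
    note [measurable] = X_measurable(2)[OF less_imp_le[OF t]]
    have "?I \<le> (\<integral>\<^sup>+\<omega>. (\<Sum>k<N. indicator (B k) \<omega> * ennreal (w (X t \<omega>))) \<partial>P (Some x))"
    proof (rule nn_integral_mono_AE)
      show "AE \<omega> in P (Some x). indicator {\<omega>\<in>space M. \<forall>s\<in>{0..t}. X s \<omega> \<in> Some ` F} \<omega> *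
          (ennreal (w (X t \<omega>)) * indicator (- {Some x}) (X t \<omega>)) \<le>
          (\<Sum>k<N. indicator (B k) \<omega> * ennreal (w (X t \<omega>)))"
        using start[of "Some x"] AE_space
      proof eventually_elim
        case (elim \<omega>)
        show ?case
        proof (cases "(\<forall>s\<in>{0..t}. X s \<omega> \<in> Some ` F) \<and> X t \<omega> \<noteq> Some x")
          case True
          have "\<exists>k<N. X (real k * \<delta>) \<omega> = Some x \<and> X (real (Suc k) * \<delta>) \<omega> \<noteq> Some x"
          proof (rule ccontr)
            assume no: "\<not> ?thesis"
            have "k \<le> N \<Longrightarrow> X (real k * \<delta>) \<omega> = Some x" for k
              by (induction k) (use elim no in \<open>auto simp: Suc_le_eq\<close>)
            then show False using True \<delta>(2) by auto
          qed
          then obtain k where k: "k < N" "X (real k * \<delta>) \<omega> = Some x" "X (real (Suc k) * \<delta>) \<omega> \<noteq> Some x"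
            by blast
          have "real (Suc k) * \<delta> \<le> real N * \<delta>" using k(1) \<delta>(1) by (intro mult_right_mono) auto
          then have "real (Suc k) * \<delta> \<in> {0..t}" using \<delta> by auto
          then have "X (real (Suc k) * \<delta>) \<omega> \<in> Some ` F" using True by blast
          then have "\<omega> \<in> B k" using k elim by (auto simp: B_def algebra_simps)
          then have "ennreal (w (X t \<omega>)) \<le> indicator (B k) \<omega> * ennreal (w (X t \<omega>))" by simp
          also have "\<dots> \<le> (\<Sum>k<N. indicator (B k) \<omega> * ennreal (w (X t \<omega>)))"
            using k(1) by (intro member_le_sum) auto
          finally show ?thesis by (auto simp: indicator_def)
        qed (auto simp: indicator_def)
      qed
    qed
    also have "\<dots> = (\<Sum>k<N. \<integral>\<^sup>+\<omega>. indicator (B k) \<omega> * ennreal (w (X t \<omega>)) \<partial>P (Some x))"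
      by (rule nn_integral_sum) measurable
    also have "\<dots> \<le> (\<Sum>k<N. ennreal (exp (c * t)) * ennreal (?S \<delta>))"
    proof (rule sum_mono)
      fix k assume "k \<in> {..<N}"
      then have "real (Suc k) * \<delta> \<le> real N * \<delta>" using \<delta>(1) by (intro mult_right_mono) auto
      then have kt: "real k * \<delta> + \<delta> \<le> t" using \<delta> by (simp add: algebra_simps)
      define r where "r = t - (real k * \<delta> + \<delta>)"
      have "0 \<le> real k * \<delta>" using \<delta>(1) by simp
      then have r: "0 \<le> r" "r \<le> t" "t = (real k * \<delta> + \<delta>) + r" using kt \<delta>(1) unfolding r_def by linarith+
      have "(\<integral>\<^sup>+\<omega>. indicator (B k) \<omega> * ennreal (w (X t \<omega>)) \<partial>P (Some x)) =
          (\<integral>\<^sup>+\<omega>. indicator (B k) \<omega> * (\<integral>\<^sup>+z. ennreal (w z) \<partial>kern r (X (real k * \<delta> + \<delta>) \<omega>)) \<partial>P (Some x))"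
        unfolding r(3) using \<delta> r by (intro markov_nn_integral B) auto
      also have "\<dots> \<le> (\<integral>\<^sup>+\<omega>. ennreal (exp (c * t)) * (indicator (B0 k) \<omega> * ?g (X (real k * \<delta> + \<delta>) \<omega>)) \<partial>P (Some x))"
      proof (rule nn_integral_mono)
        fix \<omega>
        let ?y = "X (real k * \<delta> + \<delta>) \<omega>"
        have "(\<integral>\<^sup>+z. ennreal (w z) \<partial>kern r ?y) \<le> ennreal (exp (c * r) * w ?y)"
          by (rule semigroup_growth[OF w summ super r(1)])
        also have "\<dots> \<le> ennreal (exp (c * t) * w ?y)"
          using r c w0 by (intro ennreal_leI mult_right_mono) (auto intro: mult_left_mono)
        finally show "indicator (B k) \<omega> * (\<integral>\<^sup>+z. ennreal (w z) \<partial>kern r ?y) \<le>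
            ennreal (exp (c * t)) * (indicator (B0 k) \<omega> * ?g ?y)"
          using w0 by (auto simp: B_def B0_def indicator_def ennreal_mult)
      qed
      also have "\<dots> = ennreal (exp (c * t)) * (\<integral>\<^sup>+\<omega>. indicator (B0 k) \<omega> * ?g (X (real k * \<delta> + \<delta>) \<omega>) \<partial>P (Some x))"
      proof (rule nn_integral_cmult)
        have [measurable]: "B0 k \<in> sets (P (Some x))"
          using B0 sets_past_subset laws(2) by blast
        have [measurable]: "X (real k * \<delta> + \<delta>) \<in> measurable (P (Some x)) (count_space UNIV)"
          using \<delta> by (intro X_measurable(2)) simp
        show "(\<lambda>\<omega>. indicator (B0 k) \<omega> * ?g (X (real k * \<delta> + \<delta>) \<omega>)) \<in> borel_measurable (P (Some x))"
          by measurable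
      qed
      also have "(\<integral>\<^sup>+\<omega>. indicator (B0 k) \<omega> * ?g (X (real k * \<delta> + \<delta>) \<omega>) \<partial>P (Some x)) =
          (\<integral>\<^sup>+\<omega>. indicator (B0 k) \<omega> * (\<integral>\<^sup>+z. ?g z \<partial>kern \<delta> (X (real k * \<delta>) \<omega>)) \<partial>P (Some x))"
        using \<delta> by (intro markov_nn_integral B0) auto
      also have "\<dots> \<le> (\<integral>\<^sup>+\<omega>. (\<integral>\<^sup>+z. ?g z \<partial>kern \<delta> (Some x)) \<partial>P (Some x))"
        by (intro nn_integral_mono) (auto simp: B0_def indicator_def)
      also have "\<dots> = (\<integral>\<^sup>+z. ?g z \<partial>kern \<delta> (Some x))"
        using emeasure_space_1 by simp
      also have "\<dots> = ennreal (?S \<delta>)" using F w0 by (intro nn_integral_kern_finite) auto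
      finally show "(\<integral>\<^sup>+\<omega>. indicator (B k) \<omega> * ennreal (w (X t \<omega>)) \<partial>P (Some x)) \<le>
          ennreal (exp (c * t)) * ennreal (?S \<delta>)"
        by (simp add: mult_left_mono)
    qed
    also have "\<dots> = ennreal (real N * (exp (c * t) * ?S \<delta>))"
      using w0 by (simp add: ennreal_mult sum_nonneg ennreal_of_nat_eq_real_of_nat)
    also have "real N * (exp (c * t) * ?S \<delta>) = t * exp (c * t) *
      (\<Sum>z\<in>F - {x}. pmf (kern \<delta> (Some x)) (Some z) / \<delta> * w (Some z))"
      using \<delta> by (simp add: sum_divide_distrib[symmetric] field_simps flip: \<delta>(2))
    finally show ?thesis by (simp only: \<delta>_def N_def)
  qed
  have \<delta>lim: "filterlim (\<lambda>n. t / real (Suc n)) (at_right 0) sequentially"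
  proof (rule tendsto_imp_filterlim_at_right)
    show "(\<lambda>n. t / real (Suc n)) \<longlonglongrightarrow> 0"
      using tendsto_mult[OF tendsto_const[of t] LIMSEQ_inverse_real_of_nat] by (simp add: divide_inverse)
  qed (use t in auto)
  have "(\<lambda>n. ennreal (t * exp (c * t) *
      (\<Sum>z\<in>F - {x}. pmf (kern (t / real (Suc n)) (Some x)) (Some z) / (t / real (Suc n)) * w (Some z))))
      \<longlonglongrightarrow> ennreal (t * exp (c * t) * (\<Sum>z\<in>F - {x}. q x (Some z) * w (Some z)))"
    by (intro tendsto_intros filterlim_compose[OF rate_tendsto(1) \<delta>lim]) auto
  then have "?I \<le> ennreal (t * exp (c * t) * (\<Sum>z\<in>F - {x}. q x (Some z) * w (Some z)))"
    by (rule LIMSEQ_le_const) (use bound in blast)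
  also have "\<dots> \<le> ennreal (t * exp (c * t) * (\<Sum>\<^sub>\<infinity>z\<in>UNIV - {x}. q x (Some z) * w (Some z)))"
    using F w0 t by (intro ennreal_leI mult_left_mono finite_sum_le_infsum summ)
      (auto intro!: mult_nonneg_nonneg rates_nonneg)
  finally show ?thesis .
qed

text \<open>
  To first order in \<open>t\<close> the right-hand side is \<open>t\<close> times the sum of \<open>q(x,z) w(z)\<close>.  It is the upper bound
  needed to differentiate the semigroup at time \<open>0\<close> inside the infinite sum; the matching lower bound
  is Fatou's lemma.
\<close>

lemma offdiagonal_bound:
  assumes w: "w None = 0" "\<And>z. 1 \<le> w (Some z)"
    and summ: "\<And>x. (\<lambda>z. q x (Some z) * w (Some z)) summable_on (UNIV - {x})"
    and super: "\<And>y. generator q w (Some y) \<le> c * w (Some y)"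
    and c: "0 \<le> c" and t: "0 < t"
  shows "(\<integral>\<^sup>+z. ennreal (w z) * indicator (- {Some x}) z \<partial>kern t (Some x)) \<le>
    ennreal (t * exp (c * t) * (\<Sum>\<^sub>\<infinity>z\<in>UNIV - {x}. q x (Some z) * w (Some z)))" (is "?L \<le> ?R")
proof -
  let ?v = "\<lambda>z. ennreal (w z) * indicator (- {Some x}) z"
  have "?L \<le> (\<integral>\<^sup>+\<omega>. indicator {\<omega>\<in>space M. \<forall>s\<in>{0..t}. X s \<omega> \<in> Some ` UNIV} \<omega> * ?v (X t \<omega>) \<partial>P (Some x))"
    using t w(1) by (intro nn_integral_kern_stay) auto
  also have "\<dots> \<le> ?R"
  proof (rule stay_exhaust[where v = ?v])
    fix F :: "'a set" assume "finite F"
    then show "(\<integral>\<^sup>+\<omega>. indicator {\<omega>\<in>space M. \<forall>s\<in>{0..t}. X s \<omega> \<in> Some ` F} \<omega> * ?v (X t \<omega>) \<partial>P (Some x)) \<le> ?R"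
      by (rule offdiagonal_finite[OF w summ super c t])
  qed (use t in simp)
  finally show ?thesis .
qed

end

section \<open>Harris contraction relative to a nonnegative eigenfunction\<close>

lemma expectation_ge_point:
  assumes "integrable (measure_pmf p) h" "\<And>y. 0 \<le> h y"
  shows "pmf p y * h y \<le> measure_pmf.expectation p h"
proof -
  have "pmf p y * h y = measure_pmf.expectation p (\<lambda>z. h y * indicator {y} z)"
    by (simp add: measure_pmf_single)
  also have "\<dots> \<le> measure_pmf.expectation p h"
  proof (rule integral_mono)
    show "integrable (measure_pmf p) (\<lambda>z. h y * indicator {y} z)"
      using assms(2) by (intro measure_pmf.integrable_const_bound[where B = "h y"]) (auto simp: indicator_def)
  qed (use assms in \<open>auto simp: indicator_def\<close>)
  finally show ?thesis .
qed

text \<open>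
  The space of functions bounded by a multiple of a fixed weight.  The kernels below act on it because
  they integrate the weight.
\<close>

locale weight_function =
  fixes \<phi> :: "'s \<Rightarrow> real"
  assumes phi_nonneg: "\<And>x. 0 \<le> \<phi> x"
begin

definition dominated :: "('s \<Rightarrow> real) \<Rightarrow> bool" where
  "dominated f \<longleftrightarrow> (\<exists>D. \<forall>x. \<bar>f x\<bar> \<le> D * \<phi> x)"

lemma dominatedI: "(\<And>x. \<bar>f x\<bar> \<le> D * \<phi> x) \<Longrightarrow> dominated f"
  unfolding dominated_def by blast

lemma dominatedE:
  assumes "dominated f" obtains D where "0 \<le> D" "\<And>x. \<bar>f x\<bar> \<le> D * \<phi> x"
proof -
  obtain D where D: "\<And>x. \<bar>f x\<bar> \<le> D * \<phi> x" using assms unfolding dominated_def by blast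
  have "\<bar>f x\<bar> \<le> \<bar>D\<bar> * \<phi> x" for x
    using D[of x] mult_right_mono[OF abs_ge_self[of D] phi_nonneg[of x]] by linarith
  then show thesis using that[of "\<bar>D\<bar>"] by simp
qed

lemma dominated_phi: "dominated \<phi>" using phi_nonneg by (intro dominatedI[of _ 1]) simp

lemma dominated_cmult: "dominated f \<Longrightarrow> dominated (\<lambda>x. c * f x)"
proof (erule dominatedE)
  fix D assume "\<And>x. \<bar>f x\<bar> \<le> D * \<phi> x"
  then show "dominated (\<lambda>x. c * f x)"
    by (intro dominatedI[of _ "\<bar>c\<bar> * D"]) (simp add: abs_mult mult.assoc mult_left_mono)
qed

lemma dominated_add: assumes "dominated f" "dominated g" shows "dominated (\<lambda>x. f x + g x)"
proof -
  obtain D where D: "\<And>x. \<bar>f x\<bar> \<le> D * \<phi> x" using assms(1) dominatedE by blast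
  obtain E where E: "\<And>x. \<bar>g x\<bar> \<le> E * \<phi> x" using assms(2) dominatedE by blast
  show ?thesis
  proof (rule dominatedI[of _ "D + E"])
    fix x
    show "\<bar>f x + g x\<bar> \<le> (D + E) * \<phi> x"
      using D[of x] E[of x] abs_triangle_ineq[of "f x" "g x"] by (simp add: algebra_simps)
  qed
qed

lemma dominated_diff: "dominated f \<Longrightarrow> dominated g \<Longrightarrow> dominated (\<lambda>x. f x - g x)"
  using dominated_add[of f "\<lambda>x. (-1) * g x"] dominated_cmult[of g "-1"] by simp

lemma dominated_integrable:
  assumes "integrable (measure_pmf p) \<phi>" "dominated f"
  shows "integrable (measure_pmf p) f"
proof -
  obtain D where D: "0 \<le> D" "\<And>x. \<bar>f x\<bar> \<le> D * \<phi> x" using assms(2) dominatedE by blast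
  show ?thesis
  proof (rule Bochner_Integration.integrable_bound)
    show "integrable (measure_pmf p) (\<lambda>x. D * \<phi> x)" by (intro integrable_mult_right assms)
    show "AE y in measure_pmf p. norm (f y) \<le> norm (D * \<phi> y)"
      using D phi_nonneg by (intro AE_I2) (simp add: abs_mult)
  qed simp
qed

end

text \<open>
  The setting of Harris' theorem for the positive operator \<open>T f = R K f\<close>, relative to a fixed point
  \<open>\<eta>\<close> of \<open>T\<close>.  Dividing by \<open>\<eta>\<close> would turn \<open>T\<close> into a Markov kernel with Lyapunov function
  \<open>\<phi> / \<eta>\<close>, for which the last two assumptions are the usual drift and minorization conditions.  The
  division is avoided throughout, because \<open>\<eta>\<close> vanishes at states from which \<open>x0\<close> cannot be reached.
\<close>

locale harris_kernel = weight_function \<phi> for \<phi> :: "'s \<Rightarrow> real" +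
  fixes K :: "'s \<Rightarrow> 's pmf" and R \<gamma> \<kappa> B a Rad :: real
    and \<eta> :: "'s \<Rightarrow> real" and x0 :: 's
  assumes R: "0 < R"
    and phi_integrable: "\<And>x. integrable (K x) \<phi>"
    and eta: "\<And>x. 0 \<le> \<eta> x" "\<And>x. \<eta> x \<le> B * \<phi> x" "0 < \<eta> x0"
    and eta_fixed: "\<And>x. R * measure_pmf.expectation (K x) \<eta> = \<eta> x"
    and drift: "\<And>x. R * measure_pmf.expectation (K x) \<phi> \<le> \<gamma> * \<phi> x + \<kappa> * \<eta> x"
    and constants: "0 \<le> \<gamma>" "\<gamma> < 1" "0 \<le> \<kappa>" "0 \<le> B" "0 < a" "2 * \<kappa> / (1 - \<gamma>) < Rad"
    and minorization: "\<And>x. \<phi> x \<le> Rad * \<eta> x \<Longrightarrow> a * \<eta> x \<le> R * pmf (K x) x0"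
begin

lemmas phi = phi_nonneg phi_integrable

definition T :: "('s \<Rightarrow> real) \<Rightarrow> 's \<Rightarrow> real" where
  "T f x = R * measure_pmf.expectation (K x) f"

lemma dominated_eta: "dominated \<eta>" using eta by (intro dominatedI[of _ B]) simp

lemma T_add: "dominated f \<Longrightarrow> dominated g \<Longrightarrow> T (\<lambda>x. f x + g x) x = T f x + T g x"
  unfolding T_def by (simp add: dominated_integrable[OF phi_integrable] distrib_left)

lemma T_diff: "dominated f \<Longrightarrow> dominated g \<Longrightarrow> T (\<lambda>x. f x - g x) x = T f x - T g x"
  unfolding T_def by (simp add: dominated_integrable[OF phi_integrable] right_diff_distrib)

lemma T_cmult: "T (\<lambda>x. c * f x) x = c * T f x"
  unfolding T_def by simp

lemma T_mono: "dominated f \<Longrightarrow> dominated g \<Longrightarrow> (\<And>y. f y \<le> g y) \<Longrightarrow> T f x \<le> T g x"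
  unfolding T_def using R by (intro mult_left_mono integral_mono dominated_integrable[OF phi_integrable]) auto

lemma T_abs_le:
  assumes "dominated f" "dominated g" "\<And>y. \<bar>f y\<bar> \<le> g y"
  shows "\<bar>T f x\<bar> \<le> T g x"
proof -
  have "T f x \<le> T g x" using assms by (intro T_mono) (auto simp: abs_le_iff)
  moreover have "T (\<lambda>y. (-1) * f y) x \<le> T g x"
    using assms by (intro T_mono dominated_cmult) (auto simp: abs_le_iff)
  ultimately show ?thesis using T_cmult[of "-1" f x] by (simp add: abs_le_iff)
qed

lemma T_eta: "T \<eta> = \<eta>" unfolding T_def using eta_fixed by auto

lemma T_phi_le: "T \<phi> x \<le> (\<gamma> + \<kappa> * B) * \<phi> x"
proof -
  have "\<kappa> * \<eta> x \<le> \<kappa> * (B * \<phi> x)" using eta constants by (intro mult_left_mono) auto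
  then show ?thesis using drift[of x] unfolding T_def by (simp add: algebra_simps)
qed

lemma dominated_T: assumes "dominated f" shows "dominated (T f)"
proof -
  obtain D where D: "0 \<le> D" "\<And>x. \<bar>f x\<bar> \<le> D * \<phi> x" using assms dominatedE by blast
  show ?thesis
  proof (rule dominatedI[of _ "D * (\<gamma> + \<kappa> * B)"])
    fix x
    have "\<bar>T f x\<bar> \<le> T (\<lambda>y. D * \<phi> y) x"
      by (intro T_abs_le assms dominated_cmult dominated_phi D)
    also have "\<dots> = D * T \<phi> x" by (rule T_cmult)
    also have "\<dots> \<le> D * ((\<gamma> + \<kappa> * B) * \<phi> x)" by (intro mult_left_mono T_phi_le D)
    finally show "\<bar>T f x\<bar> \<le> D * (\<gamma> + \<kappa> * B) * \<phi> x" by (simp add: mult.assoc)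
  qed
qed

lemma T_ge_point: assumes "dominated h" "\<And>y. 0 \<le> h y" shows "R * pmf (K x) x0 * h x0 \<le> T h x"
  using expectation_ge_point[OF dominated_integrable[OF phi_integrable assms(1)] assms(2), of x x0] R
  unfolding T_def by (simp add: mult.assoc)

text \<open>
  The weight of \<open>\<phi>\<close> against \<open>\<eta>\<close> in the contracting seminorm, chosen so small that the additive part
  \<open>\<beta> \<kappa>\<close> of the drift uses up only half of the gain \<open>a \<eta>(x0)\<close> from the minorization.
\<close>

definition \<beta> :: real where "\<beta> = a * \<eta> x0 / (2 * (\<kappa> + 1))"

definition W :: "'s \<Rightarrow> real" where "W x = \<eta> x + \<beta> * \<phi> x"

text \<open>
  After division by \<open>\<eta> x * \<eta> y\<close>, the oscillation of \<open>f / \<eta>\<close> is measured in the metric of Hairer and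
  Mattingly, namely \<open>2 + \<beta> V x + \<beta> V y\<close> with \<open>V = \<phi> / \<eta>\<close>.
\<close>

definition osc_bound :: "('s \<Rightarrow> real) \<Rightarrow> real \<Rightarrow> bool" where
  "osc_bound f D \<longleftrightarrow> (\<forall>x y. \<bar>f x * \<eta> y - f y * \<eta> x\<bar> \<le> D * (W x * \<eta> y + W y * \<eta> x))"

lemma beta: "0 < \<beta>" "\<beta> * \<kappa> \<le> a * \<eta> x0 / 2"
proof -
  show "0 < \<beta>" unfolding \<beta>_def using constants eta by (intro divide_pos_pos mult_pos_pos) auto
  have "\<beta> * \<kappa> = a * \<eta> x0 / 2 * (\<kappa> / (\<kappa> + 1))" unfolding \<beta>_def using constants by (simp add: field_simps)
  also have "\<dots> \<le> a * \<eta> x0 / 2 * 1"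
    using constants eta by (intro mult_left_mono) (auto simp: divide_simps)
  finally show "\<beta> * \<kappa> \<le> a * \<eta> x0 / 2" by simp
qed

lemma dominated_W: "dominated W"
  unfolding W_def by (intro dominated_add dominated_cmult dominated_eta dominated_phi)

lemma T_W_le: "T W x \<le> (1 + \<beta> * \<kappa>) * \<eta> x + \<beta> * \<gamma> * \<phi> x"
proof -
  have "T W x = \<eta> x + \<beta> * T \<phi> x"
    unfolding W_def by (simp add: T_add T_cmult dominated_cmult dominated_eta dominated_phi T_eta)
  moreover have "\<beta> * T \<phi> x \<le> \<beta> * (\<gamma> * \<phi> x + \<kappa> * \<eta> x)"
    using drift[of x] beta unfolding T_def by (intro mult_left_mono) auto
  ultimately show ?thesis by (simp add: algebra_simps)
qed

text \<open>
  The oscillation bound says that the intervals of radius \<open>D W x / \<eta> x\<close> around \<open>f x / \<eta> x\<close> meet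
  pairwise, hence they have a common point, namely the supremum of the left endpoints.  At a zero of
  \<open>\<eta>\<close> the bound on \<open>f\<close> itself is the oscillation bound for the pair \<open>(x, x0)\<close>.
\<close>

lemma osc_bound_shift:
  assumes osc: "osc_bound f D" and D: "0 \<le> D"
  shows "\<exists>c. \<forall>x. \<bar>f x - c * \<eta> x\<bar> \<le> D * W x"
proof -
  let ?S = "(\<lambda>x. (f x - D * W x) / \<eta> x) ` {x. 0 < \<eta> x}"
  have le: "(f x - D * W x) / \<eta> x \<le> (f y + D * W y) / \<eta> y" if "0 < \<eta> x" "0 < \<eta> y" for x y
  proof -
    have "f x * \<eta> y - f y * \<eta> x \<le> D * (W x * \<eta> y + W y * \<eta> x)"
      using osc unfolding osc_bound_def by (meson abs_le_D1)
    then show ?thesis using that by (simp add: divide_simps algebra_simps)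
  qed
  have bdd: "bdd_above ?S"
    unfolding bdd_above_def using le[OF _ eta(3)] by blast
  define c where "c = Sup ?S"
  show ?thesis
  proof (intro exI[of _ c] allI)
    fix x
    show "\<bar>f x - c * \<eta> x\<bar> \<le> D * W x"
    proof (cases "0 < \<eta> x")
      case True
      have "(f x - D * W x) / \<eta> x \<le> c"
        unfolding c_def using True bdd by (intro cSup_upper) auto
      moreover have "c \<le> (f x + D * W x) / \<eta> x"
        unfolding c_def using True eta(3) le by (intro cSup_least) auto
      ultimately show ?thesis using True by (simp add: field_simps abs_le_iff)
    next
      case False
      then have "\<eta> x = 0" using eta(1)[of x] by simp
      moreover have "\<bar>f x * \<eta> x0 - f x0 * \<eta> x\<bar> \<le> D * (W x * \<eta> x0 + W x0 * \<eta> x)"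
        using osc unfolding osc_bound_def by blast
      ultimately have "\<bar>f x\<bar> * \<eta> x0 \<le> D * W x * \<eta> x0"
        using eta(3) by (simp add: abs_mult mult.assoc)
      then show ?thesis using eta(3) \<open>\<eta> x = 0\<close> by simp
    qed
  qed
qed

text \<open>
  The three lower bounds are those required, in this order, by the drift, by the minorization for pairs
  in the sublevel set, and by the excess of the radius \<open>Rad\<close> over \<open>2 \<kappa> / (1 - \<gamma>)\<close> for the other pairs.
\<close>

definition \<alpha> :: real where
  "\<alpha> = max \<gamma> (max (1 - a * \<eta> x0 / 2) (1 - \<beta> * ((1 - \<gamma>) * Rad - 2 * \<kappa>) / (2 + \<beta> * Rad)))"

lemma Rad: "0 < Rad" "0 < (1 - \<gamma>) * Rad - 2 * \<kappa>"
proof -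
  have "0 \<le> 2 * \<kappa> / (1 - \<gamma>)" using constants by simp
  then show "0 < Rad" using constants(6) by linarith
  show "0 < (1 - \<gamma>) * Rad - 2 * \<kappa>" using constants by (simp add: field_simps)
qed

lemma alpha: "0 \<le> \<alpha>" "\<alpha> < 1" "\<gamma> \<le> \<alpha>" "1 - a * \<eta> x0 / 2 \<le> \<alpha>"
    "(1 - \<alpha>) * (2 + \<beta> * Rad) \<le> \<beta> * ((1 - \<gamma>) * Rad - 2 * \<kappa>)"
proof -
  have pos: "0 < 2 + \<beta> * Rad" using beta Rad by (simp add: add_pos_pos)
  show "0 \<le> \<alpha>" "\<gamma> \<le> \<alpha>" "1 - a * \<eta> x0 / 2 \<le> \<alpha>" using constants by (auto simp: \<alpha>_def)
  have "0 < \<beta> * ((1 - \<gamma>) * Rad - 2 * \<kappa>) / (2 + \<beta> * Rad)"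
    using beta Rad pos by (intro divide_pos_pos mult_pos_pos) auto
  then show "\<alpha> < 1" using constants eta(3) by (auto simp: \<alpha>_def)
  have "1 - \<beta> * ((1 - \<gamma>) * Rad - 2 * \<kappa>) / (2 + \<beta> * Rad) \<le> \<alpha>" by (simp add: \<alpha>_def)
  then have "1 - \<alpha> \<le> \<beta> * ((1 - \<gamma>) * Rad - 2 * \<kappa>) / (2 + \<beta> * Rad)" by linarith
  then show "(1 - \<alpha>) * (2 + \<beta> * Rad) \<le> \<beta> * ((1 - \<gamma>) * Rad - 2 * \<kappa>)"
    using pos by (simp add: pos_le_divide_eq)
qed

text \<open>
  Let \<open>E = \<eta> x * \<eta> y\<close> and \<open>S = \<phi> x * \<eta> y + \<phi> y * \<eta> x\<close>.  If \<open>S\<close> is large compared with \<open>E\<close>, the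
  drift alone contracts.  Otherwise \<open>x\<close> and \<open>y\<close> both lie in the sublevel set, and the mass at \<open>x0\<close>
  that the minorization provides at both points cancels in the difference.
\<close>

lemma osc_contraction:
  assumes f: "dominated f" and osc: "osc_bound f D" and D: "0 \<le> D"
  shows "osc_bound (T f) (\<alpha> * D)"
  unfolding osc_bound_def
proof (intro allI)
  fix x y
  obtain c where c: "\<And>z. \<bar>f z - c * \<eta> z\<bar> \<le> D * W z" using osc_bound_shift[OF osc D] by blast
  define g where "g z = f z - c * \<eta> z" for z
  have g: "dominated g" unfolding g_def by (intro dominated_diff f dominated_cmult dominated_eta)
  have DW: "dominated (\<lambda>z. D * W z)" by (intro dominated_cmult dominated_W)
  have Tg: "T g z = T f z - c * \<eta> z" for z
    unfolding g_def by (simp add: T_diff f dominated_cmult dominated_eta T_cmult T_eta)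
  have eq: "T f x * \<eta> y - T f y * \<eta> x = T g x * \<eta> y - T g y * \<eta> x"
    unfolding Tg by (simp add: algebra_simps)
  have gW: "\<bar>g z\<bar> \<le> D * W z" for z using c by (simp add: g_def)
  define E where "E = \<eta> x * \<eta> y"
  define S where "S = \<phi> x * \<eta> y + \<phi> y * \<eta> x"
  have ES: "0 \<le> E" "0 \<le> S" using eta phi by (auto simp: E_def S_def)
  have W2: "W x * \<eta> y + W y * \<eta> x = 2 * E + \<beta> * S"
    by (simp add: W_def E_def S_def algebra_simps)
  have TW2: "T W x * \<eta> y + T W y * \<eta> x \<le> 2 * (1 + \<beta> * \<kappa>) * E + \<beta> * \<gamma> * S"
  proof -
    have "T W x * \<eta> y + T W y * \<eta> x \<le>
      ((1 + \<beta> * \<kappa>) * \<eta> x + \<beta> * \<gamma> * \<phi> x) * \<eta> y + ((1 + \<beta> * \<kappa>) * \<eta> y + \<beta> * \<gamma> * \<phi> y) * \<eta> x"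
      by (intro add_mono mult_right_mono T_W_le eta)
    also have "\<dots> = 2 * (1 + \<beta> * \<kappa>) * E + \<beta> * \<gamma> * S"
      by (simp add: E_def S_def algebra_simps)
    finally show ?thesis .
  qed
  show "\<bar>T f x * \<eta> y - T f y * \<eta> x\<bar> \<le> \<alpha> * D * (W x * \<eta> y + W y * \<eta> x)"
  proof (cases "Rad * E \<le> S")
    case True
    have Tgb: "\<bar>T g z\<bar> \<le> D * T W z" for z
      using T_abs_le[OF g DW gW, of z] by (simp add: T_cmult)
    have "\<bar>T g x * \<eta> y - T g y * \<eta> x\<bar> \<le> \<bar>T g x\<bar> * \<eta> y + \<bar>T g y\<bar> * \<eta> x"
      using abs_triangle_ineq4[of "T g x * \<eta> y" "T g y * \<eta> x"] eta by (simp add: abs_mult)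
    also have "\<dots> \<le> D * T W x * \<eta> y + D * T W y * \<eta> x"
      by (intro add_mono mult_right_mono Tgb eta)
    also have "\<dots> = D * (T W x * \<eta> y + T W y * \<eta> x)" by (simp add: algebra_simps)
    also have "\<dots> \<le> D * (\<alpha> * (2 * E + \<beta> * S))"
    proof (rule mult_left_mono[OF _ D])
      \<comment> \<open>The claim is multiplied by Rad, since \<open>Rad * E \<le> S\<close> turns all terms into multiples of S.\<close>
      define m where "m = 1 - \<alpha>"
      have m: "0 \<le> m" "m * (2 + \<beta> * Rad) \<le> \<beta> * ((1 - \<gamma>) * Rad - 2 * \<kappa>)"
        using alpha by (auto simp: m_def)
      have "Rad * (m * (2 * E + \<beta> * S)) = 2 * m * (Rad * E) + m * \<beta> * Rad * S"
        by (simp add: algebra_simps)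
      also have "\<dots> \<le> 2 * m * S + m * \<beta> * Rad * S"
        using True m by (intro add_right_mono mult_left_mono) auto
      also have "\<dots> = m * (2 + \<beta> * Rad) * S" by (simp add: algebra_simps)
      also have "\<dots> \<le> \<beta> * ((1 - \<gamma>) * Rad - 2 * \<kappa>) * S"
        by (intro mult_right_mono m ES)
      also have "\<dots> = \<beta> * (1 - \<gamma>) * Rad * S - 2 * \<beta> * \<kappa> * S" by (simp add: algebra_simps)
      also have "\<dots> \<le> \<beta> * (1 - \<gamma>) * Rad * S - 2 * \<beta> * \<kappa> * (Rad * E)"
        using True beta constants by (intro diff_left_mono mult_left_mono) auto
      also have "\<dots> = Rad * (\<beta> * (1 - \<gamma>) * S - 2 * \<beta> * \<kappa> * E)" by (simp add: algebra_simps)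
      finally have "m * (2 * E + \<beta> * S) \<le> \<beta> * (1 - \<gamma>) * S - 2 * \<beta> * \<kappa> * E"
        using Rad(1) by simp
      then have "2 * (1 + \<beta> * \<kappa>) * E + \<beta> * \<gamma> * S \<le> \<alpha> * (2 * E + \<beta> * S)"
        by (simp add: m_def algebra_simps)
      then show "T W x * \<eta> y + T W y * \<eta> x \<le> \<alpha> * (2 * E + \<beta> * S)" using TW2 by linarith
    qed
    finally show ?thesis unfolding eq W2 by (simp add: mult_ac)
  next
    case False
    then have SE: "S < Rad * E" by simp
    then have "0 < E" using ES Rad(1) by (smt (verit) mult_nonneg_nonpos)
    then have pos: "0 < \<eta> x" "0 < \<eta> y"
      using eta(1)[of x] eta(1)[of y] unfolding E_def by (auto simp: zero_less_mult_iff)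
    have small: "\<phi> x \<le> Rad * \<eta> x" "\<phi> y \<le> Rad * \<eta> y"
    proof -
      have "0 \<le> \<phi> x * \<eta> y" "0 \<le> \<phi> y * \<eta> x" using phi(1) eta(1) by auto
      then have "\<phi> x * \<eta> y \<le> Rad * \<eta> x * \<eta> y" "\<phi> y * \<eta> x \<le> Rad * \<eta> y * \<eta> x"
        using SE unfolding S_def E_def by (auto simp: algebra_simps)
      then show "\<phi> x \<le> Rad * \<eta> x" "\<phi> y \<le> Rad * \<eta> y" using pos by auto
    qed
    have near: "\<bar>T g z - a * \<eta> z * g x0\<bar> \<le> D * (T W z - a * \<eta> z * W x0)" if z: "\<phi> z \<le> Rad * \<eta> z" for z
    proof -
      have low: "a * \<eta> z * h x0 \<le> T h z" if "dominated h" "\<And>y. 0 \<le> h y" for h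
      proof -
        have "a * \<eta> z * h x0 \<le> R * pmf (K z) x0 * h x0"
          by (intro mult_right_mono minorization z that)
        also have "\<dots> \<le> T h z" by (rule T_ge_point[OF that])
        finally show ?thesis .
      qed
      have "a * \<eta> z * (D * W x0 - g x0) \<le> T (\<lambda>y. D * W y - g y) z"
        using gW by (intro low dominated_diff DW g) (simp add: abs_le_iff)
      moreover have "a * \<eta> z * (D * W x0 + g x0) \<le> T (\<lambda>y. D * W y + g y) z"
      proof (intro low dominated_add DW g)
        show "0 \<le> D * W y + g y" for y using gW[of y] by linarith
      qed
      ultimately show ?thesis
        by (simp add: T_diff T_add DW g T_cmult abs_le_iff algebra_simps)
    qed
    have "T g x * \<eta> y - T g y * \<eta> x =
        (T g x - a * \<eta> x * g x0) * \<eta> y - (T g y - a * \<eta> y * g x0) * \<eta> x"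
      by (simp add: algebra_simps)
    also have "\<bar>\<dots>\<bar> \<le> \<bar>T g x - a * \<eta> x * g x0\<bar> * \<eta> y + \<bar>T g y - a * \<eta> y * g x0\<bar> * \<eta> x"
      using abs_triangle_ineq4[of "(T g x - a * \<eta> x * g x0) * \<eta> y" "(T g y - a * \<eta> y * g x0) * \<eta> x"] eta
      by (simp add: abs_mult)
    also have "\<dots> \<le> D * (T W x - a * \<eta> x * W x0) * \<eta> y + D * (T W y - a * \<eta> y * W x0) * \<eta> x"
      by (intro add_mono mult_right_mono near small eta)
    also have "\<dots> = D * (T W x * \<eta> y + T W y * \<eta> x - 2 * a * W x0 * E)"
      by (simp add: E_def algebra_simps)
    also have "\<dots> \<le> D * (\<alpha> * (2 * E + \<beta> * S))"
    proof (rule mult_left_mono[OF _ D])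
      have "\<eta> x0 \<le> W x0" unfolding W_def using beta phi by simp
      then have "a * \<eta> x0 * E \<le> a * W x0 * E"
        using constants ES by (intro mult_right_mono mult_left_mono) auto
      moreover have "\<beta> * \<kappa> * E \<le> a * \<eta> x0 / 2 * E" by (intro mult_right_mono beta ES)
      moreover have "(1 - a * \<eta> x0 / 2) * E \<le> \<alpha> * E" by (intro mult_right_mono alpha ES)
      moreover have "\<gamma> * (\<beta> * S) \<le> \<alpha> * (\<beta> * S)" using ES beta by (intro mult_right_mono alpha) auto
      ultimately have "2 * (1 + \<beta> * \<kappa>) * E + \<beta> * \<gamma> * S - 2 * a * W x0 * E \<le> \<alpha> * (2 * E + \<beta> * S)"
        by (simp add: algebra_simps)
      then show "T W x * \<eta> y + T W y * \<eta> x - 2 * a * W x0 * E \<le> \<alpha> * (2 * E + \<beta> * S)"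
        using TW2 by linarith
    qed
    finally show ?thesis unfolding eq W2 by (simp add: mult_ac)
  qed
qed

lemma dominated_T_power: "dominated f \<Longrightarrow> dominated ((T ^^ n) f)"
  by (induction n) (auto intro: dominated_T)

lemma T_power_shift:
  "dominated f \<Longrightarrow> (T ^^ n) (\<lambda>x. f x - c * \<eta> x) x = (T ^^ n) f x - c * \<eta> x"
proof (induction n arbitrary: x)
  case (Suc n)
  have "(T ^^ n) (\<lambda>x. f x - c * \<eta> x) = (\<lambda>x. (T ^^ n) f x - c * \<eta> x)" using Suc by blast
  then have "(T ^^ Suc n) (\<lambda>x. f x - c * \<eta> x) x = T (\<lambda>x. (T ^^ n) f x - c * \<eta> x) x" by simp
  also have "\<dots> = T ((T ^^ n) f) x - c * \<eta> x"
    by (simp add: T_diff dominated_T_power Suc.prems dominated_cmult dominated_eta T_cmult T_eta)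
  finally show ?case by simp
qed simp

lemma T_power_abs_le:
  assumes "dominated f" "dominated g" "\<And>x. \<bar>f x\<bar> \<le> g x"
  shows "\<bar>(T ^^ n) f x\<bar> \<le> (T ^^ n) g x"
proof (induction n arbitrary: x)
  case (Suc n)
  then show ?case using assms by (simp add: T_abs_le dominated_T_power)
qed (use assms in simp)

lemma T_power_cmult: "(T ^^ n) (\<lambda>x. c * f x) x = c * (T ^^ n) f x"
proof (induction n arbitrary: x)
  case (Suc n)
  have "(T ^^ n) (\<lambda>x. c * f x) = (\<lambda>x. c * (T ^^ n) f x)" using Suc by blast
  then show ?case by (simp add: T_cmult)
qed simp

lemma T_power_phi_le: "(T ^^ n) \<phi> x \<le> (1 + \<kappa> * B / (1 - \<gamma>)) * \<phi> x"
proof -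
  \<comment> \<open>The partial sums of the geometric series \<open>\<kappa> \<gamma>\<^sup>k\<close>, the total input of the drift after n steps.\<close>
  define s where "s n = \<kappa> * (1 - \<gamma> ^ n) / (1 - \<gamma>)" for n
  have s_Suc: "s n + \<kappa> * \<gamma> ^ n = s (Suc n)" for n
    using constants by (simp add: s_def field_simps)
  have le: "(T ^^ n) \<phi> x \<le> \<gamma> ^ n * \<phi> x + s n * \<eta> x"
  proof (induction n arbitrary: x)
    case 0
    then show ?case by (simp add: s_def)
  next
    case (Suc n)
    have "(T ^^ Suc n) \<phi> x \<le> T (\<lambda>x. \<gamma> ^ n * \<phi> x + s n * \<eta> x) x"
      unfolding funpow.simps o_apply
      by (intro T_mono dominated_T_power dominated_add dominated_cmult dominated_phi dominated_eta Suc)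
    also have "\<dots> = \<gamma> ^ n * T \<phi> x + s n * \<eta> x"
      by (simp only: T_add dominated_cmult dominated_phi dominated_eta T_cmult T_eta)
    also have "\<dots> \<le> \<gamma> ^ n * (\<gamma> * \<phi> x + \<kappa> * \<eta> x) + s n * \<eta> x"
      using drift[of x] constants unfolding T_def by (intro add_right_mono mult_left_mono) auto
    also have "\<dots> = \<gamma> ^ Suc n * \<phi> x + s (Suc n) * \<eta> x"
      by (simp add: algebra_simps flip: s_Suc)
    finally show ?case .
  qed
  have pw: "0 \<le> \<gamma> ^ n" "\<gamma> ^ n \<le> 1" using constants by (auto intro: power_le_one)
  have "s n \<le> \<kappa> / (1 - \<gamma>)"
    unfolding s_def using constants pw by (intro divide_right_mono) (auto simp: mult_left_le)
  then have "s n * \<eta> x \<le> \<kappa> / (1 - \<gamma>) * (B * \<phi> x)"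
    using eta constants by (intro mult_mono) auto
  moreover have "\<gamma> ^ n * \<phi> x \<le> 1 * \<phi> x" using pw phi by (intro mult_right_mono) auto
  ultimately show ?thesis using le by (simp add: algebra_simps)
qed

text \<open>
  Contraction of the oscillation puts \<open>T\<^sup>n f\<close> within distance \<open>\<alpha>\<^sup>n\<close> of some multiple \<open>c\<^sub>n \<eta>\<close>.  Since all
  later iterates stay near \<open>c\<^sub>n \<eta>\<close> as well, the values at \<open>x0\<close> form a Cauchy sequence, and the
  multiples \<open>c\<^sub>n\<close> converge at the same rate.
\<close>

theorem geometric_convergence:
  obtains \<rho> A where "0 \<le> \<rho>" "\<rho> < 1" "0 \<le> A"
    "\<And>f. (\<And>x. \<bar>f x\<bar> \<le> \<phi> x) \<Longrightarrow> \<exists>c. \<forall>n x. \<bar>(T ^^ n) f x - c * \<eta> x\<bar> \<le> A * \<rho> ^ n * \<phi> x"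
proof -
  define H where "H = (B + \<beta>) / \<beta> * (1 + \<kappa> * B / (1 - \<gamma>))"
  have H: "0 \<le> H" unfolding H_def using beta constants by (intro mult_nonneg_nonneg) auto
  define A where "A = H * (1 + \<phi> x0 / \<eta> x0 * B)"
  have "\<exists>c. \<forall>n x. \<bar>(T ^^ n) f x - c * \<eta> x\<bar> \<le> A * \<alpha> ^ n * \<phi> x" if f: "\<And>x. \<bar>f x\<bar> \<le> \<phi> x" for f
  proof -
    have dom: "dominated f" using f by (intro dominatedI[of _ 1]) simp
    have osc: "osc_bound ((T ^^ n) f) (\<alpha> ^ n / \<beta>)" for n
    proof (induction n)
      case 0
      have fW: "\<bar>f x\<bar> \<le> 1 / \<beta> * W x" for x
      proof -
        have "\<beta> * \<bar>f x\<bar> \<le> \<beta> * \<phi> x" using f[of x] beta(1) by (intro mult_left_mono) auto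
        then have "\<bar>f x\<bar> * \<beta> \<le> W x"
          using eta(1)[of x] unfolding W_def mult.commute[of _ \<beta>] by linarith
        then show ?thesis using beta(1) by (simp add: pos_le_divide_eq)
      qed
      show ?case
        unfolding osc_bound_def
      proof (intro allI)
        fix x y
        have "\<bar>f x * \<eta> y - f y * \<eta> x\<bar> \<le> \<bar>f x\<bar> * \<eta> y + \<bar>f y\<bar> * \<eta> x"
          using abs_triangle_ineq4[of "f x * \<eta> y" "f y * \<eta> x"] eta by (simp add: abs_mult)
        also have "\<dots> \<le> 1 / \<beta> * W x * \<eta> y + 1 / \<beta> * W y * \<eta> x"
          by (intro add_mono mult_right_mono fW eta)
        finally show "\<bar>(T ^^ 0) f x * \<eta> y - (T ^^ 0) f y * \<eta> x\<bar> \<le> \<alpha> ^ 0 / \<beta> * (W x * \<eta> y + W y * \<eta> x)"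
          by (simp add: algebra_simps)
      qed
    next
      case (Suc n)
      have "0 \<le> \<alpha> ^ n / \<beta>" using alpha beta by simp
      then show ?case using osc_contraction[OF dominated_T_power[OF dom] Suc] by simp
    qed
    have "\<exists>c. \<forall>x. \<bar>(T ^^ n) f x - c * \<eta> x\<bar> \<le> \<alpha> ^ n / \<beta> * W x" for n
      using osc_bound_shift[OF osc[of n]] alpha beta by simp
    then obtain c where c: "\<And>n x. \<bar>(T ^^ n) f x - c n * \<eta> x\<bar> \<le> \<alpha> ^ n / \<beta> * W x" by metis
    have far: "\<bar>(T ^^ m) f x - c n * \<eta> x\<bar> \<le> H * \<alpha> ^ n * \<phi> x" if nm: "n \<le> m" for n m x
    proof -
      obtain k where "m = n + k" using le_Suc_ex[OF nm] by blast
      then have k: "m = k + n" by simp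
      let ?g = "\<lambda>x. (T ^^ n) f x - c n * \<eta> x"
      have g: "dominated ?g"
        by (intro dominated_diff dominated_T_power dom dominated_cmult dominated_eta)
      have Wle: "W x \<le> (B + \<beta>) * \<phi> x" for x using eta(2)[of x] by (simp add: W_def algebra_simps)
      define d where "d = \<alpha> ^ n / \<beta> * (B + \<beta>)"
      have d: "0 \<le> d" unfolding d_def using alpha beta constants by simp
      have gle: "\<bar>?g x\<bar> \<le> d * \<phi> x" for x
      proof -
        have "\<alpha> ^ n / \<beta> * W x \<le> \<alpha> ^ n / \<beta> * ((B + \<beta>) * \<phi> x)"
          using alpha beta by (intro mult_left_mono Wle) auto
        then show ?thesis using c[where n=n and x=x] by (simp only: mult.assoc d_def)
      qed
      have "(T ^^ m) f x - c n * \<eta> x = (T ^^ k) ?g x"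
        using T_power_shift[OF dominated_T_power[OF dom], of k n "c n" x] by (simp add: k funpow_add)
      also have "\<bar>\<dots>\<bar> \<le> (T ^^ k) (\<lambda>x. d * \<phi> x) x"
        by (rule T_power_abs_le[where n = k and x = x, OF g dominated_cmult[OF dominated_phi, of d] gle])
      also have "\<dots> = d * (T ^^ k) \<phi> x"
        by (rule T_power_cmult[where c = d and f = \<phi> and n = k])
      also have "\<dots> \<le> d * ((1 + \<kappa> * B / (1 - \<gamma>)) * \<phi> x)"
        by (intro mult_left_mono[OF T_power_phi_le] d)
      also have "\<dots> = H * \<alpha> ^ n * \<phi> x" by (simp add: H_def d_def)
      finally show ?thesis .
    qed
    define u where "u n = (T ^^ n) f x0 / \<eta> x0" for n
    define h where "h = H * \<phi> x0 / \<eta> x0"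
    have u: "\<bar>u m - c n\<bar> \<le> h * \<alpha> ^ n" if "n \<le> m" for n m
    proof -
      have "u m - c n = ((T ^^ m) f x0 - c n * \<eta> x0) / \<eta> x0" using eta(3) by (simp add: u_def field_simps)
      also have "\<bar>\<dots>\<bar> = \<bar>(T ^^ m) f x0 - c n * \<eta> x0\<bar> / \<eta> x0" using eta(3) by simp
      also have "\<dots> \<le> H * \<alpha> ^ n * \<phi> x0 / \<eta> x0" using eta(3) by (intro divide_right_mono far that) auto
      finally show ?thesis by (simp add: h_def mult_ac)
    qed
    have small: "(\<lambda>n. 2 * h * \<alpha> ^ n) \<longlonglongrightarrow> 0"
      using tendsto_mult[OF tendsto_const LIMSEQ_power_zero[of \<alpha>], of "2 * h"] alpha by simp
    have "Cauchy u"
    proof (rule metric_CauchyI)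
      fix e :: real assume "0 < e"
      then obtain n where n: "2 * h * \<alpha> ^ n < e"
        using order_tendstoD(2)[OF small] by (auto simp: eventually_sequentially)
      have "dist (u i) (u j) < e" if "n \<le> i" "n \<le> j" for i j
        using u[OF that(1)] u[OF that(2)] n by (simp add: dist_real_def abs_le_iff) linarith
      then show "\<exists>M. \<forall>m\<ge>M. \<forall>n\<ge>M. dist (u m) (u n) < e" by blast
    qed
    then obtain d where d: "u \<longlonglongrightarrow> d" using Cauchy_convergent_iff convergentD by blast
    have dc: "\<bar>d - c n\<bar> \<le> h * \<alpha> ^ n" for n
    proof (rule tendsto_upperbound)
      show "(\<lambda>m. \<bar>u m - c n\<bar>) \<longlonglongrightarrow> \<bar>d - c n\<bar>" by (intro tendsto_intros d)
      show "\<forall>\<^sub>F m in sequentially. \<bar>u m - c n\<bar> \<le> h * \<alpha> ^ n"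
        unfolding eventually_sequentially using u by blast
    qed simp
    show ?thesis
    proof (intro exI[of _ d] allI)
      fix n x
      have "\<bar>(T ^^ n) f x - d * \<eta> x\<bar> \<le> \<bar>(T ^^ n) f x - c n * \<eta> x\<bar> + \<bar>d - c n\<bar> * \<eta> x"
      proof -
        have "(T ^^ n) f x - d * \<eta> x = ((T ^^ n) f x - c n * \<eta> x) - (d - c n) * \<eta> x"
          by (simp add: algebra_simps)
        then show ?thesis
          using abs_triangle_ineq4[of "(T ^^ n) f x - c n * \<eta> x" "(d - c n) * \<eta> x"] eta(1)[of x]
          by (simp add: abs_mult)
      qed
      also have "\<dots> \<le> H * \<alpha> ^ n * \<phi> x + h * \<alpha> ^ n * (B * \<phi> x)"
        using dc[of n] eta far[of n n x] alpha by (intro add_mono mult_mono) (auto intro: order_trans[OF abs_ge_zero])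
      also have "\<dots> = A * \<alpha> ^ n * \<phi> x" by (simp add: A_def h_def algebra_simps)
      finally show "\<bar>(T ^^ n) f x - d * \<eta> x\<bar> \<le> A * \<alpha> ^ n * \<phi> x" .
    qed
  qed
  moreover have "0 \<le> A" unfolding A_def using H phi eta constants
    by (intro mult_nonneg_nonneg add_nonneg_nonneg divide_nonneg_nonneg) auto
  ultimately show thesis using that[of \<alpha> A] alpha by blast
qed

end

section \<open>The decay parameter\<close>

lemma Liminf_pos_iff:
  "0 < Liminf at_top (\<lambda>t::real. ereal (f t)) \<longleftrightarrow> (\<exists>c>0. \<forall>\<^sub>F t in at_top. c \<le> f t)"
proof
  assume "0 < Liminf at_top (\<lambda>t. ereal (f t))"
  then obtain c where c: "0 < ereal c" "ereal c < Liminf at_top (\<lambda>t. ereal (f t))"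
    using ereal_dense2 by blast
  have "\<forall>\<^sub>F t in at_top. ereal c < ereal (f t)" using c(2) by (rule less_LiminfD)
  then have "\<forall>\<^sub>F t in at_top. c \<le> f t" by eventually_elim simp
  then show "\<exists>c>0. \<forall>\<^sub>F t in at_top. c \<le> f t" using c(1) by auto
next
  assume "\<exists>c>0. \<forall>\<^sub>F t in at_top. c \<le> f t"
  then obtain c where c: "0 < c" "\<forall>\<^sub>F t in at_top. c \<le> f t" by blast
  have "ereal c \<le> Liminf at_top (\<lambda>t. ereal (f t))"
    using c(2) by (intro Liminf_bounded) simp
  then show "0 < Liminf at_top (\<lambda>t. ereal (f t))" using c(1) by (simp add: less_le_trans[of 0 "ereal c"])
qed

context absorbed_markov_jump_process
begin

lemma kern_add_ge:
  assumes "0 \<le> s" "0 \<le> t"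
  shows "pmf (kern s x) y * pmf (kern t y) z \<le> pmf (kern (s + t) x) z"
proof -
  have "pmf (kern s x) y * pmf (kern t y) z \<le> measure_pmf.expectation (kern s x) (\<lambda>u. pmf (kern t u) z)"
    by (intro expectation_ge_point measure_pmf.integrable_const_bound[where B = 1]) (auto simp: pmf_le_1)
  then show ?thesis using assms by (simp add: kern_add pmf_bind)
qed

lemma kern_self_power:
  assumes "0 \<le> h" shows "pmf (kern h x) x ^ n \<le> pmf (kern (real n * h) x) x"
proof (induction n)
  case (Suc n)
  have "pmf (kern h x) x ^ Suc n \<le> pmf (kern h x) x * pmf (kern (real n * h) x) x"
    using Suc by (simp add: mult_left_mono)
  also have "\<dots> \<le> pmf (kern (h + real n * h) x) x" using assms by (intro kern_add_ge) auto
  finally show ?case by (simp add: algebra_simps)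
qed (simp add: kern_0)

text \<open>
  Near time \<open>0\<close> the return probability is at least \<open>1/2\<close>, and a bounded time is a bounded number of
  such short times.
\<close>

lemma kern_self_lower:
  assumes T: "0 \<le> T"
  obtains c where "0 < c" "\<And>u. 0 \<le> u \<Longrightarrow> u \<le> T \<Longrightarrow> c \<le> pmf (kern u x) x"
proof -
  have "\<forall>\<^sub>F h in at_right 0. 1 / 2 < pmf (kern h x) x"
    using kern_self_tendsto[of x] by (rule order_tendstoD) simp
  then obtain b where b: "0 < b" "\<And>h. 0 < h \<Longrightarrow> h < b \<Longrightarrow> 1 / 2 < pmf (kern h x) x"
    by (auto simp: eventually_at_right_field)
  obtain n where n: "T / b < real n" using reals_Archimedean2 by blast
  have n0: "0 < real n" using n T b(1) by (smt (verit) divide_nonneg_pos)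
  have "(1 / 2) ^ n \<le> pmf (kern u x) x" if u: "0 \<le> u" "u \<le> T" for u
  proof -
    have "u < real n * b" using n u b(1) by (simp add: divide_less_eq)
    then have "u / real n < b" using n0 by (simp add: divide_less_eq mult.commute)
    then have "1 / 2 \<le> pmf (kern (u / real n) x) x"
      using b(2)[of "u / real n"] u n0 by (cases "u = 0") (auto simp: kern_0)
    then have "(1 / 2) ^ n \<le> pmf (kern (u / real n) x) x ^ n" by (intro power_mono) auto
    also have "\<dots> \<le> pmf (kern (real n * (u / real n)) x) x" using u by (intro kern_self_power) simp
    finally show ?thesis using n0 by simp
  qed
  then show thesis using that[of "(1 / 2) ^ n"] by simp
qed

text \<open>
  By supermultiplicativity an exponential lower bound at a single time propagates to all times.
\<close>

lemma kern_self_exponential_lower: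
  fixes n :: nat
  assumes n: "0 < n" and b: "0 \<le> b" and p: "exp (- b * real n) \<le> pmf (kern (real n) x) x"
  obtains c where "0 < c" "\<And>t. 0 \<le> t \<Longrightarrow> c * exp (- b * t) \<le> pmf (kern t x) x"
proof -
  obtain c where c: "0 < c" "\<And>u. 0 \<le> u \<Longrightarrow> u \<le> real n \<Longrightarrow> c \<le> pmf (kern u x) x"
    using kern_self_lower[of "real n" x] by auto
  have "c * exp (- b * t) \<le> pmf (kern t x) x" if t: "0 \<le> t" for t
  proof -
    define k where "k = nat \<lfloor>t / real n\<rfloor>"
    define r where "r = t - real k * real n"
    have "real k \<le> t / real n" "t / real n < real k + 1"
      unfolding k_def using t by (auto simp: of_nat_nat)
    then have r: "0 \<le> r" "r \<le> real n"
      using n by (auto simp: r_def field_simps)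
    have "c * exp (- b * t) \<le> c * exp (- b * real n) ^ k"
    proof -
      have "- b * t \<le> - b * real n * real k"
        using r b mult_left_mono[of "real k * real n" t b] by (simp add: r_def algebra_simps)
      then show ?thesis using c(1) by (simp add: exp_of_nat2_mult[symmetric])
    qed
    also have "\<dots> \<le> pmf (kern r x) x * pmf (kern (real k * real n) x) x"
    proof (rule mult_mono)
      have "exp (- b * real n) ^ k \<le> pmf (kern (real n) x) x ^ k" by (intro power_mono p) simp
      also have "\<dots> \<le> pmf (kern (real k * real n) x) x" by (intro kern_self_power) simp
      finally show "exp (- b * real n) ^ k \<le> pmf (kern (real k * real n) x) x" .
    qed (use c r in auto)
    also have "\<dots> \<le> pmf (kern (r + real k * real n) x) x"
      using r by (intro kern_add_ge) auto
    finally show ?thesis by (simp add: r_def)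
  qed
  then show thesis using that c(1) by blast
qed

text \<open>
  The real exponents over which the decay parameter takes its infimum, with the positive limit inferior
  expressed by an eventual lower bound.
\<close>

definition decay_set :: "'a \<Rightarrow> real set" where
  "decay_set x = {a. 0 < a \<and> (\<exists>c>0. \<forall>\<^sub>F t in at_top. c \<le> exp (a * t) * pmf (kern t (Some x)) (Some x))}"

definition decay_rate :: "'a \<Rightarrow> real" where
  "decay_rate x = Inf (decay_set x)"

lemma decay_parameter_eq_Inf: "decay_parameter P X x = Inf (ereal ` decay_set x)"
proof -
  have "(\<forall>\<^sub>F t in at_top. c \<le> exp (a * t) * \<P>(\<omega> in P (Some x). X t \<omega> = Some x)) \<longleftrightarrow>
      (\<forall>\<^sub>F t in at_top. c \<le> exp (a * t) * pmf (kern t (Some x)) (Some x))" for a c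
    by (rule eventually_subst, rule eventually_mono[OF eventually_ge_at_top[of 0]]) (simp add: pmf_kern)
  then show ?thesis unfolding decay_parameter_def decay_set_def Liminf_pos_iff by simp
qed

lemma decay_setI:
  assumes "0 < a" "b \<le> a" "0 < c" "\<And>t. T \<le> t \<Longrightarrow> c * exp (- b * t) \<le> pmf (kern t (Some x)) (Some x)"
  shows "a \<in> decay_set x"
proof -
  have "c \<le> exp (a * t) * pmf (kern t (Some x)) (Some x)" if t: "max 0 T \<le> t" for t
  proof -
    have "b * t \<le> a * t" using assms(2) t by (intro mult_right_mono) auto
    then have "c * 1 \<le> c * (exp (a * t) * exp (- b * t))"
      using assms(3) by (intro mult_left_mono) (auto simp flip: exp_add)
    also have "\<dots> = exp (a * t) * (c * exp (- b * t))" by simp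
    also have "\<dots> \<le> exp (a * t) * pmf (kern t (Some x)) (Some x)"
      using t by (intro mult_left_mono assms(4)) auto
    finally show ?thesis by simp
  qed
  then have "\<forall>\<^sub>F t in at_top. c \<le> exp (a * t) * pmf (kern t (Some x)) (Some x)"
    unfolding eventually_at_top_linorder by blast
  then show ?thesis using assms unfolding decay_set_def by blast
qed

lemma bdd_below_decay_set: "bdd_below (decay_set x)"
  unfolding decay_set_def by (rule bdd_belowI[of _ 0]) auto

lemma decay_set_nonempty:
  assumes "0 < pmf (kern 1 (Some x)) (Some x)" shows "decay_set x \<noteq> {}"
proof -
  define b where "b = - ln (pmf (kern 1 (Some x)) (Some x))"
  have b: "0 \<le> b" unfolding b_def using assms pmf_le_1 by (simp add: ln_le_zero_iff)
  have "exp (- b * real 1) \<le> pmf (kern (real 1) (Some x)) (Some x)"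
    unfolding b_def using assms by simp
  then obtain c where "0 < c" "\<And>t. 0 \<le> t \<Longrightarrow> c * exp (- b * t) \<le> pmf (kern t (Some x)) (Some x)"
    using kern_self_exponential_lower[of 1 b "Some x"] b by auto
  then have "b + 1 \<in> decay_set x" using b by (intro decay_setI[of _ b c 0]) auto
  then show ?thesis by blast
qed

lemma decay_rate_nonneg:
  "0 < pmf (kern 1 (Some x)) (Some x) \<Longrightarrow> 0 \<le> decay_rate x"
  unfolding decay_rate_def using decay_set_nonempty by (intro cInf_greatest) (auto simp: decay_set_def)

lemma decay_parameter_eq:
  assumes "0 < pmf (kern 1 (Some x)) (Some x)"
  shows "decay_parameter P X x = ereal (decay_rate x)"
  unfolding decay_parameter_eq_Inf decay_rate_def
  using ereal_Inf'[OF bdd_below_decay_set[of x] decay_set_nonempty[OF assms]] by simp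

lemma decay_rate_lower:
  assumes pos: "0 < pmf (kern 1 (Some x)) (Some x)" and g: "decay_rate x < g"
  obtains c where "0 < c" "\<And>t. 0 \<le> t \<Longrightarrow> c * exp (- g * t) \<le> pmf (kern t (Some x)) (Some x)"
proof -
  obtain a where a: "a \<in> decay_set x" "a < g"
    using g cInf_less_iff[OF decay_set_nonempty[OF pos] bdd_below_decay_set] unfolding decay_rate_def by blast
  then obtain c T where a0: "0 < a" and c: "0 < c"
    "\<And>t. T \<le> t \<Longrightarrow> c \<le> exp (a * t) * pmf (kern t (Some x)) (Some x)"
    unfolding decay_set_def eventually_at_top_linorder by blast
  obtain d where d: "0 < d" "\<And>u. 0 \<le> u \<Longrightarrow> u \<le> max 0 T \<Longrightarrow> d \<le> pmf (kern u (Some x)) (Some x)"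
    using kern_self_lower[of "max 0 T" "Some x"] by auto
  have "min c d * exp (- g * t) \<le> pmf (kern t (Some x)) (Some x)" if t: "0 \<le> t" for t
  proof (cases "T \<le> t")
    case True
    have "a * t \<le> g * t" using a t by (intro mult_right_mono) auto
    then have "min c d * exp (- g * t) \<le> c * exp (- (a * t))"
      using c(1) d(1) by (intro mult_mono) auto
    also have "\<dots> \<le> exp (a * t) * pmf (kern t (Some x)) (Some x) * exp (- (a * t))"
      by (intro mult_right_mono c True) simp
    also have "\<dots> = pmf (kern t (Some x)) (Some x)" by (simp add: exp_minus)
    finally show ?thesis .
  next
    case False
    have "0 \<le> g * t" using a a0 t by simp
    then have "min c d * exp (- g * t) \<le> d * 1" using c(1) d(1) by (intro mult_mono) auto
    also have "\<dots> \<le> pmf (kern t (Some x)) (Some x)" using d(2)[of t] t False by simp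
    finally show ?thesis .
  qed
  then show thesis using that[of "min c d"] c(1) d(1) by simp
qed

text \<open>
  A larger value at a single integer time would, by supermultiplicativity, give an exponential lower
  bound at all times with an exponent below the decay parameter.
\<close>

lemma decay_rate_upper:
  assumes pos: "0 < pmf (kern 1 (Some x)) (Some x)"
  shows "pmf (kern (real n) (Some x)) (Some x) \<le> exp (- decay_rate x * real n)"
proof (rule ccontr)
  let ?p = "pmf (kern (real n) (Some x)) (Some x)"
  assume "\<not> ?thesis"
  then have gt: "exp (- decay_rate x * real n) < ?p" by simp
  then have n: "0 < n" by (cases "n = 0") (auto simp: kern_0)
  have p: "0 < ?p" "?p \<le> 1" using gt less_trans[OF exp_gt_zero gt] by (auto simp: pmf_le_1)
  define b where "b = - ln ?p / real n"
  have "ln ?p \<le> 0" using p by simp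
  then have b: "0 \<le> b" unfolding b_def using n by (simp add: divide_nonpos_pos)
  have "ln (exp (- decay_rate x * real n)) < ln ?p" using gt p by (intro ln_less_cancel_iff[THEN iffD2]) auto
  then have "b < decay_rate x" unfolding b_def using n by (simp add: field_simps)
  obtain c where c: "0 < c" "\<And>t. 0 \<le> t \<Longrightarrow> c * exp (- b * t) \<le> pmf (kern t (Some x)) (Some x)"
    using kern_self_exponential_lower[of n b "Some x"] n b p unfolding b_def by auto
  have "(b + decay_rate x) / 2 \<in> decay_set x"
    using b \<open>b < decay_rate x\<close> c by (intro decay_setI[of _ b c 0]) auto
  then have "decay_rate x \<le> (b + decay_rate x) / 2"
    unfolding decay_rate_def by (intro cInf_lower bdd_below_decay_set)
  then show False using \<open>b < decay_rate x\<close> by simp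
qed

text \<open>
  An excursion from \<open>x\<close> through \<open>y\<close> and back bounds \<open>p\<^sub>t(x,x)\<close> below by a multiple of \<open>p\<^sub>t\<^sub>-\<^sub>2(y,y)\<close>.
\<close>

lemma decay_rate_le:
  assumes pos: "0 < pmf (kern 1 (Some y)) (Some y)" "0 < pmf (kern 1 (Some x)) (Some y)"
    "0 < pmf (kern 1 (Some y)) (Some x)"
  shows "decay_rate x \<le> decay_rate y"
proof (rule dense_ge)
  fix g assume g: "decay_rate y < g"
  obtain c where c: "0 < c" "\<And>t. 0 \<le> t \<Longrightarrow> c * exp (- g * t) \<le> pmf (kern t (Some y)) (Some y)"
    using decay_rate_lower[OF pos(1) g] by blast
  let ?d = "pmf (kern 1 (Some x)) (Some y) * c * exp (2 * g) * pmf (kern 1 (Some y)) (Some x)"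
  have "?d * exp (- g * t) \<le> pmf (kern t (Some x)) (Some x)" if t: "2 \<le> t" for t
  proof -
    have "?d * exp (- g * t) =
        pmf (kern 1 (Some x)) (Some y) * ((c * exp (- g * (t - 2))) * pmf (kern 1 (Some y)) (Some x))"
      by (simp add: algebra_simps flip: exp_add)
    also have "\<dots> \<le> pmf (kern 1 (Some x)) (Some y) * (pmf (kern (t - 2) (Some y)) (Some y) * pmf (kern 1 (Some y)) (Some x))"
      using t by (intro mult_left_mono mult_right_mono c) auto
    also have "\<dots> \<le> pmf (kern 1 (Some x)) (Some y) * pmf (kern (t - 2 + 1) (Some y)) (Some x)"
      using t by (intro mult_left_mono kern_add_ge) auto
    also have "\<dots> \<le> pmf (kern (1 + (t - 2 + 1)) (Some x)) (Some x)"
      using t by (intro kern_add_ge) auto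
    finally show ?thesis by simp
  qed
  moreover have "0 < ?d" using pos c(1) by simp
  moreover have "0 < g" using decay_rate_nonneg[OF pos(1)] g by simp
  ultimately have "g \<in> decay_set x" by (intro decay_setI[of g g ?d 2]) auto
  then show "decay_rate x \<le> g" unfolding decay_rate_def by (intro cInf_lower bdd_below_decay_set)
qed

end

section \<open>The killed semigroup and the entrance into the finite set\<close>

text \<open>
  Positive constants chosen for the elements of a finite set have a positive minimum.
\<close>

lemma finite_uniform_positive:
  fixes Q :: "'b \<Rightarrow> real \<Rightarrow> bool"
  assumes "finite D" "\<And>x. x \<in> D \<Longrightarrow> \<exists>c>0. Q x c" "\<And>x c d. Q x c \<Longrightarrow> d \<le> c \<Longrightarrow> Q x d"
  shows "\<exists>c>0. \<forall>x\<in>D. Q x c"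
  using assms(1,2)
proof (induction D rule: finite_induct)
  case empty
  show ?case by (intro exI[of _ 1]) simp
next
  case (insert x D)
  then obtain c where c: "0 < c" "\<forall>x\<in>D. Q x c" by auto
  obtain d where d: "0 < d" "Q x d" using insert.prems by auto
  have "\<forall>y\<in>insert x D. Q y (min c d)"
    using c d assms(3)[of _ c "min c d"] assms(3)[of _ d "min c d"] by simp
  then show ?case using c(1) d(1) by (intro exI[of _ "min c d"]) simp
qed

text \<open>
  The hypotheses of the theorem, with a reference point \<open>x0\<close> of \<open>D0\<close>.
\<close>

locale lyapunov_jump_process = absorbed_markov_jump_process q M P X
  for q :: "'a::countable \<Rightarrow> 'a option \<Rightarrow> real" and M :: "'w measure"
    and P :: "'a option \<Rightarrow> 'w measure" and X :: "real \<Rightarrow> 'w \<Rightarrow> 'a option" +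
  fixes D0 :: "'a set" and x0 :: 'a and C lam0 lam1 :: real and \<phi> :: "'a option \<Rightarrow> real"
  assumes D0: "finite D0" "x0 \<in> D0"
    and positive: "\<And>x y. x \<in> D0 \<Longrightarrow> y \<in> D0 \<Longrightarrow> 0 < pmf (kern 1 (Some x)) (Some y)"
    and lam0: "lam0 = decay_rate x0"
    and lam1: "lam0 < lam1"
    and C: "0 < C"
    and phi_ge_1: "\<And>x. 1 \<le> \<phi> (Some x)"
    and phi_None: "\<phi> None = 0"
    and phi_summable: "\<And>x. (\<lambda>y. q x (Some y) * \<phi> (Some y)) summable_on (UNIV - {x})"
    and phi_drift: "\<And>x. generator q \<phi> (Some x) \<le> - lam1 * \<phi> (Some x) + C * indicator D0 x"

sublocale lyapunov_jump_process \<subseteq> weight_function \<phi>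
proof
  fix x show "0 \<le> \<phi> x"
    using phi_ge_1[of "the x"] phi_None by (cases x) auto
qed

context lyapunov_jump_process
begin

lemma lam0_nonneg: "0 \<le> lam0"
  unfolding lam0 by (intro decay_rate_nonneg positive D0)

lemma phi_generator_le: "generator q \<phi> (Some x) \<le> C * \<phi> (Some x)"
proof -
  have "0 \<le> lam1 * \<phi> (Some x)" using lam0_nonneg lam1 phi_nonneg by simp
  moreover have "C * indicator D0 x \<le> C * \<phi> (Some x)"
    using C phi_ge_1[of x] by (intro mult_left_mono) (auto simp: indicator_def)
  ultimately show ?thesis using phi_drift[of x] by linarith
qed

lemma phi_growth: "0 \<le> t \<Longrightarrow> (\<integral>\<^sup>+z. ennreal (\<phi> z) \<partial>kern t x) \<le> ennreal (exp (C * t) * \<phi> x)"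
  by (rule semigroup_growth[OF phi_None phi_ge_1 phi_summable phi_generator_le])

lemma phi_integrable_kern: assumes "0 \<le> t" shows "integrable (kern t x) \<phi>"
proof (rule integrableI_nonneg)
  show "(\<integral>\<^sup>+z. ennreal (\<phi> z) \<partial>kern t x) < \<infinity>"
    using le_less_trans[OF phi_growth[OF assms]] by simp
qed (use phi_nonneg in auto)

text \<open>
  The semigroup \<open>P\<^sub>t\<close> on functions dominated by \<open>\<phi>\<close>.  Such functions vanish at the cemetery point, so the
  killing needs no separate treatment.
\<close>

definition semi :: "real \<Rightarrow> ('a option \<Rightarrow> real) \<Rightarrow> 'a option \<Rightarrow> real" where
  "semi t f x = measure_pmf.expectation (kern t x) f"

lemma dominated_kern: "0 \<le> t \<Longrightarrow> dominated f \<Longrightarrow> integrable (kern t x) f"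
  by (rule dominated_integrable[OF phi_integrable_kern])

lemma dominated_None: assumes "dominated f" shows "f None = 0"
proof -
  obtain D where "\<And>x. \<bar>f x\<bar> \<le> D * \<phi> x" using assms dominatedE by blast
  from this[of None] show ?thesis by (simp add: phi_None)
qed

lemma semi_add: "0 \<le> t \<Longrightarrow> dominated f \<Longrightarrow> dominated g \<Longrightarrow> semi t (\<lambda>x. f x + g x) x = semi t f x + semi t g x"
  unfolding semi_def by (simp add: dominated_kern)

lemma semi_diff: "0 \<le> t \<Longrightarrow> dominated f \<Longrightarrow> dominated g \<Longrightarrow> semi t (\<lambda>x. f x - g x) x = semi t f x - semi t g x"
  unfolding semi_def by (simp add: dominated_kern)

lemma semi_cmult: "semi t (\<lambda>x. c * f x) x = c * semi t f x"
  unfolding semi_def by simp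

lemma semi_mono: "0 \<le> t \<Longrightarrow> dominated f \<Longrightarrow> dominated g \<Longrightarrow> (\<And>y. f y \<le> g y) \<Longrightarrow> semi t f x \<le> semi t g x"
  unfolding semi_def by (intro integral_mono dominated_kern) auto

lemma semi_nonneg: "(\<And>y. 0 \<le> f y) \<Longrightarrow> 0 \<le> semi t f x"
  unfolding semi_def by (intro integral_nonneg_AE) auto

lemma semi_abs_le:
  assumes "0 \<le> t" "dominated f" "dominated g" "\<And>y. \<bar>f y\<bar> \<le> g y"
  shows "\<bar>semi t f x\<bar> \<le> semi t g x"
proof -
  have "semi t f x \<le> semi t g x" using assms by (intro semi_mono) (auto simp: abs_le_iff)
  moreover have "semi t (\<lambda>y. (-1) * f y) x \<le> semi t g x"
    using assms by (intro semi_mono dominated_cmult) (auto simp: abs_le_iff)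
  ultimately show ?thesis using semi_cmult[of t "-1" f x] by (simp add: abs_le_iff)
qed

lemma semi_0: "semi 0 f x = f x"
  unfolding semi_def by (simp add: kern_0)

lemma semi_None: "0 \<le> t \<Longrightarrow> semi t f None = f None"
  unfolding semi_def by (simp add: kern_None)

lemma ennreal_semi:
  assumes "0 \<le> t" "dominated f" "\<And>y. 0 \<le> f y"
  shows "(\<integral>\<^sup>+z. ennreal (f z) \<partial>kern t x) = ennreal (semi t f x)"
  unfolding semi_def using assms by (intro nn_integral_eq_integral dominated_kern) auto

lemma semi_phi_le: "0 \<le> t \<Longrightarrow> semi t \<phi> x \<le> exp (C * t) * \<phi> x"
proof -
  assume t: "0 \<le> t"
  have "ennreal (semi t \<phi> x) \<le> ennreal (exp (C * t) * \<phi> x)"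
    using phi_growth[OF t, of x] by (simp add: ennreal_semi[OF t dominated_phi phi_nonneg])
  then show ?thesis using phi_nonneg by (simp add: ennreal_le_iff)
qed

lemma dominated_semi:
  assumes "0 \<le> t" "dominated f" shows "dominated (semi t f)"
proof -
  obtain D where D: "0 \<le> D" "\<And>x. \<bar>f x\<bar> \<le> D * \<phi> x" using assms(2) dominatedE by blast
  show ?thesis
  proof (rule dominatedI[of _ "D * exp (C * t)"])
    fix x
    have "\<bar>semi t f x\<bar> \<le> semi t (\<lambda>y. D * \<phi> y) x"
      using assms by (intro semi_abs_le dominated_cmult dominated_phi D)
    also have "\<dots> = D * semi t \<phi> x" by (rule semi_cmult)
    also have "\<dots> \<le> D * (exp (C * t) * \<phi> x)" using assms by (intro mult_left_mono semi_phi_le D)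
    finally show "\<bar>semi t f x\<bar> \<le> D * exp (C * t) * \<phi> x" by (simp add: mult.assoc)
  qed
qed

lemma semi_semi_nonneg:
  assumes "0 \<le> s" "0 \<le> t" "dominated f" "\<And>y. 0 \<le> f y"
  shows "semi (s + t) f x = semi s (semi t f) x"
proof -
  have "ennreal (semi (s + t) f x) = (\<integral>\<^sup>+z. ennreal (f z) \<partial>kern (s + t) x)"
    using assms by (intro ennreal_semi[symmetric]) auto
  also have "\<dots> = (\<integral>\<^sup>+y. \<integral>\<^sup>+z. ennreal (f z) \<partial>kern t y \<partial>kern s x)"
    using assms by (simp add: kern_add)
  also have "\<dots> = (\<integral>\<^sup>+y. ennreal (semi t f y) \<partial>kern s x)"
    using assms by (simp add: ennreal_semi)
  also have "\<dots> = ennreal (semi s (semi t f) x)"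
    using assms by (intro ennreal_semi dominated_semi semi_nonneg)
  finally show ?thesis using assms by (simp add: semi_nonneg)
qed

text \<open>
  Tonelli's theorem gives the nonnegative case; a dominated function is the difference of two nonnegative
  dominated functions.
\<close>

lemma semi_semi:
  assumes "0 \<le> s" "0 \<le> t" "dominated f"
  shows "semi (s + t) f x = semi s (semi t f) x"
proof -
  obtain D where D: "0 \<le> D" "\<And>x. \<bar>f x\<bar> \<le> D * \<phi> x" using assms(3) dominatedE by blast
  define g where "g y = D * \<phi> y" for y
  define h where "h y = f y + g y" for y
  have g: "dominated g" unfolding g_def by (intro dominated_cmult dominated_phi)
  have h: "dominated h" unfolding h_def by (intro dominated_add g assms)
  have g0: "0 \<le> g y" for y unfolding g_def using D(1) phi_nonneg by simp
  have h0: "0 \<le> h y" for y using D(2)[of y] unfolding h_def g_def by linarith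
  have hg: "semi r f y = semi r h y - semi r g y" if "0 \<le> r" for r y
    using semi_add[OF that assms(3) g, of y] unfolding h_def by simp
  have "semi t f = (\<lambda>y. semi t h y - semi t g y)" using hg assms by blast
  then have "semi s (semi t f) x = semi s (semi t h) x - semi s (semi t g) x"
    using semi_diff[OF assms(1) dominated_semi[OF assms(2) h] dominated_semi[OF assms(2) g]] by simp
  also have "\<dots> = semi (s + t) h x - semi (s + t) g x"
    using assms by (simp add: semi_semi_nonneg g h g0 h0)
  also have "\<dots> = semi (s + t) f x" using assms by (intro hg[symmetric]) simp
  finally show ?thesis by simp
qed

lemma semi_ge_point:
  assumes "0 \<le> t" "dominated h" "\<And>y. 0 \<le> h y"
  shows "pmf (kern t x) y * h y \<le> semi t h x"
  unfolding semi_def using assms by (intro expectation_ge_point dominated_kern)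

abbreviation "iD \<equiv> (indicator (Some ` D0) :: 'a option \<Rightarrow> real)"
abbreviation "iE \<equiv> (indicator (range Some) :: 'a option \<Rightarrow> real)"

lemma indicator_le_phi: "indicator (Some ` A) x \<le> \<phi> x"
  using phi_ge_1 phi_nonneg by (cases x) (auto simp: indicator_def)

lemma dominated_indicator: "dominated (indicator (Some ` A))"
  using indicator_le_phi by (intro dominatedI[of _ 1]) (simp add: indicator_def)

lemma semi_indicator: "semi t (indicator {y}) x = pmf (kern t x) y"
  unfolding semi_def by (simp add: measure_pmf_single)

abbreviation "\<tau> \<equiv> hitting_time X (Some ` D0)"

lemma tau_cases:
  assumes "\<omega> \<in> space M" "0 \<le> t" "\<tau> \<omega> \<le> ereal t"
  obtains u a where "\<tau> \<omega> = ereal u" "0 \<le> u" "u \<le> t" "X u \<omega> = Some a" "a \<in> D0"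
proof -
  have fin: "\<tau> \<omega> < \<infinity>" using assms(3) by auto
  show thesis
  proof (rule hitting_time_attained[OF assms(1) fin])
    fix u assume u: "0 \<le> u" "\<tau> \<omega> = ereal u" and hit: "X u \<omega> \<in> Some ` D0"
    obtain a where "X u \<omega> = Some a" "a \<in> D0" by (rule imageE[OF hit])
    moreover have "u \<le> t" using u(2) assms(3) by simp
    ultimately show thesis using that u by blast
  qed
qed

lemma pred_tau:
  assumes "0 \<le> t"
  shows "Measurable.pred (P x) (\<lambda>\<omega>. \<tau> \<omega> \<le> ereal t)" "Measurable.pred (P x) (\<lambda>\<omega>. ereal t < \<tau> \<omega>)"
proof -
  have "{\<omega>\<in>space M. \<tau> \<omega> \<le> ereal t} \<in> sets (P x)"
    using hitting_time_le_in_past[OF assms, of "Some ` D0"] sets_past_subset laws(2) by blast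
  then show 1: "Measurable.pred (P x) (\<lambda>\<omega>. \<tau> \<omega> \<le> ereal t)" by (simp add: pred_def)
  show "Measurable.pred (P x) (\<lambda>\<omega>. ereal t < \<tau> \<omega>)"
    using pred_intros_logic(2)[OF 1] by (simp add: not_le)
qed

text \<open>
  Splitting at the entrance time is the only way in which the following estimates use the paths.
\<close>

lemma semi_entrance:
  assumes t: "0 \<le> t" and f: "dominated f" "\<And>y. 0 \<le> f y"
  shows "ennreal (semi t f x) =
    (\<integral>\<^sup>+\<omega>. (if ereal t < \<tau> \<omega> then ennreal (f (X t \<omega>)) else 0) \<partial>P x) +
    (\<integral>\<^sup>+\<omega>. (if \<tau> \<omega> \<le> ereal t
      then ennreal (semi (t - real_of_ereal (\<tau> \<omega>)) f (X (real_of_ereal (\<tau> \<omega>)) \<omega>)) else 0) \<partial>P x)"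
proof -
  note [measurable] = pred_tau[OF t] X_measurable(2)[OF t]
  have "ennreal (semi t f x) = (\<integral>\<^sup>+\<omega>. ennreal (f (X t \<omega>)) \<partial>P x)"
    using ennreal_semi[OF t f, of x] by (simp add: nn_integral_kern t)
  also have "\<dots> = (\<integral>\<^sup>+\<omega>. (if ereal t < \<tau> \<omega> then ennreal (f (X t \<omega>)) else 0) +
      (if \<tau> \<omega> \<le> ereal t then ennreal (f (X t \<omega>)) else 0) \<partial>P x)"
    by (intro nn_integral_cong) auto
  also have "\<dots> = (\<integral>\<^sup>+\<omega>. (if ereal t < \<tau> \<omega> then ennreal (f (X t \<omega>)) else 0) \<partial>P x) +
      (\<integral>\<^sup>+\<omega>. (if \<tau> \<omega> \<le> ereal t then ennreal (f (X t \<omega>)) else 0) \<partial>P x)"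
    by (rule nn_integral_add) measurable
  also have "(\<integral>\<^sup>+\<omega>. (if \<tau> \<omega> \<le> ereal t then ennreal (f (X t \<omega>)) else 0) \<partial>P x) =
      (\<integral>\<^sup>+\<omega>. (if \<tau> \<omega> \<le> ereal t
      then \<integral>\<^sup>+y. ennreal (f y) \<partial>kern (t - real_of_ereal (\<tau> \<omega>)) (X (real_of_ereal (\<tau> \<omega>)) \<omega>) else 0) \<partial>P x)"
    by (rule strong_markov[OF t])
  also have "\<dots> = (\<integral>\<^sup>+\<omega>. (if \<tau> \<omega> \<le> ereal t
      then ennreal (semi (t - real_of_ereal (\<tau> \<omega>)) f (X (real_of_ereal (\<tau> \<omega>)) \<omega>)) else 0) \<partial>P x)"
  proof (rule nn_integral_cong)
    fix \<omega> assume "\<omega> \<in> space (P x)"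
    then have w: "\<omega> \<in> space M" by simp
    show "(if \<tau> \<omega> \<le> ereal t
      then \<integral>\<^sup>+y. ennreal (f y) \<partial>kern (t - real_of_ereal (\<tau> \<omega>)) (X (real_of_ereal (\<tau> \<omega>)) \<omega>) else 0) =
      (if \<tau> \<omega> \<le> ereal t
      then ennreal (semi (t - real_of_ereal (\<tau> \<omega>)) f (X (real_of_ereal (\<tau> \<omega>)) \<omega>)) else 0)"
    proof (cases "\<tau> \<omega> \<le> ereal t")
      case True
      then obtain u where "\<tau> \<omega> = ereal u" "0 \<le> u" "u \<le> t" using tau_cases[OF w t] by metis
      then show ?thesis by (simp add: ennreal_semi f)
    qed simp
  qed
  finally show ?thesis .
qed

text \<open>
  Before the entrance into \<open>D0\<close> the process moves in the complement of \<open>D0\<close>, where \<open>\<phi>\<close> satisfies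
  \<open>L \<phi> \<le> - lam1 \<phi>\<close>.
\<close>

lemma killed_bound:
  assumes t: "0 \<le> t"
  shows "(\<integral>\<^sup>+\<omega>. (if ereal t < \<tau> \<omega> then ennreal (\<phi> (X t \<omega>)) else 0) \<partial>P x) \<le> ennreal (exp (- lam1 * t) * \<phi> x)"
proof (cases x)
  case None
  have "(\<integral>\<^sup>+\<omega>. (if ereal t < \<tau> \<omega> then ennreal (\<phi> (X t \<omega>)) else 0) \<partial>P x) \<le> (\<integral>\<^sup>+\<omega>. ennreal (\<phi> (X t \<omega>)) \<partial>P x)"
    by (intro nn_integral_mono) auto
  also have "\<dots> = (\<integral>\<^sup>+z. ennreal (\<phi> z) \<partial>kern t x)" using t by (simp add: nn_integral_kern)
  also have "\<dots> = 0" using t by (simp add: None kern_None nn_integral_return phi_None)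
  finally show ?thesis by simp
next
  case (Some a)
  have "(\<integral>\<^sup>+\<omega>. (if ereal t < \<tau> \<omega> then ennreal (\<phi> (X t \<omega>)) else 0) \<partial>P x) \<le>
    (\<integral>\<^sup>+\<omega>. indicator {\<omega>\<in>space M. \<forall>s\<in>{0..t}. X s \<omega> \<in> Some ` (- D0)} \<omega> * ennreal (\<phi> (X t \<omega>)) \<partial>P x)"
  proof (rule nn_integral_mono_AE)
    show "AE \<omega> in P x. (if ereal t < \<tau> \<omega> then ennreal (\<phi> (X t \<omega>)) else 0) \<le>
        indicator {\<omega>\<in>space M. \<forall>s\<in>{0..t}. X s \<omega> \<in> Some ` (- D0)} \<omega> * ennreal (\<phi> (X t \<omega>))"
      using absorbed[of x] AE_space
    proof eventually_elim
      case (elim \<omega>)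
      then have w: "\<omega> \<in> space M" by simp
      show ?case
      proof (cases "ereal t < \<tau> \<omega> \<and> X t \<omega> \<noteq> None")
        case True
        have "X s \<omega> \<in> Some ` (- D0)" if s: "s \<in> {0..t}" for s
        proof -
          have "X s \<omega> \<noteq> None" using elim(1)[rule_format, of s t] True s by auto
          moreover have "\<not> (\<exists>s\<in>{0..t}. X s \<omega> \<in> Some ` D0)"
            using hitting_time_le_iff[OF w t, of "Some ` D0"] True leD by blast
          then have "X s \<omega> \<notin> Some ` D0" using s by blast
          ultimately show ?thesis by (cases "X s \<omega>") (simp_all add: image_iff)
        qed
        then show ?thesis using w by (simp add: indicator_def)
      qed (auto simp: phi_None)
    qed
  qed
  also have "\<dots> \<le> ennreal (exp (- lam1 * t) * \<phi> x)"
    unfolding Some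
  proof (rule supersolution[OF phi_None phi_ge_1 phi_summable _ t])
    fix y assume "y \<in> - D0"
    then show "generator q \<phi> (Some y) \<le> - lam1 * \<phi> (Some y)" using phi_drift[of y] by simp
  qed
  finally show ?thesis .
qed

lemma D0_self_lower:
  assumes "0 \<le> T"
  obtains c where "0 < c" "\<And>x u. x \<in> D0 \<Longrightarrow> 0 \<le> u \<Longrightarrow> u \<le> T \<Longrightarrow> c \<le> pmf (kern u (Some x)) (Some x)"
proof -
  have "\<exists>c>0. \<forall>x\<in>D0. \<forall>u\<in>{0..T}. c \<le> pmf (kern u (Some x)) (Some x)"
  proof (rule finite_uniform_positive[OF D0(1)])
    fix x
    obtain c where "0 < c" "\<And>u. 0 \<le> u \<Longrightarrow> u \<le> T \<Longrightarrow> c \<le> pmf (kern u (Some x)) (Some x)"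
      using kern_self_lower[OF assms] by blast
    then show "\<exists>c>0. \<forall>u\<in>{0..T}. c \<le> pmf (kern u (Some x)) (Some x)" by (intro exI[of _ c]) auto
  qed force
  then obtain c where "0 < c" "\<forall>x\<in>D0. \<forall>u\<in>{0..T}. c \<le> pmf (kern u (Some x)) (Some x)" by blast
  then show thesis using that[of c] by simp
qed

lemma D0_pos_lower:
  obtains c where "0 < c" "c \<le> 1" "\<And>x y. x \<in> D0 \<Longrightarrow> y \<in> D0 \<Longrightarrow> c \<le> pmf (kern 1 (Some x)) (Some y)"
proof -
  have "\<exists>c>0. \<forall>p\<in>D0 \<times> D0. c \<le> pmf (kern 1 (Some (fst p))) (Some (snd p))"
    by (rule finite_uniform_positive) (use D0 positive in force)+
  then obtain c where c: "0 < c" "\<forall>p\<in>D0 \<times> D0. c \<le> pmf (kern 1 (Some (fst p))) (Some (snd p))" by blast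
  then have "c \<le> pmf (kern 1 (Some x0)) (Some x0)" using D0 by force
  also have "\<dots> \<le> 1" by (rule pmf_le_1)
  finally show thesis using that[of c] c by force
qed

lemma phi_D0_bound: obtains m where "0 \<le> m" "\<And>x. x \<in> D0 \<Longrightarrow> \<phi> (Some x) \<le> m"
proof -
  have "\<phi> (Some x) \<le> (\<Sum>x\<in>D0. \<phi> (Some x))" if "x \<in> D0" for x
    using that D0(1) phi_nonneg by (intro member_le_sum) auto
  then show thesis using that[of "\<Sum>x\<in>D0. \<phi> (Some x)"] phi_nonneg by (simp add: sum_nonneg)
qed

text \<open>
  The discrete-time drift condition.  The part of \<open>P\<^sub>t \<phi>\<close> after the entrance is at most a constant times
  the probability of an entrance before \<open>t\<close>, since \<open>\<phi>\<close> is bounded on the finite set \<open>D0\<close>; and a process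
  that has entered \<open>D0\<close> has a probability bounded below of being in \<open>D0\<close> at time \<open>t\<close>, since it may
  stay where it entered.
\<close>

lemma semi_drift:
  assumes t: "0 \<le> t"
  obtains K where "0 \<le> K" "\<And>x. semi t \<phi> x \<le> exp (- lam1 * t) * \<phi> x + K * semi t iD x"
proof -
  obtain m where m: "0 \<le> m" "\<And>x. x \<in> D0 \<Longrightarrow> \<phi> (Some x) \<le> m" using phi_D0_bound by blast
  obtain c where c: "0 < c" "\<And>x u. x \<in> D0 \<Longrightarrow> 0 \<le> u \<Longrightarrow> u \<le> t \<Longrightarrow> c \<le> pmf (kern u (Some x)) (Some x)"
    using D0_self_lower[OF t] by blast
  define K where "K = exp (C * t) * m / c"
  have K: "0 \<le> K" unfolding K_def using m c by simp
  have "semi t \<phi> x \<le> exp (- lam1 * t) * \<phi> x + K * semi t iD x" for x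
  proof -
    let ?hit = "\<lambda>f. \<integral>\<^sup>+\<omega>. (if \<tau> \<omega> \<le> ereal t
      then ennreal (semi (t - real_of_ereal (\<tau> \<omega>)) f (X (real_of_ereal (\<tau> \<omega>)) \<omega>)) else 0) \<partial>P x"
    have "?hit \<phi> \<le> (\<integral>\<^sup>+\<omega>. (if \<tau> \<omega> \<le> ereal t then ennreal (K * c) else 0) \<partial>P x)"
    proof (rule nn_integral_mono)
      fix \<omega> assume "\<omega> \<in> space (P x)"
      then have w: "\<omega> \<in> space M" by simp
      show "(if \<tau> \<omega> \<le> ereal t then ennreal (semi (t - real_of_ereal (\<tau> \<omega>)) \<phi> (X (real_of_ereal (\<tau> \<omega>)) \<omega>)) else 0)
        \<le> (if \<tau> \<omega> \<le> ereal t then ennreal (K * c) else 0)"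
      proof (cases "\<tau> \<omega> \<le> ereal t")
        case True
        then obtain u a where u: "\<tau> \<omega> = ereal u" "0 \<le> u" "u \<le> t" "X u \<omega> = Some a" "a \<in> D0"
          using tau_cases[OF w t] by metis
        have "semi (t - u) \<phi> (Some a) \<le> exp (C * (t - u)) * \<phi> (Some a)" using u by (intro semi_phi_le) simp
        also have "\<dots> \<le> exp (C * t) * m"
          using u C m phi_nonneg by (intro mult_mono) (auto intro: mult_left_mono)
        also have "\<dots> = K * c" using c by (simp add: K_def)
        finally show ?thesis using u by (auto intro: ennreal_leI)
      qed simp
    qed
    also have "\<dots> = (\<integral>\<^sup>+\<omega>. ennreal K * (if \<tau> \<omega> \<le> ereal t then ennreal c else 0) \<partial>P x)"
      using K c(1) by (intro nn_integral_cong) (auto simp: ennreal_mult)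
    also have "\<dots> = ennreal K * (\<integral>\<^sup>+\<omega>. (if \<tau> \<omega> \<le> ereal t then ennreal c else 0) \<partial>P x)"
    proof (rule nn_integral_cmult)
      note [measurable] = pred_tau[OF t]
      show "(\<lambda>\<omega>. if \<tau> \<omega> \<le> ereal t then ennreal c else 0) \<in> borel_measurable (P x)" by measurable
    qed
    also have "\<dots> \<le> ennreal K * ?hit iD"
    proof (intro mult_left_mono nn_integral_mono)
      fix \<omega> assume "\<omega> \<in> space (P x)"
      then have w: "\<omega> \<in> space M" by simp
      show "(if \<tau> \<omega> \<le> ereal t then ennreal c else 0) \<le>
        (if \<tau> \<omega> \<le> ereal t then ennreal (semi (t - real_of_ereal (\<tau> \<omega>)) iD (X (real_of_ereal (\<tau> \<omega>)) \<omega>)) else 0)"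
      proof (cases "\<tau> \<omega> \<le> ereal t")
        case True
        then obtain u a where u: "\<tau> \<omega> = ereal u" "0 \<le> u" "u \<le> t" "X u \<omega> = Some a" "a \<in> D0"
          using tau_cases[OF w t] by metis
        have "c \<le> pmf (kern (t - u) (Some a)) (Some a) * iD (Some a)" using c(2)[of a "t - u"] u by simp
        also have "\<dots> \<le> semi (t - u) iD (Some a)"
          using u by (intro semi_ge_point dominated_indicator) auto
        finally show ?thesis using u by (auto intro: ennreal_leI)
      qed simp
    qed simp
    also have "?hit iD \<le> ennreal (semi t iD x)"
      by (subst semi_entrance[OF t dominated_indicator]) auto
    finally have "?hit \<phi> \<le> ennreal K * ennreal (semi t iD x)" by (simp add: mult_left_mono)
    then have "ennreal (semi t \<phi> x) \<le> ennreal (exp (- lam1 * t) * \<phi> x) + ennreal K * ennreal (semi t iD x)"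
      unfolding semi_entrance[OF t dominated_phi phi_nonneg] by (intro add_mono killed_bound[OF t])
    also have "\<dots> = ennreal (exp (- lam1 * t) * \<phi> x + K * semi t iD x)"
      using K phi_nonneg by (simp add: ennreal_mult semi_nonneg ennreal_plus)
    finally show ?thesis
      using K phi_nonneg by (subst (asm) ennreal_le_iff) (auto intro!: add_nonneg_nonneg mult_nonneg_nonneg semi_nonneg)
  qed
  then show thesis using that K by blast
qed

end

section \<open>The exact exponential growth of the killed semigroup\<close>

text \<open>
  Tychonoff's theorem; on a countable index set the product topology is metrizable, so compactness is
  sequential.
\<close>

lemma pointwise_convergent_subsequence:
  fixes f :: "nat \<Rightarrow> 's::countable \<Rightarrow> real"
  assumes "\<And>n x. \<bar>f n x\<bar> \<le> B x"
  obtains r l where "strict_mono (r :: nat \<Rightarrow> nat)" "\<And>x. (\<lambda>n. f (r n) x) \<longlonglongrightarrow> l x"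
proof -
  let ?S = "PiE UNIV (\<lambda>x. {- B x..B x})"
  have "compactin (product_topology (\<lambda>_. euclidean) UNIV) ?S"
    by (subst compactin_PiE) (auto simp: compactin_euclidean_iff)
  then have "compact ?S" by (simp add: euclidean_product_topology compactin_euclidean_iff)
  moreover have "\<forall>n. f n \<in> ?S" using assms by (auto simp: abs_le_iff minus_le_iff)
  ultimately obtain l r where r: "strict_mono (r :: nat \<Rightarrow> nat)" and l: "(f \<circ> r) \<longlonglongrightarrow> l"
    unfolding compact_eq_seq_compact_metric seq_compact_def by blast
  have "(\<lambda>n. f (r n) x) \<longlonglongrightarrow> l x" for x
  proof -
    have "((\<lambda>n. (\<lambda>g. g x) ((f \<circ> r) n)) \<longlongrightarrow> (\<lambda>g. g x) l) sequentially"
      by (rule continuous_on_tendsto_compose[where s = UNIV and f = "\<lambda>g. g x", OF _ l])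
         (auto intro: continuous_on_product_coordinates)
    then show ?thesis by (simp add: o_def)
  qed
  then show thesis using that r by blast
qed

context lyapunov_jump_process
begin

text \<open>
  If \<open>u \<ge> 2\<close> lies in \<open>[k + 1, k + 2)\<close>, then \<open>exp (g u)\<close> is at most \<open>exp (2 g) exp (g k)\<close>, and \<open>\<tau> = u\<close>
  implies \<open>k < \<tau>\<close>.  So the exponential moment is dominated by the sum over \<open>k\<close> of
  \<open>exp (g k) \<phi>(X\<^sub>k)\<close> on \<open>{k < \<tau>}\<close>, a geometric series of ratio \<open>exp (g - lam1)\<close>.
\<close>

lemma entrance_laplace:
  assumes g: "0 \<le> g" "g < lam1"
  obtains K where "0 \<le> K" "\<And>x t b. 0 \<le> t \<Longrightarrow> 0 \<le> b \<Longrightarrow>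
    (\<integral>\<^sup>+\<omega>. (if \<tau> \<omega> \<le> ereal t then ennreal (b * exp (g * real_of_ereal (\<tau> \<omega>))) else 0) \<partial>P (Some x))
      \<le> ennreal (b * (K * \<phi> (Some x)))"
proof -
  define r where "r = exp (- (lam1 - g))"
  have r: "0 < r" "r < 1" using g by (auto simp: r_def)
  define K where "K = exp (2 * g) * (1 + 1 / (1 - r))"
  have "(\<integral>\<^sup>+\<omega>. (if \<tau> \<omega> \<le> ereal t then ennreal (b * exp (g * real_of_ereal (\<tau> \<omega>))) else 0) \<partial>P (Some x))
      \<le> ennreal (b * (K * \<phi> (Some x)))" if t: "0 \<le> t" and b: "0 \<le> b" for x t b
  proof -
    interpret prob_space "P (Some x)" by (rule laws)
    define h where "h k \<omega> = ennreal (exp (g * real k)) *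
      (if ereal (real k) < \<tau> \<omega> then ennreal (\<phi> (X (real k) \<omega>)) else 0)" for k \<omega>
    have hm [measurable]: "h k \<in> borel_measurable (P (Some x))" for k
    proof -
      note [measurable] = pred_tau(2)[of "real k"] X_measurable(2)[of "real k"]
      show ?thesis unfolding h_def by measurable
    qed
    have hI: "(\<integral>\<^sup>+\<omega>. h k \<omega> \<partial>P (Some x)) \<le> ennreal (r ^ k * \<phi> (Some x))" for k
    proof -
      have m: "(\<lambda>\<omega>. if ereal (real k) < \<tau> \<omega> then ennreal (\<phi> (X (real k) \<omega>)) else 0) \<in> borel_measurable (P (Some x))"
      proof -
        note [measurable] = pred_tau(2)[of "real k"] X_measurable(2)[of "real k"]
        show ?thesis by measurable
      qed
      have "(\<integral>\<^sup>+\<omega>. h k \<omega> \<partial>P (Some x)) = ennreal (exp (g * real k)) *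
          (\<integral>\<^sup>+\<omega>. (if ereal (real k) < \<tau> \<omega> then ennreal (\<phi> (X (real k) \<omega>)) else 0) \<partial>P (Some x))"
        unfolding h_def by (rule nn_integral_cmult[OF m])
      also have "\<dots> \<le> ennreal (exp (g * real k)) * ennreal (exp (- lam1 * real k) * \<phi> (Some x))"
        by (intro mult_left_mono killed_bound) auto
      also have "\<dots> = ennreal (exp (g * real k) * (exp (- lam1 * real k) * \<phi> (Some x)))"
        by (simp add: ennreal_mult phi_nonneg)
      also have "exp (g * real k) * (exp (- lam1 * real k) * \<phi> (Some x)) = r ^ k * \<phi> (Some x)"
        unfolding r_def exp_of_nat_mult[symmetric] mult.assoc[symmetric] exp_add[symmetric]
        by (simp add: algebra_simps)
      finally show ?thesis .
    qed
    have "(\<integral>\<^sup>+\<omega>. (if \<tau> \<omega> \<le> ereal t then ennreal (b * exp (g * real_of_ereal (\<tau> \<omega>))) else 0) \<partial>P (Some x))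
        \<le> (\<integral>\<^sup>+\<omega>. ennreal (b * exp (2 * g)) * (1 + (\<Sum>k. h k \<omega>)) \<partial>P (Some x))"
    proof (rule nn_integral_mono_AE)
      show "AE \<omega> in P (Some x). (if \<tau> \<omega> \<le> ereal t then ennreal (b * exp (g * real_of_ereal (\<tau> \<omega>))) else 0)
          \<le> ennreal (b * exp (2 * g)) * (1 + (\<Sum>k. h k \<omega>))"
        using absorbed[of "Some x"] AE_space
      proof eventually_elim
        case (elim \<omega>)
        then have w: "\<omega> \<in> space M" by simp
        show ?case
        proof (cases "\<tau> \<omega> \<le> ereal t")
          case True
          then obtain u a where u: "\<tau> \<omega> = ereal u" "0 \<le> u" "u \<le> t" "X u \<omega> = Some a" "a \<in> D0"
            using tau_cases[OF w t] by metis
          have "ennreal (exp (g * u)) \<le> ennreal (exp (2 * g)) * (1 + (\<Sum>k. h k \<omega>))"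
          proof (cases "u < 2")
            case True
            then have "exp (g * u) \<le> exp (2 * g)" using g mult_left_mono[of u 2 g] by (simp add: mult.commute)
            then have "ennreal (exp (g * u)) \<le> ennreal (exp (2 * g)) * 1" by (simp add: ennreal_leI)
            also have "\<dots> \<le> ennreal (exp (2 * g)) * (1 + (\<Sum>k. h k \<omega>))"
              by (intro mult_left_mono) auto
            finally show ?thesis .
          next
            case False
            define k where "k = nat \<lfloor>u\<rfloor> - 1"
            have k: "real k < u" "u < real k + 2"
            proof -
              have "2 \<le> \<lfloor>u\<rfloor>" using False by (simp add: le_floor_iff)
              then have "real k = of_int \<lfloor>u\<rfloor> - 1" unfolding k_def by (simp add: of_nat_diff nat_le_iff le_nat_iff)
              then show "real k < u" "u < real k + 2" by linarith+
            qed
            have "X (real k) \<omega> \<noteq> None" using elim(1)[rule_format, of "real k" u] u k by auto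
            then have "1 \<le> \<phi> (X (real k) \<omega>)" using phi_ge_1 by auto
            have "exp (g * u) \<le> exp (2 * g) * exp (g * real k)"
              using mult_left_mono[of u "real k + 2" g] k g by (simp add: algebra_simps flip: exp_add)
            also have "\<dots> \<le> exp (2 * g) * (exp (g * real k) * \<phi> (X (real k) \<omega>))"
              using \<open>1 \<le> \<phi> (X (real k) \<omega>)\<close> by (intro mult_left_mono) auto
            finally have "ennreal (exp (g * u)) \<le> ennreal (exp (2 * g)) * h k \<omega>"
              using k u phi_nonneg by (simp add: h_def ennreal_leI flip: ennreal_mult)
            also have "h k \<omega> \<le> (\<Sum>k. h k \<omega>)"
              using sum_le_suminf[of "\<lambda>k. h k \<omega>" "{k}"] by simp
            also have "\<dots> \<le> 1 + (\<Sum>k. h k \<omega>)" by (simp add: add_increasing)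
            finally show ?thesis by (simp add: mult_left_mono)
          qed
          then have "ennreal b * ennreal (exp (g * u)) \<le> ennreal b * (ennreal (exp (2 * g)) * (1 + (\<Sum>k. h k \<omega>)))"
            by (rule mult_left_mono) simp
          then show ?thesis using u b by (simp add: ennreal_mult mult.assoc)
        qed simp
      qed
    qed
    also have "\<dots> = ennreal (b * exp (2 * g)) * (\<integral>\<^sup>+\<omega>. 1 + (\<Sum>k. h k \<omega>) \<partial>P (Some x))"
      by (rule nn_integral_cmult) measurable
    also have "(\<integral>\<^sup>+\<omega>. 1 + (\<Sum>k. h k \<omega>) \<partial>P (Some x)) = 1 + (\<integral>\<^sup>+\<omega>. (\<Sum>k. h k \<omega>) \<partial>P (Some x))"
      using emeasure_space_1 by (subst nn_integral_add) auto
    also have "(\<integral>\<^sup>+\<omega>. (\<Sum>k. h k \<omega>) \<partial>P (Some x)) = (\<Sum>k. \<integral>\<^sup>+\<omega>. h k \<omega> \<partial>P (Some x))"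
      by (rule nn_integral_suminf) measurable
    also have "\<dots> \<le> (\<Sum>k. ennreal (r ^ k * \<phi> (Some x)))"
      by (intro suminf_le hI) auto
    also have "\<dots> = ennreal (1 / (1 - r) * \<phi> (Some x))"
      using r phi_nonneg by (intro suminf_ennreal_eq sums_mult2 geometric_sums) auto
    also have "1 + ennreal (1 / (1 - r) * \<phi> (Some x)) \<le> ennreal (\<phi> (Some x)) + ennreal (1 / (1 - r) * \<phi> (Some x))"
      using phi_ge_1[of x] by (intro add_right_mono) simp
    also have "\<dots> = ennreal (\<phi> (Some x) + 1 / (1 - r) * \<phi> (Some x))"
      using r phi_nonneg by (intro ennreal_plus[symmetric]) auto
    also have "ennreal (b * exp (2 * g)) * \<dots> = ennreal (b * (K * \<phi> (Some x)))"
      using r b phi_nonneg by (subst ennreal_mult[symmetric]) (auto simp: K_def algebra_simps intro!: add_nonneg_nonneg)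
    finally show ?thesis by (simp add: mult_left_mono)
  qed
  moreover have "0 \<le> K" unfolding K_def using r by simp
  ultimately show thesis using that by blast
qed

text \<open>
  The growth of the semigroup seen from the reference point.
\<close>

definition mass :: "real \<Rightarrow> real" where "mass t = semi t \<phi> (Some x0)"

lemma x0_positive: "0 < pmf (kern 1 (Some x0)) (Some x0)"
  by (intro positive D0)

lemma mass_ge_return: "0 \<le> t \<Longrightarrow> pmf (kern t (Some x0)) (Some x0) \<le> mass t"
proof -
  assume t: "0 \<le> t"
  have "pmf (kern t (Some x0)) (Some x0) * 1 \<le> pmf (kern t (Some x0)) (Some x0) * \<phi> (Some x0)"
    using phi_ge_1 by (intro mult_left_mono) auto
  also have "\<dots> \<le> mass t" unfolding mass_def by (intro semi_ge_point t dominated_phi phi_nonneg)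
  finally show ?thesis by simp
qed

lemma mass_nonneg: "0 \<le> mass t"
  unfolding mass_def by (intro semi_nonneg phi_nonneg)

text \<open>
  If the entrance happens at time \<open>u\<close>, the rest of the expectation is \<open>P\<^sub>t\<^sub>-\<^sub>u \<phi>\<close> at a point of \<open>D0\<close>.  It
  is at most a constant times \<open>exp (g u) m(t)\<close>, because the process started from \<open>x0\<close> can first return
  to \<open>x0\<close> during time \<open>u\<close> and then reach that point in one unit of time.  Any \<open>g\<close> above \<open>lam0\<close> serves
  for the return and any \<open>g\<close> below \<open>lam1\<close> for the exponential moment of the entrance time.
\<close>

lemma semi_phi_comparison:
  obtains K where "1 \<le> K" "\<And>t x. 0 \<le> t \<Longrightarrow> semi t \<phi> x \<le> K * mass t * \<phi> x"
proof -
  define g where "g = (lam0 + lam1) / 2"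
  have g: "0 \<le> g" "lam0 < g" "g < lam1" using lam0_nonneg lam1 by (auto simp: g_def)
  obtain c where c: "0 < c" "\<And>t. 0 \<le> t \<Longrightarrow> c * exp (- g * t) \<le> pmf (kern t (Some x0)) (Some x0)"
    using decay_rate_lower[OF x0_positive] g lam0 by metis
  obtain p where p: "0 < p" "p \<le> 1" "\<And>x y. x \<in> D0 \<Longrightarrow> y \<in> D0 \<Longrightarrow> p \<le> pmf (kern 1 (Some x)) (Some y)"
    using D0_pos_lower by blast
  define K2 where "K2 = exp C / (c * p)"
  have K2: "0 \<le> K2" using c p by (simp add: K2_def)
  have start_D0: "semi (t - u) \<phi> (Some x) \<le> K2 * mass t * exp (g * u)"
    if x: "x \<in> D0" and u: "0 \<le> u" "u \<le> t" for x u t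
  proof -
    let ?S = "semi (t - u) \<phi> (Some x)"
    have S: "0 \<le> ?S" by (intro semi_nonneg phi_nonneg)
    have "c * exp (- g * u) * p \<le> pmf (kern u (Some x0)) (Some x0) * pmf (kern 1 (Some x0)) (Some x)"
      using c p u x D0 by (intro mult_mono) auto
    also have "\<dots> \<le> pmf (kern (u + 1) (Some x0)) (Some x)" using u by (intro kern_add_ge) auto
    finally have "c * exp (- g * u) * p * ?S \<le> pmf (kern (u + 1) (Some x0)) (Some x) * ?S"
      using S by (intro mult_right_mono) auto
    also have "\<dots> \<le> semi (u + 1) (semi (t - u) \<phi>) (Some x0)"
      using u by (intro semi_ge_point dominated_semi dominated_phi semi_nonneg phi_nonneg) auto
    also have "\<dots> = semi ((u + 1) + (t - u)) \<phi> (Some x0)"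
      using u by (intro semi_semi[symmetric] dominated_phi) auto
    also have "\<dots> = semi (t + 1) \<phi> (Some x0)" by (simp add: add.commute)
    also have "\<dots> = semi t (semi 1 \<phi>) (Some x0)" using u by (intro semi_semi dominated_phi) auto
    also have "\<dots> \<le> semi t (\<lambda>y. exp C * \<phi> y) (Some x0)"
    proof (rule semi_mono)
      show "semi 1 \<phi> y \<le> exp C * \<phi> y" for y using semi_phi_le[of 1 y] by simp
    qed (use u in \<open>auto intro: dominated_semi dominated_cmult dominated_phi\<close>)
    also have "\<dots> = exp C * mass t" by (simp add: semi_cmult mass_def)
    finally have "c * p * ?S \<le> exp C * mass t * exp (g * u)"
      by (simp add: exp_minus field_simps)
    then show ?thesis using c(1) p(1) by (simp add: K2_def field_simps)
  qed
  obtain K3 where K3: "0 \<le> K3" "\<And>x t b. 0 \<le> t \<Longrightarrow> 0 \<le> b \<Longrightarrow>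
    (\<integral>\<^sup>+\<omega>. (if \<tau> \<omega> \<le> ereal t then ennreal (b * exp (g * real_of_ereal (\<tau> \<omega>))) else 0) \<partial>P (Some x))
      \<le> ennreal (b * (K3 * \<phi> (Some x)))"
    using entrance_laplace[OF g(1,3)] by blast
  define K where "K = 1 + 1 / c + K2 * K3"
  have "semi t \<phi> x \<le> K * mass t * \<phi> x" if t: "0 \<le> t" for t x
  proof (cases x)
    case None
    then show ?thesis using t by (simp add: semi_None phi_None)
  next
    case (Some a)
    have "(\<integral>\<^sup>+\<omega>. (if \<tau> \<omega> \<le> ereal t
        then ennreal (semi (t - real_of_ereal (\<tau> \<omega>)) \<phi> (X (real_of_ereal (\<tau> \<omega>)) \<omega>)) else 0) \<partial>P x) \<le>
      (\<integral>\<^sup>+\<omega>. (if \<tau> \<omega> \<le> ereal t then ennreal (K2 * mass t * exp (g * real_of_ereal (\<tau> \<omega>))) else 0) \<partial>P x)"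
    proof (rule nn_integral_mono)
      fix \<omega> assume "\<omega> \<in> space (P x)"
      then have w: "\<omega> \<in> space M" by simp
      show "(if \<tau> \<omega> \<le> ereal t
          then ennreal (semi (t - real_of_ereal (\<tau> \<omega>)) \<phi> (X (real_of_ereal (\<tau> \<omega>)) \<omega>)) else 0) \<le>
        (if \<tau> \<omega> \<le> ereal t then ennreal (K2 * mass t * exp (g * real_of_ereal (\<tau> \<omega>))) else 0)"
      proof (cases "\<tau> \<omega> \<le> ereal t")
        case True
        then obtain u a where u: "\<tau> \<omega> = ereal u" "0 \<le> u" "u \<le> t" "X u \<omega> = Some a" "a \<in> D0"
          using tau_cases[OF w t] by metis
        then show ?thesis
          using start_D0[OF u(5,2,3)] by (simp add: ennreal_leI)
      qed simp
    qed
    also have "\<dots> \<le> ennreal (K2 * mass t * (K3 * \<phi> x))"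
      unfolding Some using K2 mass_nonneg[of t] by (intro K3 t) simp
    finally have "ennreal (semi t \<phi> x) \<le> ennreal (exp (- lam1 * t) * \<phi> x) + ennreal (K2 * mass t * (K3 * \<phi> x))"
      unfolding semi_entrance[OF t dominated_phi phi_nonneg] by (intro add_mono killed_bound t)
    also have "\<dots> = ennreal (exp (- lam1 * t) * \<phi> x + K2 * mass t * (K3 * \<phi> x))"
      using K2 K3 mass_nonneg[of t] phi_nonneg by (intro ennreal_plus[symmetric]) auto
    finally have "semi t \<phi> x \<le> exp (- lam1 * t) * \<phi> x + K2 * mass t * (K3 * \<phi> x)"
      using K2 K3 mass_nonneg[of t] phi_nonneg
      by (subst (asm) ennreal_le_iff) (auto intro!: add_nonneg_nonneg mult_nonneg_nonneg)
    moreover have "exp (- lam1 * t) \<le> 1 / c * mass t"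
    proof -
      have "c * exp (- lam1 * t) \<le> c * exp (- g * t)"
        using c g t by (intro mult_left_mono) (auto intro: mult_right_mono)
      also have "\<dots> \<le> mass t" using c(2)[OF t] mass_ge_return[OF t] by simp
      finally show ?thesis using c(1) by (simp add: field_simps)
    qed
    then have "exp (- lam1 * t) * \<phi> x \<le> 1 / c * mass t * \<phi> x" by (intro mult_right_mono phi_nonneg)
    moreover have "0 \<le> mass t * \<phi> x" using mass_nonneg phi_nonneg by simp
    ultimately show ?thesis by (simp add: K_def algebra_simps)
  qed
  moreover have "1 \<le> K" unfolding K_def using c K2 K3 by simp
  ultimately show thesis using that by blast
qed

text \<open>
  The probabilities of being in \<open>D0\<close> at time \<open>n\<close> are bounded by return probabilities one unit later, hence
  by \<open>exp (- lam0 n)\<close>.  In the iterated drift they are weighted by powers of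
  \<open>exp (- lam1)\<close>, which sums to the same order because \<open>lam0 < lam1\<close>.
\<close>

lemma mass_upper:
  obtains K where "0 \<le> K" "\<And>n. mass (real n) \<le> K * exp (- lam0 * real n)"
proof -
  obtain K1 where K1: "0 \<le> K1" "\<And>x. semi 1 \<phi> x \<le> exp (- lam1 * 1) * \<phi> x + K1 * semi 1 iD x"
    using semi_drift[of 1] by auto
  obtain p where p: "0 < p" "p \<le> 1" "\<And>x y. x \<in> D0 \<Longrightarrow> y \<in> D0 \<Longrightarrow> p \<le> pmf (kern 1 (Some x)) (Some y)"
    using D0_pos_lower by blast
  have visit: "semi (real n) iD (Some x0) \<le> 1 / p * exp (- lam0 * real n)" for n
  proof -
    have "p * semi (real n) iD (Some x0) = semi (real n) (\<lambda>y. p * iD y) (Some x0)" by (simp add: semi_cmult)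
    also have "\<dots> \<le> semi (real n) (semi 1 (indicator {Some x0})) (Some x0)"
    proof (rule semi_mono)
      show "dominated (\<lambda>y. p * iD y)" by (intro dominated_cmult dominated_indicator)
      show "dominated (semi 1 (indicator {Some x0}))"
        using dominated_indicator[of "{x0}"] by (intro dominated_semi) auto
      show "p * iD y \<le> semi 1 (indicator {Some x0}) y" for y
        using p(3)[OF _ D0(2)] by (auto simp: semi_indicator indicator_def)
    qed simp
    also have "\<dots> = pmf (kern (real n + 1) (Some x0)) (Some x0)"
      using dominated_indicator[of "{x0}"] by (subst semi_semi[symmetric]) (auto simp: semi_indicator)
    also have "\<dots> \<le> exp (- lam0 * real (Suc n))"
      using decay_rate_upper[OF x0_positive, of "Suc n"] by (simp add: lam0 add.commute)
    also have "\<dots> \<le> exp (- lam0 * real n)" using lam0_nonneg by (simp add: algebra_simps)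
    finally show ?thesis using p(1) by (simp add: field_simps)
  qed
  define r where "r = exp (- (lam1 - lam0))"
  have r: "0 < r" "r < 1" using lam1 by (auto simp: r_def)
  define K2 where "K2 = K1 / p"
  have K2: "0 \<le> K2" using K1 p by (simp add: K2_def)
  define s where "s n = exp (lam0 * real n) * mass (real n)" for n
  have step: "s (Suc n) \<le> r * s n + K2" for n
  proof -
    have "mass (real (Suc n)) = semi (real n) (semi 1 \<phi>) (Some x0)"
      unfolding mass_def by (subst semi_semi[symmetric]) (auto simp: dominated_phi add.commute)
    also have "\<dots> \<le> semi (real n) (\<lambda>x. exp (- lam1) * \<phi> x + K1 * semi 1 iD x) (Some x0)"
      using K1(2) by (intro semi_mono dominated_semi dominated_add dominated_cmult dominated_phi dominated_indicator) auto
    also have "\<dots> = exp (- lam1) * mass (real n) + K1 * semi (real n) (semi 1 iD) (Some x0)"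
      by (subst semi_add)
         (auto simp: semi_cmult mass_def intro!: dominated_semi dominated_cmult dominated_phi dominated_indicator)
    also have "semi (real n) (semi 1 iD) (Some x0) = semi (real (Suc n)) iD (Some x0)"
      by (subst semi_semi[symmetric]) (auto simp: dominated_indicator add.commute)
    also have "\<dots> \<le> 1 / p * exp (- lam0 * real (Suc n))" by (rule visit)
    finally have *: "mass (real (Suc n)) \<le> exp (- lam1) * mass (real n) + K1 * (1 / p * exp (- lam0 * real (Suc n)))"
      using K1(1) by (simp add: mult_left_mono)
    have "s (Suc n) \<le> exp (lam0 * real (Suc n)) * (exp (- lam1) * mass (real n) + K1 * (1 / p * exp (- lam0 * real (Suc n))))"
      unfolding s_def by (intro mult_left_mono *) simp
    also have "\<dots> = (exp (lam0 * real (Suc n)) * exp (- lam1)) * mass (real n) + K2 * (exp (lam0 * real (Suc n)) * exp (- lam0 * real (Suc n)))"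
      by (simp add: K2_def algebra_simps)
    also have "exp (lam0 * real (Suc n)) * exp (- lam0 * real (Suc n)) = 1" by (simp flip: exp_add)
    also have "exp (lam0 * real (Suc n)) * exp (- lam1) = r * exp (lam0 * real n)"
      by (simp add: r_def algebra_simps flip: exp_add)
    finally show ?thesis by (simp add: s_def mult.assoc)
  qed
  define K where "K = s 0 + K2 / (1 - r)"
  have K: "0 \<le> K" unfolding K_def s_def using K2 r mass_nonneg by simp
  have "s n \<le> K" for n
  proof (induction n)
    case 0 then show ?case using K2 r by (simp add: K_def)
  next
    case (Suc n)
    have "s (Suc n) \<le> r * K + K2" using step[of n] mult_left_mono[OF Suc, of r] r by linarith
    also have "\<dots> \<le> K"
    proof -
      have "K2 \<le> (1 - r) * K"
        using r K2 mass_nonneg[of 0] by (simp add: K_def s_def distrib_left)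
      then show ?thesis by (simp add: algebra_simps)
    qed
    finally show ?case .
  qed
  then have "mass (real n) \<le> K * exp (- lam0 * real n)" for n
    unfolding s_def by (simp add: exp_minus field_simps)
  then show thesis using that K by blast
qed

text \<open>
  The comparison makes \<open>K m\<close> submultiplicative.  If it were below \<open>exp (- lam0 n)\<close> for a single \<open>n\<close>, it
  would decay at a rate above \<open>lam0\<close>, and so would the return probabilities, contrary to the definition
  of the decay parameter.
\<close>

lemma mass_lower:
  obtains c where "0 < c" "\<And>n. c * exp (- lam0 * real n) \<le> mass (real n)"
proof -
  obtain K where K: "1 \<le> K" "\<And>t x. 0 \<le> t \<Longrightarrow> semi t \<phi> x \<le> K * mass t * \<phi> x"
    using semi_phi_comparison by blast
  have sub: "mass (s + t) \<le> K * mass s * mass t" if "0 \<le> s" "0 \<le> t" for s t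
  proof -
    have "mass (s + t) = semi s (semi t \<phi>) (Some x0)"
      unfolding mass_def using that by (intro semi_semi dominated_phi)
    also have "\<dots> \<le> semi s (\<lambda>y. K * mass t * \<phi> y) (Some x0)"
      using that K by (intro semi_mono dominated_semi dominated_cmult dominated_phi) auto
    also have "\<dots> = K * mass s * mass t" by (simp add: semi_cmult mass_def)
    finally show ?thesis .
  qed
  have sub_power: "K * mass (real k * t) \<le> (K * mass t) ^ k" if "0 \<le> t" "0 < k" for k t
    using that(2)
  proof (induction k rule: nat_induct_non_zero)
    case (Suc k)
    have "K * mass (real (Suc k) * t) \<le> K * (K * mass t * mass (real k * t))"
      using sub[of t "real k * t"] that K by (intro mult_left_mono) (auto simp: algebra_simps)
    also have "\<dots> = K * mass t * (K * mass (real k * t))" by simp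
    also have "\<dots> \<le> K * mass t * (K * mass t) ^ k"
      using Suc K mass_nonneg by (intro mult_left_mono) auto
    finally show ?case by simp
  qed simp
  have "exp (- lam0 * real n) \<le> K * mass (real n)" for n
  proof (rule ccontr)
    assume "\<not> ?thesis"
    then have lt: "K * mass (real n) < exp (- lam0 * real n)" by simp
    have "1 \<le> K * mass 0" using mult_mono[of 1 K 1 "mass 0"] K phi_ge_1[of x0] by (simp add: mass_def semi_0)
    then have n: "0 < n" using lt by (cases "n = 0") auto
    obtain c0 where "0 < c0" "\<And>t. 0 \<le> t \<Longrightarrow> c0 * exp (- (lam0 + 1) * t) \<le> pmf (kern t (Some x0)) (Some x0)"
      using decay_rate_lower[OF x0_positive, of "lam0 + 1"] lam0 by auto
    then have "0 < mass (real n)"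
      using mass_ge_return[of "real n"] by (smt (verit) exp_gt_zero mult_pos_pos of_nat_0_le_iff)
    then have pos: "0 < K * mass (real n)" using K by simp
    define b where "b = - ln (K * mass (real n)) / real n"
    have eb: "K * mass (real n) = exp (- b * real n)" using n pos by (simp add: b_def)
    have b: "lam0 < b" using lt n unfolding eb by simp
    define g where "g = (lam0 + b) / 2"
    have g: "lam0 < g" "g < b" using b by (auto simp: g_def)
    obtain c where c: "0 < c" "\<And>t. 0 \<le> t \<Longrightarrow> c * exp (- g * t) \<le> pmf (kern t (Some x0)) (Some x0)"
      using decay_rate_lower[OF x0_positive] g lam0 by metis
    define \<rho> where "\<rho> = exp (- (b - g) * real n)"
    have \<rho>: "0 < \<rho>" "\<rho> < 1" using g n by (auto simp: \<rho>_def mult_neg_pos)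
    have "c \<le> \<rho> ^ k" if k: "0 < k" for k
    proof -
      have "c * exp (- g * (real k * real n)) \<le> mass (real k * real n)"
        using c(2)[of "real k * real n"] mass_ge_return[of "real k * real n"] by simp
      also have "\<dots> \<le> K * mass (real k * real n)"
        using mult_right_mono[OF K(1) mass_nonneg] by simp
      also have "\<dots> \<le> (K * mass (real n)) ^ k" using k by (intro sub_power) auto
      also have "\<dots> = exp (- b * real n) ^ k" by (simp only: eb)
      also have "\<dots> = exp (- b * (real k * real n))" by (simp add: exp_of_nat_mult[symmetric] mult_ac)
      finally have "c \<le> exp (- b * (real k * real n)) * exp (g * (real k * real n))"
        by (simp add: exp_minus field_simps)
      also have "\<dots> = \<rho> ^ k"
        unfolding \<rho>_def exp_of_nat_mult[symmetric] exp_add[symmetric] by (simp add: algebra_simps)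
      finally show ?thesis .
    qed
    moreover have "\<forall>\<^sub>F k in sequentially. \<rho> ^ k < c"
      using order_tendstoD(2)[OF LIMSEQ_power_zero[of \<rho>]] \<rho> c(1) by simp
    then obtain k where "\<rho> ^ Suc k < c" unfolding eventually_sequentially using le_Suc_eq by (metis le_add2 plus_1_eq_Suc)
    ultimately show False by (metis not_le zero_less_Suc)
  qed
  then have "1 / K * exp (- lam0 * real n) \<le> mass (real n)" for n
    using K(1) by (simp add: field_simps)
  then show thesis using that[of "1 / K"] K(1) by simp
qed

text \<open>
  The semigroup normalised to have spectral radius \<open>1\<close>.
\<close>

definition scaled :: "real \<Rightarrow> ('a option \<Rightarrow> real) \<Rightarrow> 'a option \<Rightarrow> real" where
  "scaled t f x = exp (lam0 * t) * semi t f x"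

lemma scaled_scaled:
  assumes "0 \<le> s" "0 \<le> t" "dominated f"
  shows "scaled s (scaled t f) x = scaled (s + t) f x"
  unfolding scaled_def using semi_semi[OF assms]
  by (simp add: semi_cmult algebra_simps flip: exp_add)

lemma dominated_scaled: "0 \<le> t \<Longrightarrow> dominated f \<Longrightarrow> dominated (scaled t f)"
  unfolding scaled_def by (intro dominated_cmult dominated_semi)

lemma scaled_nonneg: "(\<And>y. 0 \<le> f y) \<Longrightarrow> 0 \<le> scaled t f x"
  unfolding scaled_def by (simp add: semi_nonneg)

lemma scaled_mono: "0 \<le> t \<Longrightarrow> dominated f \<Longrightarrow> dominated g \<Longrightarrow> (\<And>y. f y \<le> g y) \<Longrightarrow> scaled t f x \<le> scaled t g x"
  unfolding scaled_def by (intro mult_left_mono semi_mono) auto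

lemma scaled_abs_le: "0 \<le> t \<Longrightarrow> dominated f \<Longrightarrow> dominated g \<Longrightarrow> (\<And>y. \<bar>f y\<bar> \<le> g y) \<Longrightarrow> \<bar>scaled t f x\<bar> \<le> scaled t g x"
  unfolding scaled_def using semi_abs_le[of t f g x] by (simp add: abs_mult)

lemma scaled_add: "0 \<le> t \<Longrightarrow> dominated f \<Longrightarrow> dominated g \<Longrightarrow> scaled t (\<lambda>x. f x + g x) x = scaled t f x + scaled t g x"
  unfolding scaled_def by (simp add: semi_add distrib_left)

lemma scaled_diff: "0 \<le> t \<Longrightarrow> dominated f \<Longrightarrow> dominated g \<Longrightarrow> scaled t (\<lambda>x. f x - g x) x = scaled t f x - scaled t g x"
  unfolding scaled_def by (simp add: semi_diff right_diff_distrib)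

lemma scaled_cmult: "scaled t (\<lambda>x. c * f x) x = c * scaled t f x"
  unfolding scaled_def by (simp add: semi_cmult)

lemma scaled_phi_bound:
  obtains K where "0 < K" "\<And>t x. 0 \<le> t \<Longrightarrow> scaled t \<phi> x \<le> K * \<phi> x"
proof -
  obtain K1 where K1: "1 \<le> K1" "\<And>t x. 0 \<le> t \<Longrightarrow> semi t \<phi> x \<le> K1 * mass t * \<phi> x"
    using semi_phi_comparison by blast
  obtain K2 where K2: "0 \<le> K2" "\<And>n. mass (real n) \<le> K2 * exp (- lam0 * real n)"
    using mass_upper by blast
  have int: "scaled (real n) \<phi> x \<le> K1 * K2 * \<phi> x" for n x
  proof -
    have "semi (real n) \<phi> x \<le> K1 * mass (real n) * \<phi> x" by (intro K1) simp
    also have "\<dots> \<le> K1 * (K2 * exp (- lam0 * real n)) * \<phi> x"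
      using K1(1) by (intro mult_right_mono mult_left_mono K2 phi_nonneg) auto
    finally have "exp (lam0 * real n) * semi (real n) \<phi> x \<le>
        exp (lam0 * real n) * (K1 * (K2 * exp (- lam0 * real n)) * \<phi> x)" by (intro mult_left_mono) auto
    then show ?thesis by (simp add: scaled_def exp_minus field_simps)
  qed
  define K where "K = exp (lam0 + C) * (K1 * K2) + 1"
  have "scaled t \<phi> x \<le> K * \<phi> x" if t: "0 \<le> t" for t x
  proof -
    define n where "n = nat \<lfloor>t\<rfloor>"
    define u where "u = t - real n"
    have u: "0 \<le> u" "u \<le> 1" using t unfolding u_def n_def by (auto simp: of_nat_nat) linarith
    have frac: "scaled u \<phi> y \<le> exp (lam0 + C) * \<phi> y" for y
    proof -
      have "scaled u \<phi> y \<le> exp (lam0 * u) * (exp (C * u) * \<phi> y)"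
        unfolding scaled_def using u by (intro mult_left_mono semi_phi_le) auto
      also have "\<dots> = exp ((lam0 + C) * u) * \<phi> y" by (simp add: algebra_simps exp_add)
      also have "\<dots> \<le> exp (lam0 + C) * \<phi> y"
        using u lam0_nonneg C by (intro mult_right_mono phi_nonneg) (simp add: mult_left_le)
      finally show ?thesis .
    qed
    have "scaled t \<phi> x = scaled (real n) (scaled u \<phi>) x"
      using u by (subst scaled_scaled) (auto simp: dominated_phi u_def)
    also have "\<dots> \<le> scaled (real n) (\<lambda>y. exp (lam0 + C) * \<phi> y) x"
      using u frac by (intro scaled_mono dominated_scaled dominated_cmult dominated_phi) auto
    also have "\<dots> = exp (lam0 + C) * scaled (real n) \<phi> x" by (rule scaled_cmult)
    also have "\<dots> \<le> exp (lam0 + C) * (K1 * K2 * \<phi> x)" by (intro mult_left_mono int) simp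
    also have "\<dots> \<le> K * \<phi> x" using phi_nonneg by (simp add: K_def algebra_simps)
    finally show ?thesis .
  qed
  moreover have "0 < K" unfolding K_def using K1(1) K2(1) by (intro add_nonneg_pos) auto
  ultimately show thesis using that by blast
qed

end

section \<open>The right eigenfunction and exponential convergence\<close>

context lyapunov_jump_process
begin

lemma mass_scaled: "scaled t \<phi> (Some x0) = exp (lam0 * t) * mass t"
  by (simp add: scaled_def mass_def)

text \<open>
  The averages of the first \<open>N\<close> iterates of \<open>\<phi>\<close> are bounded by a multiple of \<open>\<phi>\<close>, bounded below at \<open>x0\<close>,
  and almost invariant: one more step changes them by \<open>O(1/N)\<close>.  Every pointwise limit is invariant by
  dominated convergence, and it is nonzero at \<open>x0\<close>.
\<close>

lemma right_eigenfunction_exists: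
  obtains \<eta> B where "\<And>x. 0 \<le> \<eta> x" "0 < B" "\<And>x. \<eta> x \<le> B * \<phi> x" "0 < \<eta> (Some x0)"
    "\<And>x. scaled 1 \<eta> x = \<eta> x"
proof -
  obtain K where K: "0 < K" "\<And>t x. 0 \<le> t \<Longrightarrow> scaled t \<phi> x \<le> K * \<phi> x"
    using scaled_phi_bound by blast
  obtain c where c: "0 < c" "\<And>n. c * exp (- lam0 * real n) \<le> mass (real n)"
    using mass_lower by blast
  have low: "c \<le> scaled (real n) \<phi> (Some x0)" for n
  proof -
    have "c = exp (lam0 * real n) * (c * exp (- lam0 * real n))" by (simp add: exp_minus)
    also have "\<dots> \<le> scaled (real n) \<phi> (Some x0)"
      unfolding mass_scaled by (intro mult_left_mono c) simp
    finally show ?thesis .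
  qed
  define avg where "avg N x = 1 / real (Suc N) * (\<Sum>k\<le>N. scaled (real k) \<phi> x)" for N x
  have avg0: "0 \<le> avg N x" for N x
    unfolding avg_def by (intro mult_nonneg_nonneg sum_nonneg scaled_nonneg phi_nonneg) auto
  have avgK: "avg N x \<le> K * \<phi> x" for N x
  proof -
    have "(\<Sum>k\<le>N. scaled (real k) \<phi> x) \<le> real (Suc N) * (K * \<phi> x)"
      using sum_bounded_above[of "{..N}" "\<lambda>k. scaled (real k) \<phi> x" "K * \<phi> x"] K(2) by simp
    then show ?thesis unfolding avg_def by (simp add: field_simps)
  qed
  have avgc: "c \<le> avg N (Some x0)" for N
  proof -
    have "real (Suc N) * c \<le> (\<Sum>k\<le>N. scaled (real k) \<phi> (Some x0))"
      using sum_bounded_below[of "{..N}" c "\<lambda>k. scaled (real k) \<phi> (Some x0)"] low by simp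
    then show ?thesis unfolding avg_def by (simp add: field_simps)
  qed
  have avg_abs: "\<bar>avg N x\<bar> \<le> K * \<phi> x" for N x using avg0[of N x] avgK[of N x] by simp
  have avg_dom: "dominated (avg N)" for N using avg_abs by (rule dominatedI)
  obtain r \<eta> where r: "strict_mono (r :: nat \<Rightarrow> nat)" and lim: "\<And>x. (\<lambda>n. avg (r n) x) \<longlonglongrightarrow> \<eta> x"
    using pointwise_convergent_subsequence[of avg "\<lambda>x. K * \<phi> x"] avg_abs by blast
  have eta0: "0 \<le> \<eta> x" for x
    using avg0 by (intro LIMSEQ_le_const[OF lim]) blast
  have etaK: "\<eta> x \<le> K * \<phi> x" for x
    using avgK by (intro LIMSEQ_le_const2[OF lim]) blast
  have "c \<le> \<eta> (Some x0)"
    using avgc by (intro LIMSEQ_le_const[OF lim]) blast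
  then have eta_pos: "0 < \<eta> (Some x0)" using c(1) by simp
  have shift: "scaled 1 (avg N) x = avg N x + (scaled (real (Suc N)) \<phi> x - \<phi> x) / real (Suc N)" for N x
  proof -
    have "scaled 1 (avg N) x = 1 / real (Suc N) * scaled 1 (\<lambda>y. \<Sum>k\<le>N. scaled (real k) \<phi> y) x"
      unfolding avg_def by (rule scaled_cmult)
    also have "scaled 1 (\<lambda>y. \<Sum>k\<le>N. scaled (real k) \<phi> y) x = (\<Sum>k\<le>N. scaled 1 (scaled (real k) \<phi>) x)"
      unfolding scaled_def[of 1] semi_def[of 1] sum_distrib_left[symmetric]
      by (subst Bochner_Integration.integral_sum)
         (auto intro!: dominated_kern dominated_scaled dominated_phi)
    also have "\<dots> = (\<Sum>k\<le>N. scaled (real (Suc k)) \<phi> x)"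
      by (intro sum.cong refl) (simp add: scaled_scaled dominated_phi)
    also have "\<dots> = (\<Sum>k\<le>N. scaled (real k) \<phi> x) + (scaled (real (Suc N)) \<phi> x - scaled (real 0) \<phi> x)"
      using sum.atMost_Suc_shift[of "\<lambda>k. scaled (real k) \<phi> x" N] sum.atMost_Suc[of "\<lambda>k. scaled (real k) \<phi> x" N]
      by simp
    also have "scaled (real 0) \<phi> x = \<phi> x" by (simp add: scaled_def semi_0)
    finally show ?thesis
      unfolding avg_def[of N x] by (simp add: algebra_simps add_divide_distrib diff_divide_distrib)
  qed
  have "scaled 1 \<eta> x = \<eta> x" for x
  proof (rule LIMSEQ_unique)
    show "(\<lambda>n. scaled 1 (avg (r n)) x) \<longlonglongrightarrow> scaled 1 \<eta> x"
      unfolding scaled_def semi_def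
    proof (intro tendsto_mult tendsto_const integral_dominated_convergence[where w = "\<lambda>y. K * \<phi> y"])
      show "integrable (kern 1 x) (\<lambda>y. K * \<phi> y)" by (intro integrable_mult_right phi_integrable_kern) simp
      show "AE y in kern 1 x. (\<lambda>n. avg (r n) y) \<longlonglongrightarrow> \<eta> y" using lim by simp
      show "AE y in kern 1 x. norm (avg (r n) y) \<le> K * \<phi> y" for n using avg_abs by simp
    qed simp_all
    have r_top: "filterlim (\<lambda>n. real (Suc (r n))) at_top sequentially"
      by (intro filterlim_compose[OF filterlim_real_sequentially] filterlim_compose[OF filterlim_Suc] filterlim_subseq r)
    have "(\<lambda>n. (scaled (real (Suc (r n))) \<phi> x - \<phi> x) / real (Suc (r n))) \<longlonglongrightarrow> 0"
    proof (rule Lim_null_comparison)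
      show "\<forall>\<^sub>F n in sequentially. norm ((scaled (real (Suc (r n))) \<phi> x - \<phi> x) / real (Suc (r n))) \<le>
          ((K + 1) * \<phi> x) / real (Suc (r n))"
      proof (rule always_eventually, rule allI)
        fix n
        have "0 \<le> scaled (real (Suc (r n))) \<phi> x" by (intro scaled_nonneg phi_nonneg)
        moreover have "scaled (real (Suc (r n))) \<phi> x \<le> K * \<phi> x" by (intro K) simp
        ultimately have "\<bar>scaled (real (Suc (r n))) \<phi> x - \<phi> x\<bar> \<le> (K + 1) * \<phi> x"
          using phi_nonneg[of x] by (simp add: abs_le_iff algebra_simps)
        then show "norm ((scaled (real (Suc (r n))) \<phi> x - \<phi> x) / real (Suc (r n))) \<le>
          ((K + 1) * \<phi> x) / real (Suc (r n))"
          by (simp add: divide_right_mono)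
      qed
      show "(\<lambda>n. (K + 1) * \<phi> x / real (Suc (r n))) \<longlonglongrightarrow> 0"
        by (rule tendsto_divide_0[OF tendsto_const filterlim_at_top_imp_at_infinity[OF r_top]])
    qed
    then have "(\<lambda>n. avg (r n) x + (scaled (real (Suc (r n))) \<phi> x - \<phi> x) / real (Suc (r n))) \<longlonglongrightarrow> \<eta> x + 0"
      by (intro tendsto_add lim)
    then show "(\<lambda>n. scaled 1 (avg (r n)) x) \<longlonglongrightarrow> \<eta> x" by (simp only: shift add_0_right)
  qed
  then show thesis using that[of \<eta> K] eta0 K(1) etaK eta_pos by blast
qed

lemma D0_power_lower:
  assumes p: "0 \<le> p" "\<And>x y. x \<in> D0 \<Longrightarrow> y \<in> D0 \<Longrightarrow> p \<le> pmf (kern 1 (Some x)) (Some y)"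
    and y: "y \<in> D0"
  shows "p ^ Suc i \<le> pmf (kern (real (Suc i)) (Some y)) (Some x0)"
proof -
  have "p ^ i \<le> pmf (kern 1 (Some x0)) (Some x0) ^ i" using p D0 by (intro power_mono) auto
  also have "\<dots> \<le> pmf (kern (real i * 1) (Some x0)) (Some x0)" by (intro kern_self_power) simp
  finally have "p * p ^ i \<le> pmf (kern 1 (Some y)) (Some x0) * pmf (kern (real i) (Some x0)) (Some x0)"
    using p y D0 by (intro mult_mono) auto
  also have "\<dots> \<le> pmf (kern (1 + real i) (Some y)) (Some x0)" by (intro kern_add_ge) auto
  finally show ?thesis by simp
qed

lemma scaled_drift:
  obtains r K where "0 < r" "r < 1" "0 \<le> K" "\<And>x. scaled 1 \<phi> x \<le> r * \<phi> x + K * scaled 1 iD x"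
proof -
  obtain K where K: "0 \<le> K" "\<And>x. semi 1 \<phi> x \<le> exp (- lam1 * 1) * \<phi> x + K * semi 1 iD x"
    using semi_drift[of 1] by auto
  define r where "r = exp (- (lam1 - lam0))"
  have "scaled 1 \<phi> x \<le> r * \<phi> x + K * scaled 1 iD x" for x
  proof -
    have "scaled 1 \<phi> x \<le> exp lam0 * (exp (- lam1) * \<phi> x + K * semi 1 iD x)"
      using K(2)[of x] unfolding scaled_def by simp
    also have "\<dots> = r * \<phi> x + K * scaled 1 iD x"
      by (simp add: r_def scaled_def algebra_simps exp_diff exp_minus field_simps)
    finally show ?thesis .
  qed
  moreover have "0 < r" "r < 1" using lam1 by (auto simp: r_def)
  ultimately show thesis using that K(1) by blast
qed

text \<open>
  The two hypotheses of Harris' theorem.  The drift relative to \<open>\<eta>\<close> holds because \<open>\<eta>\<close> is bounded below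
  on \<open>D0\<close>; its constant \<open>\<kappa>\<close> is the same for all times, so the radius \<open>Rad\<close> can be fixed before the
  length \<open>m\<close> of the time step.  For the minorization, \<open>\<eta> = T\<^sub>N \<eta> \<le> B T\<^sub>N \<phi>\<close> and the iterated drift bound
  \<open>\<eta>\<close> by a contracted multiple of \<open>\<phi>\<close>, at most \<open>\<eta> / 2\<close> on the sublevel set once \<open>N\<close> is large, plus
  probabilities of visits to \<open>D0\<close>; from \<open>D0\<close> the point \<open>x0\<close> is reached at time \<open>m\<close>.
\<close>

theorem skeleton_convergence:
  obtains \<eta> B A \<rho> and m :: nat where "\<And>x. 0 \<le> \<eta> x" "0 < B" "\<And>x. \<eta> x \<le> B * \<phi> x" "0 < \<eta> (Some x0)"
    "\<And>n x. scaled (real n) \<eta> x = \<eta> x" "0 < m" "0 \<le> \<rho>" "\<rho> < 1" "0 \<le> A"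
    "\<And>f. (\<And>x. \<bar>f x\<bar> \<le> \<phi> x) \<Longrightarrow> \<exists>c. \<forall>n x. \<bar>scaled (real (n * m)) f x - c * \<eta> x\<bar> \<le> A * \<rho> ^ n * \<phi> x"
proof -
  obtain \<eta> B where eta0: "\<And>x. 0 \<le> \<eta> x" and B: "0 < B" "\<And>x. \<eta> x \<le> B * \<phi> x"
    and eta_pos: "0 < \<eta> (Some x0)" and eta1: "\<And>x. scaled 1 \<eta> x = \<eta> x"
    using right_eigenfunction_exists by blast
  have eta_dom: "dominated \<eta>" using eta0 B by (intro dominatedI[of _ B]) simp
  have eta_n: "scaled (real n) \<eta> x = \<eta> x" for n x
  proof (induction n arbitrary: x)
    case (Suc n)
    have "scaled (real (Suc n)) \<eta> x = scaled 1 (scaled (real n) \<eta>) x"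
      by (subst scaled_scaled) (auto simp: eta_dom)
    also have "scaled (real n) \<eta> = \<eta>" using Suc by blast
    finally show ?case by (simp add: eta1)
  qed (simp add: scaled_def semi_0)
  obtain p where p: "0 < p" "p \<le> 1" "\<And>x y. x \<in> D0 \<Longrightarrow> y \<in> D0 \<Longrightarrow> p \<le> pmf (kern 1 (Some x)) (Some y)"
    using D0_pos_lower by blast
  obtain r K1 where r: "0 < r" "r < 1" and K1: "0 \<le> K1"
    and drift1: "\<And>x. scaled 1 \<phi> x \<le> r * \<phi> x + K1 * scaled 1 iD x"
    using scaled_drift by blast
  have visits: "scaled (real n) \<phi> x \<le> r ^ n * \<phi> x + K1 * (\<Sum>j<n. scaled (real (Suc j)) iD x)" for n x
  proof (induction n)
    case 0 then show ?case by (simp add: scaled_def semi_0)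
  next
    case (Suc n)
    let ?V = "\<lambda>n. \<Sum>j<n. scaled (real (Suc j)) iD x"
    have V0: "0 \<le> ?V n" by (intro sum_nonneg scaled_nonneg) simp
    have "scaled (real (Suc n)) \<phi> x = scaled (real n) (scaled 1 \<phi>) x"
      by (subst scaled_scaled) (auto simp: dominated_phi add.commute)
    also have "\<dots> \<le> scaled (real n) (\<lambda>y. r * \<phi> y + K1 * scaled 1 iD y) x"
      using drift1 by (intro scaled_mono dominated_scaled dominated_add dominated_cmult dominated_phi dominated_indicator) auto
    also have "\<dots> = r * scaled (real n) \<phi> x + K1 * scaled (real n) (scaled 1 iD) x"
      by (subst scaled_add)
         (auto simp: scaled_cmult intro!: dominated_scaled dominated_cmult dominated_phi dominated_indicator)
    also have "scaled (real n) (scaled 1 iD) x = scaled (real (Suc n)) iD x"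
      by (subst scaled_scaled) (auto simp: dominated_indicator add.commute)
    also have "r * scaled (real n) \<phi> x \<le> r * (r ^ n * \<phi> x + K1 * ?V n)"
      using Suc r by (intro mult_left_mono) auto
    also have "\<dots> \<le> r ^ Suc n * \<phi> x + K1 * ?V n"
      using r K1 V0 mult_left_mono[of r 1 "K1 * ?V n"] by (simp add: algebra_simps)
    finally show ?case by (simp add: algebra_simps)
  qed
  have iD_le: "\<exists>\<delta>>0. \<forall>x\<in>D0. \<delta> \<le> \<eta> (Some x)"
  proof (rule finite_uniform_positive[OF D0(1)])
    fix x assume x: "x \<in> D0"
    have "0 < exp lam0 * (pmf (kern 1 (Some x)) (Some x0) * \<eta> (Some x0))"
      using positive[OF x D0(2)] eta_pos by simp
    also have "\<dots> \<le> scaled 1 \<eta> (Some x)"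
      using semi_ge_point[OF _ eta_dom eta0, of 1 "Some x" "Some x0"] by (simp add: scaled_def)
    finally show "\<exists>c>0. c \<le> \<eta> (Some x)" by (auto simp: eta1)
  qed linarith
  then obtain \<delta> where \<delta>: "0 < \<delta>" "\<And>x. x \<in> D0 \<Longrightarrow> \<delta> \<le> \<eta> (Some x)" by blast
  have iD_eta: "scaled (real n) iD x \<le> 1 / \<delta> * \<eta> x" for n x
  proof -
    have "scaled (real n) iD x \<le> scaled (real n) (\<lambda>y. 1 / \<delta> * \<eta> y) x"
    proof (intro scaled_mono dominated_indicator dominated_cmult eta_dom)
      show "iD y \<le> 1 / \<delta> * \<eta> y" for y
        using \<delta> eta0[of y] by (auto simp: indicator_def field_simps)
    qed simp
    also have "\<dots> = 1 / \<delta> * \<eta> x" by (simp only: scaled_cmult eta_n)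
    finally show ?thesis .
  qed
  define \<kappa>1 where "\<kappa>1 = K1 / \<delta>"
  have \<kappa>1: "0 \<le> \<kappa>1" using K1 \<delta> by (simp add: \<kappa>1_def)
  define \<kappa> where "\<kappa> = \<kappa>1 / (1 - r)"
  have \<kappa>: "0 \<le> \<kappa>" using \<kappa>1 r by (simp add: \<kappa>_def)
  have drift_n: "scaled (real n) \<phi> x \<le> r ^ n * \<phi> x + \<kappa> * (1 - r ^ n) * \<eta> x" for n x
  proof (induction n)
    case 0 then show ?case by (simp add: scaled_def semi_0)
  next
    case (Suc n)
    have "scaled (real (Suc n)) \<phi> x = scaled (real n) (scaled 1 \<phi>) x"
      by (subst scaled_scaled) (auto simp: dominated_phi add.commute)
    also have "\<dots> \<le> scaled (real n) (\<lambda>y. r * \<phi> y + \<kappa>1 * \<eta> y) x"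
    proof (intro scaled_mono dominated_scaled dominated_add dominated_cmult dominated_phi eta_dom)
      show "scaled 1 \<phi> y \<le> r * \<phi> y + \<kappa>1 * \<eta> y" for y
        using drift1[of y] mult_left_mono[OF iD_eta[of 1 y] K1(1)] by (simp add: \<kappa>1_def)
    qed auto
    also have "\<dots> = r * scaled (real n) \<phi> x + \<kappa>1 * \<eta> x"
      by (subst scaled_add) (auto simp: scaled_cmult eta_n intro!: dominated_cmult dominated_phi eta_dom)
    also have "\<dots> \<le> r * (r ^ n * \<phi> x + \<kappa> * (1 - r ^ n) * \<eta> x) + \<kappa>1 * \<eta> x"
      using Suc r by (intro add_right_mono mult_left_mono) auto
    also have "\<kappa>1 = \<kappa> * (1 - r)" using r by (simp add: \<kappa>_def)
    finally show ?case by (simp add: algebra_simps)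
  qed
  \<comment> \<open>Any radius above \<open>2 \<kappa> / (1 - r)\<close> works for all time steps m at once, as \<open>r\<^sup>m \<le> r\<close>.\<close>
  define Rad where "Rad = 2 * \<kappa> / (1 - r) + 1"
  have Rad: "0 < Rad" using \<kappa> r by (simp add: Rad_def add_nonneg_pos)
  have "\<forall>\<^sub>F n in sequentially. r ^ n < 1 / (2 * B * Rad)"
    using order_tendstoD(2)[OF LIMSEQ_power_zero[of r]] r B(1) Rad by simp
  then obtain N where N: "r ^ N < 1 / (2 * B * Rad)" unfolding eventually_sequentially by blast
  define m where "m = Suc N"
  define R where "R = exp (lam0 * real m)"
  define d where "d = p ^ m"
  have d: "0 < d" using p by (simp add: d_def)
  \<comment> \<open>The summand 1 keeps Q positive in case no visit to the finite set is counted.\<close>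
  define Q where "Q = 2 * B * K1 * real N / d + 1"
  have Q: "0 < Q" unfolding Q_def using B K1 d by (intro add_nonneg_pos) auto
  have visit_x0: "scaled (real (Suc j)) iD x \<le> 1 / d * (R * pmf (kern (real m) x) (Some x0))" if j: "j < N" for j x
  proof -
    define i where "i = N - Suc j"
    have i: "m = Suc j + Suc i" using j by (simp add: m_def i_def)
    have "d * semi (real (Suc j)) iD x = semi (real (Suc j)) (\<lambda>y. d * iD y) x" by (simp add: semi_cmult)
    also have "\<dots> \<le> semi (real (Suc j)) (semi (real (Suc i)) (indicator {Some x0})) x"
    proof (rule semi_mono)
      show "dominated (\<lambda>y. d * iD y)" by (intro dominated_cmult dominated_indicator)
      show "dominated (semi (real (Suc i)) (indicator {Some x0}))"
        using dominated_indicator[of "{x0}"] by (intro dominated_semi) auto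
      fix y
      have "d \<le> pmf (kern (real (Suc i)) (Some z)) (Some x0)" if "z \<in> D0" for z
      proof -
        have "d \<le> p ^ Suc i" unfolding d_def i using p by (intro power_decreasing) auto
        also have "\<dots> \<le> pmf (kern (real (Suc i)) (Some z)) (Some x0)"
          using p that by (intro D0_power_lower) auto
        finally show ?thesis .
      qed
      then show "d * iD y \<le> semi (real (Suc i)) (indicator {Some x0}) y"
        by (auto simp: semi_indicator indicator_def)
    qed simp
    also have "\<dots> = pmf (kern (real m) x) (Some x0)"
      using dominated_indicator[of "{x0}"] by (subst semi_semi[symmetric]) (auto simp: semi_indicator i)
    finally have "semi (real (Suc j)) iD x \<le> 1 / d * pmf (kern (real m) x) (Some x0)"
      using d by (simp add: field_simps)
    moreover have "exp (lam0 * real (Suc j)) \<le> R"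
      unfolding R_def i using lam0_nonneg by (simp add: mult_left_mono)
    ultimately have "scaled (real (Suc j)) iD x \<le> R * (1 / d * pmf (kern (real m) x) (Some x0))"
      unfolding scaled_def using d by (intro mult_mono) (auto simp: R_def intro: semi_nonneg)
    then show ?thesis by (simp add: mult_ac)
  qed
  have minor: "1 / Q * \<eta> x \<le> R * pmf (kern (real m) x) (Some x0)" if x: "\<phi> x \<le> Rad * \<eta> x" for x
  proof -
    let ?p = "R * pmf (kern (real m) x) (Some x0)"
    have p0: "0 \<le> ?p" by (simp add: R_def)
    have "\<eta> x \<le> B * scaled (real N) \<phi> x"
      using scaled_mono[of "real N" \<eta> "\<lambda>y. B * \<phi> y" x] B eta_dom
      by (simp add: scaled_cmult eta_n dominated_cmult dominated_phi)
    also have "\<dots> \<le> B * (r ^ N * \<phi> x + K1 * (\<Sum>j<N. scaled (real (Suc j)) iD x))"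
      using B by (intro mult_left_mono visits) auto
    also have "\<dots> \<le> B * (r ^ N * (Rad * \<eta> x) + K1 * (\<Sum>j<N. 1 / d * ?p))"
      using B r K1 x by (intro mult_left_mono add_mono sum_mono visit_x0) auto
    also have "\<dots> = (r ^ N * (B * Rad)) * \<eta> x + B * K1 * real N / d * ?p" by (simp add: algebra_simps)
    also have "\<dots> \<le> 1 / 2 * \<eta> x + B * K1 * real N / d * ?p"
    proof -
      have "r ^ N * (B * Rad) \<le> 1 / 2" using N B(1) Rad by (simp add: field_simps)
      then show ?thesis using eta0 by (intro add_right_mono mult_right_mono) auto
    qed
    finally have "\<eta> x \<le> 2 * B * K1 * real N / d * ?p" by simp
    also have "\<dots> \<le> Q * ?p" unfolding Q_def using p0 by (intro mult_right_mono) auto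
    finally show ?thesis using Q by (simp add: field_simps)
  qed
  have rm: "0 \<le> r ^ m" "r ^ m \<le> r" using r by (auto simp: m_def mult_left_le power_le_one)
  interpret H: harris_kernel \<phi> "kern (real m)" R "r ^ m" \<kappa> B "1 / Q" Rad \<eta> "Some x0"
  proof
    show "0 < R" by (simp add: R_def)
    show "integrable (kern (real m) x) \<phi>" for x by (intro phi_integrable_kern) simp
    show "R * measure_pmf.expectation (kern (real m) x) \<eta> = \<eta> x" for x
      using eta_n[of m x] by (simp add: scaled_def semi_def R_def)
    show "R * measure_pmf.expectation (kern (real m) x) \<phi> \<le> r ^ m * \<phi> x + \<kappa> * \<eta> x" for x
    proof -
      have "\<kappa> * (1 - r ^ m) * \<eta> x \<le> \<kappa> * 1 * \<eta> x"
        using \<kappa> rm eta0 by (intro mult_right_mono mult_left_mono) auto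
      then show ?thesis using drift_n[of m x] by (simp add: scaled_def semi_def R_def)
    qed
    show "0 \<le> r ^ m" "r ^ m < 1" using rm r by auto
    show "2 * \<kappa> / (1 - r ^ m) < Rad"
    proof -
      have "2 * \<kappa> / (1 - r ^ m) \<le> 2 * \<kappa> / (1 - r)" using \<kappa> rm r by (intro divide_left_mono) auto
      then show ?thesis by (simp add: Rad_def)
    qed
  qed (use eta0 B eta_pos \<kappa> Q minor in auto)
  have HT: "H.T f x = scaled (real m) f x" for f x
    unfolding H.T_def by (simp add: scaled_def semi_def R_def)
  have HTn: "(H.T ^^ n) f = scaled (real (n * m)) f" if "dominated f" for n f
  proof (induction n)
    case 0 then show ?case by (simp add: fun_eq_iff scaled_def semi_0)
  next
    case (Suc n)
    have "(H.T ^^ Suc n) f x = scaled (real m) (scaled (real (n * m)) f) x" for x by (simp add: HT Suc)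
    also have "\<dots> x = scaled (real (Suc n * m)) f x" for x
      using that by (subst scaled_scaled) (auto simp: algebra_simps)
    finally show ?case by blast
  qed
  obtain \<rho> A where \<rho>: "0 \<le> \<rho>" "\<rho> < 1" "0 \<le> A"
    and conv: "\<And>f. (\<And>x. \<bar>f x\<bar> \<le> \<phi> x) \<Longrightarrow> \<exists>c. \<forall>n x. \<bar>(H.T ^^ n) f x - c * \<eta> x\<bar> \<le> A * \<rho> ^ n * \<phi> x"
    using H.geometric_convergence by blast
  show thesis
  proof (rule that[of \<eta> B m \<rho> A])
    show "0 < m" by (simp add: m_def)
    show "\<exists>c. \<forall>n x. \<bar>scaled (real (n * m)) f x - c * \<eta> x\<bar> \<le> A * \<rho> ^ n * \<phi> x" if "\<And>x. \<bar>f x\<bar> \<le> \<phi> x" for f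
    proof -
      have "dominated f" using that by (intro dominatedI[of _ 1]) simp
      then show ?thesis using conv[OF that] by (simp only: HTn)
    qed
  qed (use eta0 B eta_pos eta_n \<rho> in auto)
qed

text \<open>
  Passage from the skeleton to all times.  Since \<open>T\<^sub>t \<eta>\<close> is invariant under the skeleton, it is a multiple
  \<open>k(t) \<eta>\<close>; as \<open>k\<close> is multiplicative, bounded and equal to \<open>1\<close> at the integers, it is constantly \<open>1\<close>.
  For \<open>t = n m + s\<close> the convergence along the skeleton is then transported by \<open>T\<^sub>s\<close>.
\<close>

theorem exponential_convergence:
  obtains \<eta> B \<epsilon> and c :: "('a option \<Rightarrow> real) \<Rightarrow> real" where
    "\<And>x. 0 \<le> \<eta> x" "0 < B" "\<And>x. \<eta> x \<le> B * \<phi> x" "0 < \<eta> (Some x0)"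
    "\<And>t x. 0 \<le> t \<Longrightarrow> scaled t \<eta> x = \<eta> x" "(\<epsilon> \<longlongrightarrow> 0) at_top"
    "\<And>f t x. (\<And>y. \<bar>f y\<bar> \<le> \<phi> y) \<Longrightarrow> 0 \<le> t \<Longrightarrow> \<bar>scaled t f x - c f * \<eta> x\<bar> \<le> \<epsilon> t * \<phi> x"
proof -
  obtain \<eta> B A \<rho> and m :: nat where eta0: "\<And>x. 0 \<le> \<eta> x" and B: "0 < B" "\<And>x. \<eta> x \<le> B * \<phi> x"
    and eta_pos: "0 < \<eta> (Some x0)" and eta_n: "\<And>n x. scaled (real n) \<eta> x = \<eta> x"
    and m: "0 < m" and \<rho>: "0 \<le> \<rho>" "\<rho> < 1" and A: "0 \<le> A"
    and conv: "\<And>f. (\<And>x. \<bar>f x\<bar> \<le> \<phi> x) \<Longrightarrow> \<exists>c. \<forall>n x. \<bar>scaled (real (n * m)) f x - c * \<eta> x\<bar> \<le> A * \<rho> ^ n * \<phi> x"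
    by (rule skeleton_convergence) blast
  have eta_dom: "dominated \<eta>" using eta0 B by (intro dominatedI[of _ B]) simp
  obtain K where K: "0 < K" "\<And>t x. 0 \<le> t \<Longrightarrow> scaled t \<phi> x \<le> K * \<phi> x"
    using scaled_phi_bound by blast
  have pow0: "(\<lambda>n. D * \<rho> ^ n * z) \<longlonglongrightarrow> 0" for D z
    using tendsto_mult[OF tendsto_mult[OF tendsto_const[of D] LIMSEQ_power_zero[of \<rho>]] tendsto_const[of z]] \<rho> by simp
  have multiple: "\<exists>k. \<forall>x. scaled t \<eta> x = k * \<eta> x" if t: "0 \<le> t" for t
  proof -
    define D where "D = B * K"
    have D: "0 < D" using B K by (simp add: D_def)
    define f where "f x = 1 / D * scaled t \<eta> x" for x
    have tdom: "dominated (scaled t \<eta>)" using t by (intro dominated_scaled eta_dom)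
    have "\<bar>f x\<bar> \<le> \<phi> x" for x
    proof -
      have "scaled t \<eta> x \<le> B * scaled t \<phi> x"
        using scaled_mono[of t \<eta> "\<lambda>y. B * \<phi> y" x] t B eta_dom
        by (simp add: scaled_cmult dominated_cmult dominated_phi)
      also have "\<dots> \<le> B * (K * \<phi> x)" using B t by (intro mult_left_mono K) auto
      finally have "scaled t \<eta> x \<le> D * \<phi> x" by (simp add: D_def mult.assoc)
      moreover have "0 \<le> scaled t \<eta> x" by (intro scaled_nonneg eta0)
      ultimately show ?thesis using D by (simp add: f_def field_simps)
    qed
    then obtain c where c: "\<And>n x. \<bar>scaled (real (n * m)) f x - c * \<eta> x\<bar> \<le> A * \<rho> ^ n * \<phi> x"
      using conv by blast
    have inv: "scaled (real (n * m)) f x = f x" for n x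
    proof -
      have "scaled (real (n * m)) f x = 1 / D * scaled (real (n * m)) (scaled t \<eta>) x"
        unfolding f_def by (rule scaled_cmult)
      also have "scaled (real (n * m)) (scaled t \<eta>) x = scaled t (scaled (real (n * m)) \<eta>) x"
        using t eta_dom by (simp add: scaled_scaled add.commute)
      also have "scaled (real (n * m)) \<eta> = \<eta>" using eta_n by blast
      finally show ?thesis by (simp only: f_def[of x])
    qed
    have "f x = c * \<eta> x" for x
    proof -
      have "\<bar>f x - c * \<eta> x\<bar> \<le> A * \<rho> ^ n * \<phi> x" for n using c[of n x] by (simp only: inv)
      then have "\<bar>f x - c * \<eta> x\<bar> \<le> 0"
        by (intro LIMSEQ_le_const[OF pow0[of A "\<phi> x"]]) blast
      then show ?thesis by simp
    qed
    then have "scaled t \<eta> x = (D * c) * \<eta> x" for x using D by (simp add: f_def field_simps)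
    then show ?thesis by blast
  qed
  define k where "k t = scaled t \<eta> (Some x0) / \<eta> (Some x0)" for t
  have k: "scaled t \<eta> x = k t * \<eta> x" if t: "0 \<le> t" for t x
  proof -
    obtain d where d: "\<forall>x. scaled t \<eta> x = d * \<eta> x" using multiple[OF t] by (rule exE)
    have "k t = d" using d[rule_format, of "Some x0"] eta_pos unfolding k_def by simp
    then show ?thesis using d by (simp only:)
  qed
  have k_add: "k (s + t) = k s * k t" if "0 \<le> s" "0 \<le> t" for s t
  proof -
    have "scaled (s + t) \<eta> (Some x0) = scaled s (scaled t \<eta>) (Some x0)"
      by (rule scaled_scaled[OF that eta_dom, symmetric])
    also have "scaled t \<eta> = (\<lambda>x. k t * \<eta> x)" by (rule ext) (rule k[OF that(2)])
    finally have "scaled (s + t) \<eta> (Some x0) = k t * scaled s \<eta> (Some x0)" by (simp only: scaled_cmult)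
    then show ?thesis unfolding k_def[of "s + t"] k_def[of s] by simp
  qed
  have k_nat: "k (real n) = 1" for n using eta_pos by (simp add: k_def eta_n)
  have k_power: "k (real n * t) = k t ^ n" if t: "0 \<le> t" for n t
  proof (induction n)
    case 0 then show ?case using k_nat[of 0] by simp
  next
    case (Suc n)
    have "k (real (Suc n) * t) = k (t + real n * t)" by (simp add: algebra_simps)
    then show ?case using Suc t by (simp add: k_add)
  qed
  define Kb where "Kb = B * K * \<phi> (Some x0) / \<eta> (Some x0)"
  have k_bound: "k t \<le> Kb" if t: "0 \<le> t" for t
  proof -
    have "scaled t \<eta> (Some x0) \<le> B * scaled t \<phi> (Some x0)"
      using scaled_mono[of t \<eta> "\<lambda>y. B * \<phi> y" "Some x0"] t B eta_dom
      by (simp add: scaled_cmult dominated_cmult dominated_phi)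
    also have "\<dots> \<le> B * (K * \<phi> (Some x0))" using B t by (intro mult_left_mono K) auto
    finally show ?thesis using eta_pos by (simp add: k_def Kb_def divide_right_mono)
  qed
  \<comment> \<open>A value above 1 would make the powers \<open>k t ^ n = k (n t)\<close> unbounded.\<close>
  have k_le: "k t \<le> 1" if t: "0 \<le> t" for t
  proof (rule ccontr)
    assume "\<not> k t \<le> 1"
    then obtain n where "Kb < k t ^ n" using real_arch_pow[of "k t" Kb] by auto
    then show False using k_bound[of "real n * t"] t by (simp add: k_power)
  qed
  have k1: "k t = 1" if t: "0 \<le> t" for t
  proof -
    obtain n where n: "t \<le> real n" using real_arch_simple by blast
    have "k t * k (real n - t) = 1" using k_add[of t "real n - t"] n t k_nat by simp
    moreover have "k (real n - t) \<le> 1" "k t \<le> 1" using n t by (auto intro: k_le)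
    moreover have "0 \<le> k t" unfolding k_def using eta_pos by (simp add: scaled_nonneg eta0)
    ultimately show ?thesis by (smt (verit) mult_left_le)
  qed
  have eta_t: "scaled t \<eta> x = \<eta> x" if "0 \<le> t" for t x using k[OF that] k1[OF that] by simp
  define c where "c f = (SOME c. \<forall>n x. \<bar>scaled (real (n * m)) f x - c * \<eta> x\<bar> \<le> A * \<rho> ^ n * \<phi> x)" for f
  have c: "\<bar>scaled (real (n * m)) f x - c f * \<eta> x\<bar> \<le> A * \<rho> ^ n * \<phi> x"
    if "\<And>x. \<bar>f x\<bar> \<le> \<phi> x" for f n x
    using someI_ex[OF conv[OF that]] unfolding c_def by blast
  define \<epsilon> where "\<epsilon> t = A * \<rho> ^ nat \<lfloor>t / real m\<rfloor> * K" for t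
  have eps: "(\<epsilon> \<longlongrightarrow> 0) at_top"
  proof -
    have "filterlim (\<lambda>t. 1 / real m * t) at_top at_top"
      by (rule filterlim_tendsto_pos_mult_at_top[OF tendsto_const _ filterlim_ident]) (use m in simp)
    then have "filterlim (\<lambda>t. t / real m) at_top at_top" by simp
    then have "filterlim (\<lambda>t. nat \<lfloor>t / real m\<rfloor>) sequentially at_top"
      by (intro filterlim_compose[OF filterlim_nat_sequentially] filterlim_compose[OF filterlim_floor_sequentially])
    then show ?thesis unfolding \<epsilon>_def by (rule filterlim_compose[OF pow0])
  qed
  have main: "\<bar>scaled t f x - c f * \<eta> x\<bar> \<le> \<epsilon> t * \<phi> x"
    if f: "\<And>y. \<bar>f y\<bar> \<le> \<phi> y" and t: "0 \<le> t" for f t x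
  proof -
    have dom: "dominated f" using f by (intro dominatedI[of _ 1]) simp
    define n where "n = nat \<lfloor>t / real m\<rfloor>"
    define s where "s = t - real (n * m)"
    have "real n \<le> t / real m" unfolding n_def using t by (simp add: of_nat_nat)
    then have s: "0 \<le> s" using m by (simp add: s_def field_simps)
    define g where "g y = scaled (real (n * m)) f y - c f * \<eta> y" for y
    have g_le: "\<bar>g y\<bar> \<le> (A * \<rho> ^ n) * \<phi> y" for y unfolding g_def by (rule c[OF f])
    have g_dom: "dominated g" using g_le by (rule dominatedI)
    have "scaled s g x = scaled s (scaled (real (n * m)) f) x - c f * \<eta> x"
      unfolding g_def
      by (subst scaled_diff[OF s dominated_scaled[OF _ dom] dominated_cmult[OF eta_dom]])
         (simp_all add: scaled_cmult eta_t s)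
    also have "scaled s (scaled (real (n * m)) f) x = scaled t f x"
      using s dom by (subst scaled_scaled) (auto simp: s_def)
    finally have "\<bar>scaled t f x - c f * \<eta> x\<bar> = \<bar>scaled s g x\<bar>" by simp
    also have "\<dots> \<le> scaled s (\<lambda>y. (A * \<rho> ^ n) * \<phi> y) x"
      by (rule scaled_abs_le[OF s g_dom dominated_cmult[OF dominated_phi] g_le])
    also have "\<dots> = (A * \<rho> ^ n) * scaled s \<phi> x" by (rule scaled_cmult)
    also have "\<dots> \<le> (A * \<rho> ^ n) * (K * \<phi> x)" using A \<rho> s by (intro mult_left_mono K) auto
    finally show ?thesis by (simp add: \<epsilon>_def n_def mult.assoc)
  qed
  show thesis by (rule that[OF eta0 B eta_pos eta_t eps main])
qed

end

section \<open>Assumption (F)\<close>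

context absorbed_markov_jump_process
begin

lemma semigroup_op_eq:
  assumes t: "0 \<le> t" and f: "f None = 0"
  shows "semigroup_op P X t f x = (\<integral>\<^sup>+z. ennreal (f z) \<partial>kern t x)"
  unfolding semigroup_op_def nn_integral_kern[OF t]
proof (rule nn_integral_cong_AE)
  show "AE \<omega> in P x. (if ereal t < absorption_time X \<omega> then ennreal (f (X t \<omega>)) else 0) = ennreal (f (X t \<omega>))"
    using AE_absorption[OF t, of x] by eventually_elim (auto simp: f)
qed

lemma semigroup_op_cut:
  "semigroup_op P X t f x = semigroup_op P X t (f(None := 0)) x" if "0 \<le> t"
  unfolding semigroup_op_def
proof (rule nn_integral_cong_AE)
  show "AE \<omega> in P x. (if ereal t < absorption_time X \<omega> then ennreal (f (X t \<omega>)) else 0) =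
      (if ereal t < absorption_time X \<omega> then ennreal ((f(None := 0)) (X t \<omega>)) else 0)"
    using AE_absorption[OF that, of x] by eventually_elim auto
qed

lemma survival_event: "0 \<le> t \<Longrightarrow> {\<omega>\<in>space M. ereal t < absorption_time X \<omega>} \<in> sets M"
proof -
  assume t: "0 \<le> t"
  have "{\<omega>\<in>space M. ereal t < absorption_time X \<omega>} = space M - {\<omega>\<in>space M. hitting_time X {None} \<omega> \<le> ereal t}"
    by (auto simp: absorption_time_def not_le)
  also have "\<dots> \<in> sets M"
    using hitting_time_le_in_past[OF t, of "{None}"] sets_past_subset by blast
  finally show ?thesis .
qed

lemma state_event: "0 \<le> t \<Longrightarrow> {\<omega>\<in>space M. X t \<omega> \<in> A} \<in> sets M"
  using measurable_sets[OF X_measurable(1), of t A] by (simp add: vimage_def Int_def conj_commute)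

lemma survival_eq: "0 \<le> t \<Longrightarrow> survival P X t x = measure (kern t x) (range Some)"
proof -
  assume t: "0 \<le> t"
  interpret prob_space "P x" by (rule laws)
  have "survival P X t x = \<P>(\<omega> in P x. X t \<omega> \<in> range Some)"
    unfolding survival_def
  proof (rule prob_eq_AE)
    show "AE \<omega> in P x. (ereal t < absorption_time X \<omega>) = (X t \<omega> \<in> range Some)"
      using AE_absorption[OF t, of x] by eventually_elim (metis notin_range_Some)
  qed (use survival_event[OF t] state_event[OF t, of "range Some"] in \<open>simp_all add: laws(2)\<close>)
  then show ?thesis using t by (simp add: measure_kern)
qed

text \<open>
  No path returns from the cemetery point, so \<open>L\<close> can only be hit before absorption.
\<close>

lemma hit_before_absorption:
  "AE \<omega> in P x. \<forall>t\<ge>0. hitting_time X (Some ` L) \<omega> \<le> min (ereal t) (absorption_time X \<omega>) \<longleftrightarrow>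
    hitting_time X (Some ` L) \<omega> \<le> ereal t"
  using absorbed[of x] AE_space
proof eventually_elim
  case (elim \<omega>)
  then have w: "\<omega> \<in> space M" by simp
  have "hitting_time X (Some ` L) \<omega> \<le> absorption_time X \<omega>" if "hitting_time X (Some ` L) \<omega> \<le> ereal t" for t
  proof (rule ccontr)
    assume "\<not> ?thesis"
    then have lt: "absorption_time X \<omega> < hitting_time X (Some ` L) \<omega>" by simp
    have fin: "hitting_time X (Some ` L) \<omega> < \<infinity>" using that by auto
    have fin': "hitting_time X {None} \<omega> < \<infinity>" using less_trans[OF lt fin] by (simp add: absorption_time_def)
    show False
    proof (rule hitting_time_attained[OF w fin], rule hitting_time_attained[OF w fin'])
      fix u v assume u: "hitting_time X (Some ` L) \<omega> = ereal u" "X u \<omega> \<in> Some ` L"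
        and v: "0 \<le> v" "hitting_time X {None} \<omega> = ereal v" "X v \<omega> \<in> {None}"
      have "v \<le> u" using lt u v by (simp add: absorption_time_def)
      then have "X u \<omega> = None" using elim(1)[rule_format, of v u] v by auto
      then show False using u(2) by auto
    qed
  qed
  then show ?case by (auto simp: min_def)
qed

lemma initial_law_measure:
  assumes A: "A \<in> sets M"
  shows "measure (initial_law P \<mu>) A = measure_pmf.expectation \<mu> (\<lambda>x. measure (P (Some x)) A)"
    and "space (initial_law P \<mu>) = space M"
proof -
  have K: "(\<lambda>x. P (Some x)) \<in> measurable (measure_pmf \<mu>) (subprob_algebra M)"
    using laws by (auto simp: measurable_def space_subprob_algebra prob_space_imp_subprob_space)
  show "space (initial_law P \<mu>) = space M"
    unfolding initial_law_def by (rule space_bind_measurable[OF K]) simp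
  have "emeasure (initial_law P \<mu>) A = (\<integral>\<^sup>+x. emeasure (P (Some x)) A \<partial>\<mu>)"
    unfolding initial_law_def by (rule emeasure_bind[OF _ K A]) simp
  also have "\<dots> = (\<integral>\<^sup>+x. ennreal (measure (P (Some x)) A) \<partial>\<mu>)"
  proof (rule nn_integral_cong)
    fix x
    interpret prob_space "P (Some x)" by (rule laws)
    show "emeasure (P (Some x)) A = ennreal (measure (P (Some x)) A)" by (rule emeasure_eq_measure)
  qed
  also have "\<dots> = ennreal (measure_pmf.expectation \<mu> (\<lambda>x. measure (P (Some x)) A))"
    by (intro nn_integral_eq_integral measure_pmf.integrable_const_bound[where B = 1])
       (auto simp: prob_space.prob_le_1[OF laws(1)])
  finally show "measure (initial_law P \<mu>) A = measure_pmf.expectation \<mu> (\<lambda>x. measure (P (Some x)) A)"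
    by (simp add: measure_def integral_nonneg_AE)
qed

end

context lyapunov_jump_process
begin

lemma semi_indicator_set: "semi t (indicator A) x = measure (kern t x) A"
  unfolding semi_def by simp

lemma survival_semi: "0 \<le> t \<Longrightarrow> survival P X t x = semi t iE x"
  by (simp add: survival_eq semi_indicator_set)

lemma phi_case: "case_option 0 (\<lambda>x. \<phi> (Some x)) = \<phi>"
  by (auto simp: fun_eq_iff phi_None split: option.split)

text \<open>
  The second clause of (F0): the strong Markov property, once the indicators of survival are absorbed into
  a function that vanishes at the cemetery point.
\<close>

lemma strong_markov_clause:
  assumes t: "0 \<le> t" and f: "\<forall>y. 0 \<le> f y"
  shows "(\<integral>\<^sup>+\<omega>. (if \<tau> \<omega> \<le> ereal t \<and> ereal t < absorption_time X \<omega> then ennreal (f (X t \<omega>)) else 0) \<partial>P x) =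
    (\<integral>\<^sup>+\<omega>. (if \<tau> \<omega> \<le> min (ereal t) (absorption_time X \<omega>)
       then let u = real_of_ereal (\<tau> \<omega>) in semigroup_op P X (t - u) f (X u \<omega>) else 0) \<partial>P x)"
proof -
  let ?f = "f(None := 0)"
  have "(\<integral>\<^sup>+\<omega>. (if \<tau> \<omega> \<le> ereal t \<and> ereal t < absorption_time X \<omega> then ennreal (f (X t \<omega>)) else 0) \<partial>P x) =
      (\<integral>\<^sup>+\<omega>. (if \<tau> \<omega> \<le> ereal t then ennreal (?f (X t \<omega>)) else 0) \<partial>P x)"
  proof (rule nn_integral_cong_AE)
    show "AE \<omega> in P x. (if \<tau> \<omega> \<le> ereal t \<and> ereal t < absorption_time X \<omega> then ennreal (f (X t \<omega>)) else 0) =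
        (if \<tau> \<omega> \<le> ereal t then ennreal (?f (X t \<omega>)) else 0)"
      using AE_absorption[OF t, of x] by eventually_elim auto
  qed
  also have "\<dots> = (\<integral>\<^sup>+\<omega>. (if \<tau> \<omega> \<le> ereal t
      then \<integral>\<^sup>+y. ennreal (?f y) \<partial>kern (t - real_of_ereal (\<tau> \<omega>)) (X (real_of_ereal (\<tau> \<omega>)) \<omega>) else 0) \<partial>P x)"
    by (rule strong_markov[OF t])
  also have "\<dots> = (\<integral>\<^sup>+\<omega>. (if \<tau> \<omega> \<le> min (ereal t) (absorption_time X \<omega>)
       then let u = real_of_ereal (\<tau> \<omega>) in semigroup_op P X (t - u) f (X u \<omega>) else 0) \<partial>P x)"
  proof (rule nn_integral_cong_AE)
    show "AE \<omega> in P x. (if \<tau> \<omega> \<le> ereal t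
        then \<integral>\<^sup>+y. ennreal (?f y) \<partial>kern (t - real_of_ereal (\<tau> \<omega>)) (X (real_of_ereal (\<tau> \<omega>)) \<omega>) else 0) =
      (if \<tau> \<omega> \<le> min (ereal t) (absorption_time X \<omega>)
       then let u = real_of_ereal (\<tau> \<omega>) in semigroup_op P X (t - u) f (X u \<omega>) else 0)"
      using hit_before_absorption[where x = x and L = D0] AE_space
    proof eventually_elim
      case (elim \<omega>)
      then have w: "\<omega> \<in> space M" by simp
      have iff: "\<tau> \<omega> \<le> min (ereal t) (absorption_time X \<omega>) \<longleftrightarrow> \<tau> \<omega> \<le> ereal t" using elim(1) t by blast
      show ?case
      proof (cases "\<tau> \<omega> \<le> ereal t")
        case True
        then obtain u where u: "\<tau> \<omega> = ereal u" "u \<le> t" using tau_cases[OF w t] by metis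
        have "semigroup_op P X (t - u) f (X u \<omega>) = (\<integral>\<^sup>+y. ennreal (?f y) \<partial>kern (t - u) (X u \<omega>))"
          using u by (subst semigroup_op_cut, simp, subst semigroup_op_eq) auto
        then show ?thesis unfolding iff using True u(1) by (simp add: Let_def)
      qed (simp add: iff)
    qed
  qed
  finally show ?thesis .
qed

lemma decay_rate_D0: assumes "x \<in> D0" shows "decay_rate x = lam0"
  unfolding lam0 using assms D0 by (intro antisym decay_rate_le positive) auto

text \<open>
  \<open>- ln \<gamma>\<close> exceeds the decay parameter, so the return probability alone outweighs \<open>\<gamma>\<^sup>t\<close>.
\<close>

lemma entrance_probability_growth:
  assumes x: "x \<in> D0" and g: "0 < \<gamma>" "\<gamma> < exp (- lam0)"
  shows "filterlim (\<lambda>t. \<gamma> powr (- t) * \<P>(\<omega> in P (Some x). X t \<omega> \<in> Some ` D0)) at_top at_top"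
proof -
  define b where "b = - ln \<gamma>"
  have b: "lam0 < b"
  proof -
    have "ln \<gamma> < ln (exp (- lam0))" using g by (subst ln_less_cancel_iff) auto
    then show ?thesis by (simp add: b_def)
  qed
  define h where "h = (lam0 + b) / 2"
  have h: "lam0 < h" "h < b" using b by (auto simp: h_def)
  obtain c where c: "0 < c" "\<And>t. 0 \<le> t \<Longrightarrow> c * exp (- h * t) \<le> pmf (kern t (Some x)) (Some x)"
    using decay_rate_lower[OF positive[OF x x]] h decay_rate_D0[OF x] by metis
  have lim: "filterlim (\<lambda>t. c * exp ((b - h) * t)) at_top at_top"
  proof (rule filterlim_tendsto_pos_mult_at_top[OF tendsto_const c(1)])
    show "filterlim (\<lambda>t. exp ((b - h) * t)) at_top at_top"
      by (rule filterlim_compose[OF exp_at_top],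
          rule filterlim_tendsto_pos_mult_at_top[OF tendsto_const _ filterlim_ident]) (use h in simp)
  qed
  show ?thesis
  proof (rule filterlim_at_top_mono[OF lim], rule eventually_mono[OF eventually_ge_at_top[of 0]])
    fix t :: real assume t: "0 \<le> t"
    have "\<gamma> powr (- t) = exp (b * t)" using g by (simp add: powr_def b_def)
    moreover have "c * exp (- h * t) \<le> \<P>(\<omega> in P (Some x). X t \<omega> \<in> Some ` D0)"
    proof -
      have "pmf (kern t (Some x)) (Some x) \<le> measure (kern t (Some x)) (Some ` D0)"
        using x by (simp add: measure_pmf_single[symmetric] measure_pmf.finite_measure_mono)
      then show ?thesis using c(2)[OF t] by (simp add: measure_kern[OF t])
    qed
    ultimately have "exp (b * t) * (c * exp (- h * t)) \<le> \<gamma> powr (- t) * \<P>(\<omega> in P (Some x). X t \<omega> \<in> Some ` D0)"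
      using c(1) by (intro mult_mono) auto
    then show "c * exp ((b - h) * t) \<le> \<gamma> powr (- t) * \<P>(\<omega> in P (Some x). X t \<omega> \<in> Some ` D0)"
      by (simp add: algebra_simps exp_diff exp_minus field_simps)
  qed
qed

lemma semi_iE_antimono:
  assumes "0 \<le> s" "0 \<le> t" shows "semi (s + t) iE x \<le> semi s iE x"
proof -
  have "semi (s + t) iE x = semi s (semi t iE) x" using assms by (intro semi_semi dominated_indicator)
  also have "\<dots> \<le> semi s iE x"
  proof (rule semi_mono)
    show "semi t iE y \<le> iE y" for y
    proof (cases y)
      case None
      then show ?thesis using semi_None[OF assms(2), of iE] by simp
    qed (simp add: semi_indicator_set measure_pmf.prob_le_1)
  qed (use assms in \<open>auto intro: dominated_semi dominated_indicator\<close>)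
  finally show ?thesis .
qed

text \<open>
  Any point of \<open>D0\<close> reaches any other in one unit of time, and surviving longer is less likely.
\<close>

lemma survival_ratio:
  obtains c where "0 < c" "(SUP t\<in>{0..}. (SUP y\<in>D0. ennreal (survival P X t (Some y))) /
    (INF y\<in>D0. ennreal (survival P X t (Some y)))) \<le> ennreal c"
proof -
  obtain p where p: "0 < p" "p \<le> 1" "\<And>x y. x \<in> D0 \<Longrightarrow> y \<in> D0 \<Longrightarrow> p \<le> pmf (kern 1 (Some x)) (Some y)"
    using D0_pos_lower by blast
  have comp: "survival P X t (Some x) \<le> 1 / p * survival P X t (Some y)"
    if x: "x \<in> D0" and y: "y \<in> D0" and t: "0 \<le> t" for x y t
  proof -
    have "p * semi t iE (Some x) \<le> pmf (kern 1 (Some y)) (Some x) * semi t iE (Some x)"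
      using p x y by (intro mult_right_mono semi_nonneg) auto
    also have "\<dots> \<le> semi 1 (semi t iE) (Some y)"
      using t by (intro semi_ge_point dominated_semi dominated_indicator semi_nonneg) auto
    also have "\<dots> = semi (t + 1) iE (Some y)"
      using t by (subst semi_semi[symmetric]) (auto simp: dominated_indicator add.commute)
    also have "\<dots> \<le> semi t iE (Some y)" using t by (intro semi_iE_antimono) auto
    finally show ?thesis using p t by (simp add: survival_semi field_simps)
  qed
  have "(SUP y\<in>D0. ennreal (survival P X t (Some y))) / (INF y\<in>D0. ennreal (survival P X t (Some y))) \<le> ennreal (1 / p)"
    if t: "0 \<le> t" for t
  proof -
    define I where "I = (INF y\<in>D0. ennreal (survival P X t (Some y)))"
    have s0: "0 \<le> survival P X t x" for x unfolding survival_def by simp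
    have "0 < pmf (kern t (Some x0)) (Some x0)"
      using kern_self_lower[OF t, of "Some x0"] t by (metis order.refl less_le_trans)
    also have "\<dots> \<le> survival P X t (Some x0)"
      using t by (simp add: survival_eq measure_pmf_single[symmetric] measure_pmf.finite_measure_mono)
    finally have pos: "0 < survival P X t (Some x0)" .
    have "ennreal (p * survival P X t (Some x0)) \<le> I"
      unfolding I_def
    proof (rule INF_greatest)
      fix y assume "y \<in> D0"
      then show "ennreal (p * survival P X t (Some x0)) \<le> ennreal (survival P X t (Some y))"
        using comp[OF D0(2) _ t, of y] p(1) by (intro ennreal_leI) (simp add: field_simps)
    qed
    moreover have "0 < ennreal (p * survival P X t (Some x0))" using p pos by simp
    ultimately have I0: "I \<noteq> 0" using less_le_trans by force
    have "I \<le> ennreal (survival P X t (Some x0))" unfolding I_def by (intro INF_lower D0)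
    then have Itop: "I \<noteq> top" using ennreal_less_top[of "survival P X t (Some x0)"] by (auto simp: top_unique)
    have "(SUP y\<in>D0. ennreal (survival P X t (Some y))) \<le> ennreal (1 / p) * I"
    proof (rule SUP_least)
      fix x assume x: "x \<in> D0"
      have "ennreal p * ennreal (survival P X t (Some x)) \<le> I"
        unfolding I_def
      proof (rule INF_greatest)
        fix y assume "y \<in> D0"
        then have "p * survival P X t (Some x) \<le> survival P X t (Some y)"
          using comp[OF x _ t, of y] p(1) by (simp add: field_simps)
        then show "ennreal p * ennreal (survival P X t (Some x)) \<le> ennreal (survival P X t (Some y))"
          using p(1) s0 by (simp add: ennreal_leI flip: ennreal_mult)
      qed
      then have "ennreal (1 / p) * (ennreal p * ennreal (survival P X t (Some x))) \<le> ennreal (1 / p) * I"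
        by (intro mult_left_mono) auto
      also have "ennreal (1 / p) * (ennreal p * ennreal (survival P X t (Some x))) = ennreal (survival P X t (Some x))"
        using p(1) s0 by (simp flip: ennreal_mult)
      finally show "ennreal (survival P X t (Some x)) \<le> ennreal (1 / p) * I" .
    qed
    then have "(SUP y\<in>D0. ennreal (survival P X t (Some y))) / I \<le> ennreal (1 / p) * I / I"
      by (rule divide_right_mono_ennreal)
    also have "\<dots> = ennreal (1 / p)" using I0 Itop by (rule ennreal_mult_divide_eq)
    finally show ?thesis unfolding I_def .
  qed
  then show thesis using that[of "1 / p"] p(1) by (simp add: SUP_le_iff)
qed

text \<open>
  Both times of Assumption (F) are taken to be \<open>1\<close>, and \<open>\<nu>\<close> is the point mass at \<open>x0\<close>.
\<close>

theorem assumption_F_holds: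
  assumes g: "exp (- lam1) < \<gamma>" "\<gamma> < exp (- lam0)"
  shows "assumption_F P X D0 (exp (- lam1)) \<gamma> (\<lambda>x. \<phi> (Some x))"
proof -
  obtain p where p: "0 < p" "p \<le> 1" "\<And>x y. x \<in> D0 \<Longrightarrow> y \<in> D0 \<Longrightarrow> p \<le> pmf (kern 1 (Some x)) (Some y)"
    using D0_pos_lower by blast
  obtain m where m: "0 \<le> m" "\<And>x. x \<in> D0 \<Longrightarrow> \<phi> (Some x) \<le> m" using phi_D0_bound by blast
  obtain c3 where c3: "0 < c3" "(SUP t\<in>{0..}. (SUP y\<in>D0. ennreal (survival P X t (Some y))) /
    (INF y\<in>D0. ennreal (survival P X t (Some y)))) \<le> ennreal c3" using survival_ratio by blast
  have g0: "0 < \<gamma>" using less_trans[OF exp_gt_zero g(1)] .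
  have F0: "AE \<omega> in P (Some x). \<tau> \<omega> < \<infinity> \<longrightarrow> X (real_of_ereal (\<tau> \<omega>)) \<omega> \<in> Some ` D0" for x
  proof (rule AE_I2, rule impI)
    fix \<omega> assume w: "\<omega> \<in> space (P (Some x))" and fin: "\<tau> \<omega> < \<infinity>"
    from w have w': "\<omega> \<in> space M" by simp
    show "X (real_of_ereal (\<tau> \<omega>)) \<omega> \<in> Some ` D0"
      by (rule hitting_time_attained[OF w' fin]) simp
  qed
  have F1: "p * measure_pmf.prob (return_pmf x0) (A \<inter> D0) \<le> \<P>(\<omega> in P (Some x). X 1 \<omega> \<in> Some ` A)"
    if x: "x \<in> D0" for x A
  proof (cases "x0 \<in> A")
    case True
    have "p \<le> measure (kern 1 (Some x)) {Some x0}" using p(3)[OF x D0(2)] by (simp add: measure_pmf_single)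
    also have "\<dots> \<le> measure (kern 1 (Some x)) (Some ` A)"
      using True by (intro measure_pmf.finite_measure_mono) auto
    finally show ?thesis using True D0 by (simp add: measure_kern indicator_def)
  qed (simp add: indicator_def)
  have F2: "(\<integral>\<^sup>+\<omega>. (if ereal 1 < min (\<tau> \<omega>) (absorption_time X \<omega>) then ennreal (\<phi> (X 1 \<omega>)) else 0) \<partial>P (Some x))
      \<le> ennreal (exp (- lam1) powr 1 * \<phi> (Some x))" for x
  proof -
    have "(\<integral>\<^sup>+\<omega>. (if ereal 1 < min (\<tau> \<omega>) (absorption_time X \<omega>) then ennreal (\<phi> (X 1 \<omega>)) else 0) \<partial>P (Some x))
        \<le> (\<integral>\<^sup>+\<omega>. (if ereal 1 < \<tau> \<omega> then ennreal (\<phi> (X 1 \<omega>)) else 0) \<partial>P (Some x))"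
      by (intro nn_integral_mono) auto
    also have "\<dots> \<le> ennreal (exp (- lam1 * 1) * \<phi> (Some x))" by (rule killed_bound) simp
    finally show ?thesis by simp
  qed
  have F2': "semigroup_op P X t \<phi> (Some x) \<le> ennreal (exp C * m + 1)" if "x \<in> D0" "t \<in> {0..1}" for x t
  proof -
    have "semigroup_op P X t \<phi> (Some x) \<le> ennreal (exp (C * t) * \<phi> (Some x))"
      using that phi_growth[of t "Some x"] by (simp add: semigroup_op_eq phi_None)
    also have "\<dots> \<le> ennreal (exp C * m + 1)"
    proof (rule ennreal_leI)
      have "exp (C * t) * \<phi> (Some x) \<le> exp C * m"
        using that C m by (intro mult_mono phi_nonneg) (auto simp: mult_left_le)
      then show "exp (C * t) * \<phi> (Some x) \<le> exp C * m + 1" by simp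
    qed
    finally show ?thesis .
  qed
  show ?thesis
    unfolding assumption_F_def Let_def phi_case
  proof (rule conjI, simp, rule conjI, rule g0, rule conjI, simp add: phi_ge_1,
      rule exI[of _ p], rule exI[of _ "exp C * m + 1"], rule exI[of _ c3], rule exI[of _ 1], rule exI[of _ 1],
      rule exI[of _ "return_pmf x0"], intro conjI)
    show "\<forall>x t f. 0 \<le> t \<and> (\<forall>y. 0 \<le> f y) \<longrightarrow>
      (\<integral>\<^sup>+\<omega>. (if \<tau> \<omega> \<le> ereal t \<and> ereal t < absorption_time X \<omega> then ennreal (f (X t \<omega>)) else 0) \<partial>P (Some x)) =
      (\<integral>\<^sup>+\<omega>. (if \<tau> \<omega> \<le> min (ereal t) (absorption_time X \<omega>)
         then semigroup_op P X (t - real_of_ereal (\<tau> \<omega>)) f (X (real_of_ereal (\<tau> \<omega>)) \<omega>) else 0) \<partial>P (Some x))"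
      using strong_markov_clause unfolding Let_def by blast
    show "0 < exp C * m + 1" using m by (simp add: add_nonneg_pos)
    show "\<forall>x\<in>D0. filterlim (\<lambda>t. \<gamma> powr (- t) * \<P>(\<omega> in P (Some x). X t \<omega> \<in> Some ` D0)) at_top at_top"
      using entrance_probability_growth g0 g by blast
  qed (use p c3 g g0 F0 F1 F2 F2' phi_ge_1 D0 in auto)
qed

end

section \<open>The quasi-stationary distribution and the generator\<close>

context lyapunov_jump_process
begin

lemma semi_finite_support:
  assumes "finite G"
  shows "semi t (\<lambda>z. f z * indicator (Some ` G) z) x = (\<Sum>y\<in>G. f (Some y) * pmf (kern t x) (Some y))"
proof -
  have "semi t (\<lambda>z. f z * indicator (Some ` G) z) x =
      (\<Sum>z\<in>Some ` G. f z * indicator (Some ` G) z * pmf (kern t x) z)"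
    unfolding semi_def using assms by (intro integral_measure_pmf_real) (auto simp: indicator_def split: if_splits)
  also have "\<dots> = (\<Sum>y\<in>G. f (Some y) * pmf (kern t x) (Some y))"
    by (subst sum.reindex) auto
  finally show ?thesis .
qed

lemma dominated_restrict: "dominated f \<Longrightarrow> dominated (\<lambda>z. f z * indicator A z)"
proof (erule dominatedE)
  fix D assume D: "0 \<le> D" "\<And>x. \<bar>f x\<bar> \<le> D * \<phi> x"
  show "dominated (\<lambda>z. f z * indicator A z)"
  proof (rule dominatedI)
    fix z show "\<bar>f z * indicator A z\<bar> \<le> D * \<phi> z"
      using D(1) D(2)[of z] phi_nonneg[of z] by (auto simp: indicator_def)
  qed
qed

text \<open>
  Let \<open>S\<close> be the sum of \<open>q(x,y) h(y)\<close>.  The off-diagonal part of \<open>P\<^sub>t h(x) / t\<close> has a limit \<open>L\<close>, by the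
  eigenvalue equation.  Taking finitely many terms gives \<open>S \<le> L\<close>.  The same argument for \<open>D \<phi> - h\<close>,
  where \<open>h \<le> D \<phi>\<close>, gives \<open>L \<le> S\<close>, because the off-diagonal part of \<open>P\<^sub>t \<phi>(x) / t\<close> does not exceed
  the sum of \<open>q(x,y) \<phi>(y)\<close> in the limit.
\<close>

theorem eigenfunction_generator:
  assumes h: "\<And>x. 0 \<le> h x" "dominated h" "\<And>t x. 0 \<le> t \<Longrightarrow> scaled t h x = h x"
  shows "(\<lambda>y. q x (Some y) * h (Some y)) summable_on (UNIV - {x})" (is ?summable)
    and "generator q h (Some x) = - lam0 * h (Some x)"
proof -
  obtain D where D: "0 \<le> D" "\<And>x. \<bar>h x\<bar> \<le> D * \<phi> x" using h(2) dominatedE by blast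
  have hD: "h z \<le> D * \<phi> z" for z using D(2)[of z] by simp
  have qn: "0 \<le> q x (Some z)" if "z \<in> UNIV - {x}" for z using that by (intro rates_nonneg) auto
  have summD: "(\<lambda>y. D * (q x (Some y) * \<phi> (Some y))) summable_on (UNIV - {x})"
    by (intro summable_on_cmult_right phi_summable)
  have le: "q x (Some y) * h (Some y) \<le> D * (q x (Some y) * \<phi> (Some y))" if "y \<in> UNIV - {x}" for y
    using mult_left_mono[OF hD[of "Some y"] qn[OF that]] by (simp add: mult_ac)
  show summ: ?summable
    by (rule summable_on_comparison_test[OF summD le]) (use qn h(1) in auto)
  let ?p = "\<lambda>t y. pmf (kern t (Some x)) (Some y)"
  define off where "off f t = semi t (\<lambda>z. f z * indicator (- {Some x}) z) (Some x) / t" for f t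
  define S where "S = (\<Sum>\<^sub>\<infinity>y\<in>UNIV - {x}. q x (Some y) * h (Some y))"
  define S\<phi> where "S\<phi> = (\<Sum>\<^sub>\<infinity>y\<in>UNIV - {x}. q x (Some y) * \<phi> (Some y))"
  define L where "L = - lam0 * h (Some x) + exit_rate x * h (Some x)"
  have pos: "\<forall>\<^sub>F t in at_right (0::real). 0 < t" by (rule eventually_at_right_less)
  have off_h: "off h t = (exp (- lam0 * t) - 1) / t * h (Some x) + (1 - ?p t x) / t * h (Some x)" if t: "0 < t" for t
  proof -
    have "exp (- lam0 * t) * h (Some x) = exp (- lam0 * t) * scaled t h (Some x)" using h(3) t by simp
    also have "\<dots> = semi t h (Some x)" by (simp add: scaled_def exp_minus)
    also have "\<dots> = semi t (\<lambda>z. h z * indicator (- {Some x}) z + h z * indicator (Some ` {x}) z) (Some x)"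
      by (rule arg_cong[of _ _ "\<lambda>f. semi t f (Some x)"]) (auto simp: fun_eq_iff indicator_def)
    also have "\<dots> = semi t (\<lambda>z. h z * indicator (- {Some x}) z) (Some x) + h (Some x) * ?p t x"
      using t by (subst semi_add) (auto intro: dominated_restrict h(2) simp: semi_finite_support simp del: image_insert)
    finally have "semi t (\<lambda>z. h z * indicator (- {Some x}) z) (Some x) =
        (exp (- lam0 * t) - 1) * h (Some x) + (1 - ?p t x) * h (Some x)" by (simp add: algebra_simps)
    then show ?thesis unfolding off_def by (simp add: add_divide_distrib)
  qed
  have exp_lim: "((\<lambda>t. (exp (- lam0 * t) - 1) / t) \<longlongrightarrow> - lam0) (at_right 0)"
  proof -
    have "((\<lambda>t. exp (- lam0 * t)) has_real_derivative - lam0) (at 0)"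
      by (auto intro!: derivative_eq_intros)
    then have "((\<lambda>t. (exp (- lam0 * t) - 1) / t) \<longlongrightarrow> - lam0) (at 0)"
      by (simp add: has_field_derivative_iff)
    then show ?thesis by (rule filterlim_mono) (auto simp: at_le)
  qed
  have off_lim: "(off h \<longlongrightarrow> L) (at_right 0)"
  proof -
    have "((\<lambda>t. (exp (- lam0 * t) - 1) / t * h (Some x) + (1 - ?p t x) / t * h (Some x)) \<longlongrightarrow> L) (at_right 0)"
      unfolding L_def by (intro tendsto_intros exp_lim rate_tendsto)
    then show ?thesis
      by (rule Lim_transform_eventually) (use pos in eventually_elim, simp only: off_h)
  qed
  have off_lower: "(\<Sum>z\<in>F. g (Some z) * (?p t z / t)) \<le> off g t"
    if t: "0 < t" and F: "finite F" "F \<subseteq> UNIV - {x}" and g: "dominated g" "\<And>z. 0 \<le> g z" for F g t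
  proof -
    have "(\<Sum>z\<in>F. g (Some z) * ?p t z) = semi t (\<lambda>z. g z * indicator (Some ` F) z) (Some x)"
      by (rule semi_finite_support[OF F(1), symmetric])
    also have "\<dots> \<le> semi t (\<lambda>z. g z * indicator (- {Some x}) z) (Some x)"
      using t F g by (intro semi_mono dominated_restrict) (auto simp: indicator_def)
    finally have "(\<Sum>z\<in>F. g (Some z) * ?p t z) / t \<le> off g t"
      unfolding off_def using t by (intro divide_right_mono) auto
    then show ?thesis by (simp add: sum_divide_distrib)
  qed
  have sum_lim: "((\<lambda>t. \<Sum>z\<in>F. g (Some z) * (?p t z / t)) \<longlongrightarrow> (\<Sum>z\<in>F. g (Some z) * q x (Some z))) (at_right 0)"
    if "F \<subseteq> UNIV - {x}" for F g
    using that by (intro tendsto_intros rate_tendsto) auto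
  have "S \<le> L"
    unfolding S_def
  proof (rule infsum_le_finite_sums[OF summ])
    fix F assume F: "finite F" "F \<subseteq> UNIV - {x}"
    have "(\<Sum>z\<in>F. h (Some z) * q x (Some z)) \<le> L"
    proof (rule tendsto_le[OF _ off_lim sum_lim[OF F(2)]])
      show "\<forall>\<^sub>F t in at_right 0. (\<Sum>z\<in>F. h (Some z) * (?p t z / t)) \<le> off h t"
        using pos by eventually_elim (intro off_lower F h)
    qed simp
    then show "(\<Sum>y\<in>F. q x (Some y) * h (Some y)) \<le> L" by (simp add: mult.commute)
  qed
  moreover have "D * S\<phi> - S \<le> D * S\<phi> - L"
  proof -
    define g where "g z = D * \<phi> z - h z" for z
    have g: "dominated g" "\<And>z. 0 \<le> g z"
      unfolding g_def by (rule dominated_diff[OF dominated_cmult[OF dominated_phi] h(2)]) (simp add: hD)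
    have off_g: "off g t \<le> D * (exp (C * t) * S\<phi>) - off h t" if t: "0 < t" for t
    proof -
      have "ennreal (semi t (\<lambda>z. \<phi> z * indicator (- {Some x}) z) (Some x)) =
          (\<integral>\<^sup>+z. ennreal (\<phi> z * indicator (- {Some x}) z) \<partial>kern t (Some x))"
        using t phi_nonneg by (intro ennreal_semi[symmetric] dominated_restrict dominated_phi) auto
      also have "\<dots> = (\<integral>\<^sup>+z. ennreal (\<phi> z) * indicator (- {Some x}) z \<partial>kern t (Some x))"
        by (intro nn_integral_cong) (auto simp: indicator_def)
      also have "\<dots> \<le> ennreal (t * exp (C * t) * S\<phi>)"
        unfolding S\<phi>_def using C t
        by (intro offdiagonal_bound phi_None phi_ge_1 phi_summable phi_generator_le) auto
      finally have "semi t (\<lambda>z. \<phi> z * indicator (- {Some x}) z) (Some x) \<le> t * exp (C * t) * S\<phi>"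
        using t phi_nonneg qn unfolding S\<phi>_def
        by (subst (asm) ennreal_le_iff) (auto intro!: mult_nonneg_nonneg infsum_nonneg)
      then have off_phi: "off \<phi> t \<le> exp (C * t) * S\<phi>" unfolding off_def using t by (simp add: field_simps)
      have "semi t (\<lambda>z. g z * indicator (- {Some x}) z) (Some x) =
          semi t (\<lambda>z. D * (\<phi> z * indicator (- {Some x}) z) - h z * indicator (- {Some x}) z) (Some x)"
        by (rule arg_cong[of _ _ "\<lambda>f. semi t f (Some x)"]) (auto simp: fun_eq_iff indicator_def g_def)
      also have "\<dots> = D * semi t (\<lambda>z. \<phi> z * indicator (- {Some x}) z) (Some x) -
          semi t (\<lambda>z. h z * indicator (- {Some x}) z) (Some x)"
        using t
        by (subst semi_diff[OF _ dominated_cmult[OF dominated_restrict[OF dominated_phi]] dominated_restrict[OF h(2)]])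
           (simp_all add: semi_cmult)
      finally have "off g t = D * off \<phi> t - off h t" unfolding off_def by (simp add: diff_divide_distrib)
      then show ?thesis using mult_left_mono[OF off_phi D(1)] by simp
    qed
    have lim_upper: "((\<lambda>t. D * (exp (C * t) * S\<phi>) - off h t) \<longlongrightarrow> D * (exp (C * 0) * S\<phi>) - L) (at_right 0)"
      by (intro tendsto_intros off_lim)
    have summ_g: "(\<lambda>y. q x (Some y) * g (Some y)) summable_on (UNIV - {x})"
    proof (rule summable_on_comparison_test[OF summD])
      fix y assume y: "y \<in> UNIV - {x}"
      show "q x (Some y) * g (Some y) \<le> D * (q x (Some y) * \<phi> (Some y))"
        using mult_nonneg_nonneg[OF qn[OF y] h(1)[of "Some y"]] by (simp add: g_def algebra_simps)
      show "0 \<le> q x (Some y) * g (Some y)" by (intro mult_nonneg_nonneg qn y g(2))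
    qed
    have "(\<Sum>\<^sub>\<infinity>y\<in>UNIV - {x}. q x (Some y) * g (Some y)) \<le> D * S\<phi> - L"
    proof (rule infsum_le_finite_sums[OF summ_g])
      fix F assume F: "finite F" "F \<subseteq> UNIV - {x}"
      have "(\<Sum>z\<in>F. g (Some z) * q x (Some z)) \<le> D * (exp (C * 0) * S\<phi>) - L"
      proof (rule tendsto_le[OF _ lim_upper sum_lim[OF F(2)]])
        show "\<forall>\<^sub>F t in at_right 0. (\<Sum>z\<in>F. g (Some z) * (?p t z / t)) \<le> D * (exp (C * t) * S\<phi>) - off h t"
          using pos
        proof eventually_elim
          case (elim t)
          show ?case using off_lower[OF elim F g] off_g[OF elim] by linarith
        qed
      qed simp
      then show "(\<Sum>y\<in>F. q x (Some y) * g (Some y)) \<le> D * S\<phi> - L" by (simp add: mult.commute)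
    qed
    moreover have "(\<Sum>\<^sub>\<infinity>y\<in>UNIV - {x}. q x (Some y) * g (Some y)) + S = D * S\<phi>"
    proof -
      have "(\<Sum>\<^sub>\<infinity>y\<in>UNIV - {x}. q x (Some y) * g (Some y)) + S =
          (\<Sum>\<^sub>\<infinity>y\<in>UNIV - {x}. q x (Some y) * g (Some y) + q x (Some y) * h (Some y))"
        unfolding S_def by (rule infsum_add[OF summ_g summ, symmetric])
      also have "\<dots> = (\<Sum>\<^sub>\<infinity>y\<in>UNIV - {x}. D * (q x (Some y) * \<phi> (Some y)))"
        by (intro infsum_cong) (simp add: g_def algebra_simps)
      also have "\<dots> = D * S\<phi>" unfolding S\<phi>_def by (rule infsum_cmult_right) (use phi_summable in blast)
      finally show ?thesis .
    qed
    ultimately show ?thesis by simp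
  qed
  ultimately have "S = L" by simp
  then show "generator q h (Some x) = - lam0 * h (Some x)"
    using generator_eq[of h x] summ dominated_None[OF h(2)] by (simp add: S_def L_def)
qed

definition mean :: "'a pmf \<Rightarrow> ('a option \<Rightarrow> real) \<Rightarrow> real" where
  "mean \<mu> f = measure_pmf.expectation \<mu> (\<lambda>x. f (Some x))"

lemma initial_survival:
  assumes t: "0 \<le> t"
  shows "\<P>(\<omega> in initial_law P \<mu>. ereal t < absorption_time X \<omega>) = mean \<mu> (semi t iE)"
proof -
  have "\<P>(\<omega> in initial_law P \<mu>. ereal t < absorption_time X \<omega>) =
      measure_pmf.expectation \<mu> (\<lambda>x. measure (P (Some x)) {\<omega>\<in>space M. ereal t < absorption_time X \<omega>})"
    using initial_law_measure[OF survival_event[OF t], of \<mu>] by simp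
  also have "\<dots> = mean \<mu> (semi t iE)"
    unfolding mean_def using t by (simp add: survival_semi[symmetric] survival_def)
  finally show ?thesis .
qed

lemma initial_state:
  assumes t: "0 \<le> t"
  shows "\<P>(\<omega> in initial_law P \<mu>. X t \<omega> \<in> Some ` A \<and> ereal t < absorption_time X \<omega>) =
    mean \<mu> (semi t (indicator (Some ` A)))"
proof -
  let ?E = "{\<omega>\<in>space M. X t \<omega> \<in> Some ` A \<and> ereal t < absorption_time X \<omega>}"
  have "?E = {\<omega>\<in>space M. X t \<omega> \<in> Some ` A} \<inter> {\<omega>\<in>space M. ereal t < absorption_time X \<omega>}" by auto
  also have "\<dots> \<in> sets M" by (intro sets.Int state_event survival_event t)
  finally have E: "?E \<in> sets M" .
  have "measure (P (Some x)) ?E = semi t (indicator (Some ` A)) (Some x)" for x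
  proof -
    interpret prob_space "P (Some x)" by (rule laws)
    have "measure (P (Some x)) ?E = \<P>(\<omega> in P (Some x). X t \<omega> \<in> Some ` A \<and> ereal t < absorption_time X \<omega>)"
      by simp
    also have "\<dots> = \<P>(\<omega> in P (Some x). X t \<omega> \<in> Some ` A)"
    proof (rule prob_eq_AE)
      show "AE \<omega> in P (Some x). (X t \<omega> \<in> Some ` A \<and> ereal t < absorption_time X \<omega>) = (X t \<omega> \<in> Some ` A)"
        using AE_absorption[OF t, of "Some x"] by eventually_elim auto
    qed (use E state_event[OF t, of "Some ` A"] in \<open>simp_all add: laws(2)\<close>)
    also have "\<dots> = semi t (indicator (Some ` A)) (Some x)"
      using t by (simp add: semi_indicator_set measure_kern)
    finally show ?thesis .
  qed
  then show ?thesis using initial_law_measure[OF E, of \<mu>] by (simp add: mean_def)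
qed

lemma quasi_stationary_iff:
  "quasi_stationary P X \<mu> \<longleftrightarrow>
    (\<forall>t\<ge>0. \<forall>A. mean \<mu> (semi t (indicator (Some ` A))) / mean \<mu> (semi t iE) = measure_pmf.prob \<mu> A)"
  unfolding quasi_stationary_def cond_prob_def by (simp add: initial_survival initial_state)

end

text \<open>
  A choice of the data provided by \<open>exponential_convergence\<close>.  The functional \<open>c\<close> is only known to be
  meaningful on functions bounded by \<open>\<phi>\<close>.
\<close>

locale spectral_jump_process = lyapunov_jump_process q M P X D0 x0 C lam0 lam1 \<phi>
  for q :: "'a::countable \<Rightarrow> 'a option \<Rightarrow> real" and M :: "'w measure"
    and P :: "'a option \<Rightarrow> 'w measure" and X :: "real \<Rightarrow> 'w \<Rightarrow> 'a option"
    and D0 :: "'a set" and x0 :: 'a and C lam0 lam1 :: real and \<phi> :: "'a option \<Rightarrow> real" +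
  fixes \<eta> :: "'a option \<Rightarrow> real" and B :: real and \<epsilon> :: "real \<Rightarrow> real"
    and c :: "('a option \<Rightarrow> real) \<Rightarrow> real"
  assumes eta_nonneg: "\<And>x. 0 \<le> \<eta> x" and B_pos: "0 < B" and eta_le: "\<And>x. \<eta> x \<le> B * \<phi> x"
    and eta_pos: "0 < \<eta> (Some x0)"
    and eta_invariant: "\<And>t x. 0 \<le> t \<Longrightarrow> scaled t \<eta> x = \<eta> x"
    and eps_tendsto: "(\<epsilon> \<longlongrightarrow> 0) at_top"
    and scaled_converges: "\<And>f t x. (\<And>y. \<bar>f y\<bar> \<le> \<phi> y) \<Longrightarrow> 0 \<le> t \<Longrightarrow>
      \<bar>scaled t f x - c f * \<eta> x\<bar> \<le> \<epsilon> t * \<phi> x"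
begin

lemma eta_dominated: "dominated \<eta>"
  using eta_nonneg eta_le by (intro dominatedI[of _ B]) simp

lemma bounded_dominated: "(\<And>y. \<bar>f y\<bar> \<le> \<phi> y) \<Longrightarrow> dominated f"
  by (rule dominatedI[of _ 1]) simp

lemma scaled_tendsto:
  assumes "\<And>y. \<bar>f y\<bar> \<le> \<phi> y"
  shows "((\<lambda>t. scaled t f x) \<longlongrightarrow> c f * \<eta> x) at_top"
proof -
  have "((\<lambda>t. \<epsilon> t * \<phi> x) \<longlongrightarrow> 0 * \<phi> x) at_top" by (intro tendsto_intros eps_tendsto)
  then have "((\<lambda>t. \<epsilon> t * \<phi> x) \<longlongrightarrow> 0) at_top" by simp
  then have "((\<lambda>t. scaled t f x - c f * \<eta> x) \<longlongrightarrow> 0) at_top"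
  proof (rule Lim_null_comparison[rotated])
    show "\<forall>\<^sub>F t in at_top. norm (scaled t f x - c f * \<eta> x) \<le> \<epsilon> t * \<phi> x"
      using eventually_ge_at_top[of 0]
    proof eventually_elim
      case (elim t)
      then show ?case using scaled_converges[OF assms elim, of x] by simp
    qed
  qed
  then show ?thesis by (rule LIM_zero_cancel)
qed

text \<open>
  Since \<open>\<eta>\<close> is positive at \<open>x0\<close>, the value of \<open>c\<close> is determined by the limit there; order and linearity
  of \<open>c\<close> are read off from those of the semigroup in this way.
\<close>

lemma c_eqI:
  assumes "\<And>y. \<bar>f y\<bar> \<le> \<phi> y" "((\<lambda>t. scaled t f (Some x0)) \<longlongrightarrow> l * \<eta> (Some x0)) at_top"
  shows "c f = l"
  using tendsto_unique[OF trivial_limit_at_top_linorder scaled_tendsto[OF assms(1)] assms(2)] eta_pos by simp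

lemma c_leI:
  assumes f: "\<And>y. \<bar>f y\<bar> \<le> \<phi> y" and g: "\<And>y. \<bar>g y\<bar> \<le> \<phi> y" and le: "\<And>y. f y \<le> g y"
  shows "c f \<le> c g"
proof -
  have "c f * \<eta> (Some x0) \<le> c g * \<eta> (Some x0)"
  proof (rule tendsto_le[OF _ scaled_tendsto[OF g] scaled_tendsto[OF f]])
    show "\<forall>\<^sub>F t in at_top. scaled t f (Some x0) \<le> scaled t g (Some x0)"
      using eventually_ge_at_top[of 0]
      by eventually_elim (intro scaled_mono bounded_dominated f g le)
  qed simp
  then show ?thesis using eta_pos by simp
qed

lemma c_nonneg:
  assumes f: "\<And>y. \<bar>f y\<bar> \<le> \<phi> y" "\<And>y. 0 \<le> f y" shows "0 \<le> c f"
proof -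
  have "0 \<le> c f * \<eta> (Some x0)"
  proof (rule tendsto_lowerbound[OF scaled_tendsto[OF f(1)]])
    show "\<forall>\<^sub>F t in at_top. 0 \<le> scaled t f (Some x0)" by (intro always_eventually allI scaled_nonneg f)
  qed simp
  then show ?thesis using eta_pos by (simp add: zero_le_mult_iff)
qed

lemma indicator_bounded: "\<bar>indicator (Some ` A) y\<bar> \<le> \<phi> y"
  using indicator_le_phi[of A y] by (simp add: indicator_def)

lemma phi_bounded: "\<bar>\<phi> y\<bar> \<le> \<phi> y" using phi_nonneg by simp

text \<open>
  In the limit the drift condition reads \<open>c(\<phi>) \<le> r c(\<phi>) + K c(1\<^sub>D)\<close> with \<open>r < 1\<close>, and \<open>c(\<phi>)\<close> is
  positive since \<open>\<eta> \<le> B \<phi>\<close> and \<open>c(\<eta>) = 1\<close>.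
\<close>

lemma c_iD_pos: "0 < c iD"
proof -
  obtain r K where r: "0 < r" "r < 1" and K: "0 \<le> K"
    and drift: "\<And>x. scaled 1 \<phi> x \<le> r * \<phi> x + K * scaled 1 iD x"
    using scaled_drift by blast
  have shift: "filterlim (\<lambda>t::real. t + 1) at_top at_top"
    using filterlim_tendsto_add_at_top[OF tendsto_const[of 1] filterlim_ident] by (simp add: add.commute)
  have "c \<phi> * \<eta> (Some x0) \<le> r * (c \<phi> * \<eta> (Some x0)) + K * (c iD * \<eta> (Some x0))"
  proof (rule tendsto_le)
    show "((\<lambda>t. scaled (t + 1) \<phi> (Some x0)) \<longlongrightarrow> c \<phi> * \<eta> (Some x0)) at_top"
      by (rule filterlim_compose[OF scaled_tendsto[OF phi_bounded] shift])
    show "((\<lambda>t. r * scaled t \<phi> (Some x0) + K * scaled (t + 1) iD (Some x0)) \<longlongrightarrow>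
        r * (c \<phi> * \<eta> (Some x0)) + K * (c iD * \<eta> (Some x0))) at_top"
      by (intro tendsto_intros scaled_tendsto[OF phi_bounded]
          filterlim_compose[OF scaled_tendsto[OF indicator_bounded] shift])
    show "\<forall>\<^sub>F t in at_top. scaled (t + 1) \<phi> (Some x0) \<le> r * scaled t \<phi> (Some x0) + K * scaled (t + 1) iD (Some x0)"
      using eventually_ge_at_top[of 0]
    proof eventually_elim
      case (elim t)
      have "scaled (t + 1) \<phi> (Some x0) = scaled t (scaled 1 \<phi>) (Some x0)"
        using elim by (intro scaled_scaled[symmetric] dominated_phi) auto
      also have "\<dots> \<le> scaled t (\<lambda>y. r * \<phi> y + K * scaled 1 iD y) (Some x0)"
        using elim drift
        by (intro scaled_mono dominated_scaled dominated_add dominated_cmult dominated_phi dominated_indicator) auto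
      also have "\<dots> = r * scaled t \<phi> (Some x0) + K * scaled t (scaled 1 iD) (Some x0)"
        using elim by (subst scaled_add)
          (auto simp: scaled_cmult intro!: dominated_scaled dominated_cmult dominated_phi dominated_indicator)
      also have "scaled t (scaled 1 iD) (Some x0) = scaled (t + 1) iD (Some x0)"
        using elim by (intro scaled_scaled dominated_indicator) auto
      finally show ?case .
    qed
  qed simp
  then have "c \<phi> * \<eta> (Some x0) \<le> (r * c \<phi> + K * c iD) * \<eta> (Some x0)" by (simp add: algebra_simps)
  then have "c \<phi> \<le> r * c \<phi> + K * c iD" using mult_right_le_imp_le[OF _ eta_pos] by blast
  then have 1: "(1 - r) * c \<phi> \<le> K * c iD" by (simp add: algebra_simps)
  have "\<eta> (Some x0) \<le> B * (c \<phi> * \<eta> (Some x0))"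
  proof (rule tendsto_lowerbound)
    show "((\<lambda>t. B * scaled t \<phi> (Some x0)) \<longlongrightarrow> B * (c \<phi> * \<eta> (Some x0))) at_top"
      by (intro tendsto_intros scaled_tendsto phi_bounded)
    show "\<forall>\<^sub>F t in at_top. \<eta> (Some x0) \<le> B * scaled t \<phi> (Some x0)"
      using eventually_ge_at_top[of 0]
    proof eventually_elim
      case (elim t)
      then show ?case
        using scaled_mono[OF elim eta_dominated dominated_cmult[OF dominated_phi] eta_le, of "Some x0"]
        by (simp add: scaled_cmult eta_invariant)
    qed
  qed simp
  then have "1 \<le> B * c \<phi>" using eta_pos by simp
  then have "0 < c \<phi>" using B_pos by (smt (verit) mult_nonneg_nonpos)
  then have "0 < K * c iD" using 1 r by (smt (verit) mult_pos_pos)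
  then show ?thesis using K by (simp add: zero_less_mult_iff)
qed

lemma c_iE_pos: "0 < c iE"
proof -
  have "c iD \<le> c iE" by (intro c_leI indicator_bounded) (auto simp: indicator_def)
  then show ?thesis using c_iD_pos by simp
qed

definition exhaust :: "nat \<Rightarrow> 'a set" where "exhaust n = {y. to_nat y < n}"

lemma finite_exhaust: "finite (exhaust n)"
  unfolding exhaust_def by (rule finite_subset[of _ "to_nat -` {..<n}"]) (auto intro!: finite_vimageI)

lemma restrict_bounded: "(\<And>y. \<bar>f y\<bar> \<le> \<phi> y) \<Longrightarrow> \<bar>f z * indicator A z\<bar> \<le> \<phi> z"
  using phi_nonneg[of z] by (auto simp: indicator_def)

text \<open>
  Countable additivity of \<open>c\<close>: at a fixed time the expectation of a tail of \<open>\<phi>\<close> is small by dominated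
  convergence, and at a late time it is close to the limit uniformly over all functions bounded by
  \<open>\<phi>\<close>.
\<close>

lemma c_tail: "(\<lambda>n. c (\<lambda>z. \<phi> z * indicator (- Some ` exhaust n) z)) \<longlonglongrightarrow> 0"
proof -
  let ?g = "\<lambda>n z. \<phi> z * indicator (- Some ` exhaust n) z :: real"
  have gb: "\<bar>?g n z\<bar> \<le> \<phi> z" for n z by (rule restrict_bounded) (rule phi_bounded)
  have g0: "0 \<le> ?g n z" for n z using phi_nonneg by simp
  have glim: "(\<lambda>n. ?g n z) \<longlonglongrightarrow> 0" for z
  proof (cases z)
    case (Some y)
    have "\<forall>\<^sub>F n in sequentially. ?g n z = 0"
      using eventually_gt_at_top[of "to_nat y"] by eventually_elim (simp add: Some exhaust_def)
    then show ?thesis by (rule tendsto_eventually)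
  qed (simp add: phi_None)
  have semi_lim: "(\<lambda>n. scaled t (?g n) (Some x0)) \<longlonglongrightarrow> 0" if t: "0 \<le> t" for t
  proof -
    have "(\<lambda>n. semi t (?g n) (Some x0)) \<longlonglongrightarrow> measure_pmf.expectation (kern t (Some x0)) (\<lambda>_. 0)"
      unfolding semi_def
    proof (rule integral_dominated_convergence[where w = \<phi>])
      show "AE z in kern t (Some x0). norm (?g n z) \<le> \<phi> z" for n using gb by simp
    qed (use t glim in \<open>auto intro: phi_integrable_kern\<close>)
    then have "(\<lambda>n. exp (lam0 * t) * semi t (?g n) (Some x0)) \<longlonglongrightarrow> exp (lam0 * t) * 0"
      by (intro tendsto_intros) simp
    then show ?thesis by (simp add: scaled_def)
  qed
  show ?thesis
  proof (rule order_tendstoI)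
    fix a :: real assume "a < 0"
    moreover have "0 \<le> c (?g n)" for n by (intro c_nonneg gb g0)
    ultimately show "\<forall>\<^sub>F n in sequentially. a < c (?g n)" by (intro always_eventually allI) (meson less_le_trans)
  next
    fix a :: real assume a: "0 < a"
    have "((\<lambda>t. \<epsilon> t * \<phi> (Some x0)) \<longlongrightarrow> 0 * \<phi> (Some x0)) at_top" by (intro tendsto_intros eps_tendsto)
    then have "\<forall>\<^sub>F t in at_top. \<epsilon> t * \<phi> (Some x0) < a * \<eta> (Some x0) / 2"
      using a eta_pos by (intro order_tendstoD(2)) auto
    then obtain t where t: "0 \<le> t" "\<epsilon> t * \<phi> (Some x0) < a * \<eta> (Some x0) / 2"
      using eventually_happens[OF eventually_conj[OF eventually_ge_at_top[of 0]]] by force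
    have "\<forall>\<^sub>F n in sequentially. scaled t (?g n) (Some x0) < a * \<eta> (Some x0) / 2"
      using a eta_pos by (intro order_tendstoD(2)[OF semi_lim[OF t(1)]]) auto
    then show "\<forall>\<^sub>F n in sequentially. c (?g n) < a"
    proof eventually_elim
      case (elim n)
      have "c (?g n) * \<eta> (Some x0) \<le> scaled t (?g n) (Some x0) + \<epsilon> t * \<phi> (Some x0)"
        using scaled_converges[where f = "?g n" and x = "Some x0", OF gb t(1)] by (simp add: abs_le_iff)
      also have "\<dots> < a * \<eta> (Some x0)" using elim t(2) by simp
      finally show ?case using eta_pos by simp
    qed
  qed
qed

lemma c_exhaust:
  assumes f: "\<And>y. \<bar>f y\<bar> \<le> \<phi> y"
  shows "(\<lambda>n. c (\<lambda>z. f z * indicator (Some ` exhaust n) z)) \<longlonglongrightarrow> c f"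
proof -
  have "(\<lambda>n. c (\<lambda>z. f z * indicator (Some ` exhaust n) z) - c f) \<longlonglongrightarrow> 0"
  proof (rule Lim_null_comparison[OF always_eventually c_tail], rule allI)
    fix n
    let ?a = "\<lambda>z. f z * indicator (Some ` exhaust n) z"
    let ?g = "\<lambda>z. \<phi> z * indicator (- Some ` exhaust n) z :: real"
    have a: "\<bar>?a y\<bar> \<le> \<phi> y" for y by (rule restrict_bounded) (rule f)
    have g: "\<bar>?g y\<bar> \<le> \<phi> y" for y by (rule restrict_bounded) (rule phi_bounded)
    have "\<bar>c ?a * \<eta> (Some x0) - c f * \<eta> (Some x0)\<bar> \<le> c ?g * \<eta> (Some x0)"
    proof (rule tendsto_le)
      show "((\<lambda>t. \<bar>scaled t ?a (Some x0) - scaled t f (Some x0)\<bar>) \<longlongrightarrow>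
          \<bar>c ?a * \<eta> (Some x0) - c f * \<eta> (Some x0)\<bar>) at_top"
        by (intro tendsto_intros scaled_tendsto a f)
      show "((\<lambda>t. scaled t ?g (Some x0)) \<longlongrightarrow> c ?g * \<eta> (Some x0)) at_top"
        by (rule scaled_tendsto[OF g])
      show "\<forall>\<^sub>F t in at_top. \<bar>scaled t ?a (Some x0) - scaled t f (Some x0)\<bar> \<le> scaled t ?g (Some x0)"
        using eventually_ge_at_top[of 0]
      proof eventually_elim
        case (elim t)
        have "scaled t ?a (Some x0) - scaled t f (Some x0) = scaled t (\<lambda>z. ?a z - f z) (Some x0)"
          by (rule scaled_diff[OF elim bounded_dominated[OF a] bounded_dominated[OF f], symmetric])
        also have "\<bar>\<dots>\<bar> \<le> scaled t ?g (Some x0)"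
          by (rule scaled_abs_le[OF elim dominated_diff[OF bounded_dominated[OF a] bounded_dominated[OF f]]
                bounded_dominated[OF g]]) (use f in \<open>auto simp: indicator_def\<close>)
        finally show ?case .
      qed
    qed simp
    then have "\<bar>c ?a - c f\<bar> * \<eta> (Some x0) \<le> c ?g * \<eta> (Some x0)"
      using eta_pos by (simp add: left_diff_distrib[symmetric] abs_mult)
    then show "norm (c ?a - c f) \<le> c ?g" using eta_pos by simp
  qed
  then show ?thesis by (rule LIM_zero_cancel)
qed

lemma c_finite_support:
  assumes f: "\<And>y. \<bar>f y\<bar> \<le> \<phi> y" and G: "finite G"
  shows "c (\<lambda>z. f z * indicator (Some ` G) z) = (\<Sum>y\<in>G. f (Some y) * c (indicator {Some y}))"
proof (rule c_eqI)
  show "\<bar>f y * indicator (Some ` G) y\<bar> \<le> \<phi> y" for y by (rule restrict_bounded) (rule f)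
  have "scaled t (\<lambda>z. f z * indicator (Some ` G) z) (Some x0) =
      (\<Sum>y\<in>G. f (Some y) * scaled t (indicator {Some y}) (Some x0))" for t
    unfolding scaled_def semi_finite_support[OF G] semi_indicator
    by (simp add: sum_distrib_left mult_ac)
  moreover have "((\<lambda>t. \<Sum>y\<in>G. f (Some y) * scaled t (indicator {Some y}) (Some x0)) \<longlongrightarrow>
      (\<Sum>y\<in>G. f (Some y) * (c (indicator {Some y}) * \<eta> (Some x0)))) at_top"
    using indicator_bounded[of "{_}"] by (intro tendsto_intros scaled_tendsto) simp
  ultimately show "((\<lambda>t. scaled t (\<lambda>z. f z * indicator (Some ` G) z) (Some x0)) \<longlongrightarrow>
      (\<Sum>y\<in>G. f (Some y) * c (indicator {Some y})) * \<eta> (Some x0)) at_top"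
    by (simp add: sum_distrib_right mult.assoc)
qed

text \<open>
  The left eigenvector: the point masses are the values of the normalised functional \<open>c\<close>.
\<close>

definition qsd :: "'a pmf" where
  "qsd = embed_pmf (\<lambda>y. c (indicator {Some y}) / c iE)"

lemma c_point_nonneg: "0 \<le> c (indicator {Some y})"
  using indicator_bounded[of "{y}"] by (intro c_nonneg) auto

lemma pmf_qsd: "pmf qsd y = c (indicator {Some y}) / c iE"
  unfolding qsd_def
proof (rule pmf_embed_pmf)
  let ?w = "\<lambda>y. c (indicator {Some y}) / c iE"
  show "0 \<le> ?w y" for y using c_point_nonneg c_iE_pos by simp
  have lim1: "(\<lambda>n. \<integral>\<^sup>+y. ennreal (?w y) * indicator (exhaust n) y \<partial>count_space UNIV) \<longlonglongrightarrow>
      (\<integral>\<^sup>+y. ennreal (?w y) \<partial>count_space UNIV)"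
  proof (rule nn_integral_LIMSEQ)
    show "incseq (\<lambda>n y. ennreal (?w y) * indicator (exhaust n) y)"
      by (auto simp: incseq_def le_fun_def exhaust_def indicator_def)
    show "(\<lambda>n. ennreal (?w y) * indicator (exhaust n) y) \<longlonglongrightarrow> ennreal (?w y)" for y
    proof (rule tendsto_eventually)
      show "\<forall>\<^sub>F n in sequentially. ennreal (?w y) * indicator (exhaust n) y = ennreal (?w y)"
        using eventually_gt_at_top[of "to_nat y"] by eventually_elim (simp add: exhaust_def)
    qed
  qed simp
  have eq: "(\<integral>\<^sup>+y. ennreal (?w y) * indicator (exhaust n) y \<partial>count_space UNIV) =
      ennreal (c (\<lambda>z. iE z * indicator (Some ` exhaust n) z) / c iE)" for n
  proof -
    have "(\<integral>\<^sup>+y. ennreal (?w y) * indicator (exhaust n) y \<partial>count_space UNIV) = (\<Sum>y\<in>exhaust n. ennreal (?w y))"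
      using finite_exhaust by (subst nn_integral_indicator_finite) auto
    also have "\<dots> = ennreal (\<Sum>y\<in>exhaust n. ?w y)"
      using c_point_nonneg c_iE_pos by (intro sum_ennreal) simp
    also have "(\<Sum>y\<in>exhaust n. ?w y) = c (\<lambda>z. iE z * indicator (Some ` exhaust n) z) / c iE"
      by (subst c_finite_support[OF indicator_bounded finite_exhaust]) (simp add: sum_divide_distrib)
    finally show ?thesis .
  qed
  have lim2: "(\<lambda>n. ennreal (c (\<lambda>z. iE z * indicator (Some ` exhaust n) z) / c iE)) \<longlonglongrightarrow> ennreal (c iE / c iE)"
    using c_iE_pos by (intro tendsto_ennrealI tendsto_divide c_exhaust tendsto_const indicator_bounded) simp
  have "(\<integral>\<^sup>+y. ennreal (?w y) \<partial>count_space UNIV) = ennreal (c iE / c iE)"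
    by (rule LIMSEQ_unique[OF lim1[unfolded eq] lim2])
  then show "(\<integral>\<^sup>+y. ennreal (?w y) \<partial>count_space UNIV) = 1" using c_iE_pos by simp
qed

lemma qsd_finite_support:
  assumes "finite G"
  shows "mean qsd (\<lambda>z. f z * indicator (Some ` G) z) = (\<Sum>y\<in>G. f (Some y) * c (indicator {Some y})) / c iE"
proof -
  have "mean qsd (\<lambda>z. f z * indicator (Some ` G) z) =
      (\<Sum>y\<in>G. f (Some y) * indicator (Some ` G) (Some y) * pmf qsd y)"
    unfolding mean_def using assms
    by (intro integral_measure_pmf_real) (auto simp: indicator_def split: if_splits)
  then show ?thesis by (simp add: pmf_qsd sum_divide_distrib)
qed

lemma qsd_phi_integral: "(\<integral>\<^sup>+x. ennreal (\<phi> (Some x)) \<partial>qsd) \<le> ennreal (c \<phi> / c iE)"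
proof -
  let ?f = "\<lambda>n z. \<phi> z * indicator (Some ` exhaust n) z :: real"
  have "(\<lambda>n. \<integral>\<^sup>+x. ennreal (?f n (Some x)) \<partial>qsd) \<longlonglongrightarrow> (\<integral>\<^sup>+x. ennreal (\<phi> (Some x)) \<partial>qsd)"
  proof (rule nn_integral_LIMSEQ)
    show "incseq (\<lambda>n x. ennreal (?f n (Some x)))"
      by (auto simp: incseq_def le_fun_def exhaust_def indicator_def)
    show "(\<lambda>n. ennreal (?f n (Some x))) \<longlonglongrightarrow> ennreal (\<phi> (Some x))" for x
    proof (rule tendsto_eventually)
      show "\<forall>\<^sub>F n in sequentially. ennreal (?f n (Some x)) = ennreal (\<phi> (Some x))"
        using eventually_gt_at_top[of "to_nat x"] by eventually_elim (simp add: exhaust_def)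
    qed
  qed simp
  moreover have "(\<integral>\<^sup>+x. ennreal (?f n (Some x)) \<partial>qsd) \<le> ennreal (c \<phi> / c iE)" for n
  proof -
    have "(\<integral>\<^sup>+x. ennreal (?f n (Some x)) \<partial>qsd) = (\<integral>\<^sup>+x. ennreal (\<phi> (Some x)) * indicator (exhaust n) x \<partial>qsd)"
      by (intro nn_integral_cong) (auto simp: indicator_def)
    also have "\<dots> = (\<Sum>x\<in>exhaust n. ennreal (\<phi> (Some x)) * emeasure qsd {x})"
      using finite_exhaust by (intro nn_integral_indicator_finite) auto
    also have "\<dots> = ennreal (\<Sum>x\<in>exhaust n. \<phi> (Some x) * pmf qsd x)"
      using phi_nonneg by (subst sum_ennreal[symmetric]) (auto simp: emeasure_pmf_single ennreal_mult)
    also have "(\<Sum>x\<in>exhaust n. \<phi> (Some x) * pmf qsd x) = c (?f n) / c iE"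
      by (subst c_finite_support[OF phi_bounded finite_exhaust]) (simp add: pmf_qsd sum_divide_distrib)
    also have "\<dots> \<le> c \<phi> / c iE"
      using c_iE_pos phi_nonneg
      by (intro divide_right_mono c_leI restrict_bounded phi_bounded) (auto simp: indicator_def)
    finally show ?thesis by (simp add: ennreal_leI)
  qed
  ultimately show ?thesis by (intro LIMSEQ_le_const2) auto
qed

lemma integrable_mean:
  assumes "(\<integral>\<^sup>+x. ennreal (\<phi> (Some x)) \<partial>measure_pmf \<mu>) < \<infinity>" "dominated f"
  shows "integrable (measure_pmf \<mu>) (\<lambda>x. f (Some x))"
proof -
  obtain D where D: "0 \<le> D" "\<And>x. \<bar>f x\<bar> \<le> D * \<phi> x" using assms(2) dominatedE by blast
  have "integrable (measure_pmf \<mu>) (\<lambda>x. \<phi> (Some x))"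
    using assms(1) phi_nonneg by (intro integrableI_nonneg) auto
  then show ?thesis
  proof (rule Bochner_Integration.integrable_bound[OF integrable_mult_right[of D]])
    show "AE x in measure_pmf \<mu>. norm (f (Some x)) \<le> norm (D * \<phi> (Some x))"
      using D phi_nonneg by (intro AE_I2) (simp add: abs_mult)
  qed simp
qed

lemma qsd_phi_finite: "(\<integral>\<^sup>+x. ennreal (\<phi> (Some x)) \<partial>measure_pmf qsd) < \<infinity>"
  using le_less_trans[OF qsd_phi_integral] by simp

text \<open>
  Both sides are limits of the same finite sums over the exhaustion.
\<close>

lemma mean_qsd:
  assumes f: "\<And>y. \<bar>f y\<bar> \<le> \<phi> y"
  shows "mean qsd f = c f / c iE"
proof (rule LIMSEQ_unique)
  let ?f = "\<lambda>n z. f z * indicator (Some ` exhaust n) z :: real"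
  show "(\<lambda>n. mean qsd (?f n)) \<longlonglongrightarrow> mean qsd f"
    unfolding mean_def
  proof (rule integral_dominated_convergence[where w = "\<lambda>x. \<phi> (Some x)"])
    show "integrable qsd (\<lambda>x. \<phi> (Some x))" by (rule integrable_mean[OF qsd_phi_finite dominated_phi])
    show "AE x in qsd. (\<lambda>n. ?f n (Some x)) \<longlonglongrightarrow> f (Some x)"
    proof (rule AE_I2, rule tendsto_eventually)
      fix x
      show "\<forall>\<^sub>F n in sequentially. ?f n (Some x) = f (Some x)"
        using eventually_gt_at_top[of "to_nat x"] by eventually_elim (simp add: exhaust_def)
    qed
    show "AE x in qsd. norm (?f n (Some x)) \<le> \<phi> (Some x)" for n
      using restrict_bounded[OF f] by simp
  qed simp_all
  have "mean qsd (?f n) = c (?f n) / c iE" for n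
    by (simp add: qsd_finite_support[OF finite_exhaust] c_finite_support[OF f finite_exhaust])
  moreover have "(\<lambda>n. c (?f n) / c iE) \<longlonglongrightarrow> c f / c iE"
    using c_iE_pos by (intro tendsto_divide c_exhaust f tendsto_const) simp
  ultimately show "(\<lambda>n. mean qsd (?f n)) \<longlonglongrightarrow> c f / c iE" by simp
qed

lemma mean_indicator: "mean \<mu> (indicator (Some ` A)) = measure_pmf.prob \<mu> A"
proof -
  have "mean \<mu> (indicator (Some ` A)) = measure_pmf.expectation \<mu> (indicator A)"
    unfolding mean_def by (intro Bochner_Integration.integral_cong) (auto simp: indicator_def)
  then show ?thesis by simp
qed

lemma mean_cmult: "mean \<mu> (\<lambda>z. a * f z) = a * mean \<mu> f"
  unfolding mean_def by simp

text \<open>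
  Replacing \<open>f\<close> by \<open>T\<^sub>t f\<close> shifts time in the limit that defines \<open>c\<close>, so \<open>c\<close> is invariant.  The factor
  \<open>1 / K\<close> only serves to keep the function below \<open>\<phi>\<close>.
\<close>

lemma mean_qsd_semi:
  assumes f: "\<And>y. \<bar>f y\<bar> \<le> \<phi> y" and t: "0 \<le> t"
  shows "mean qsd (semi t f) = exp (- lam0 * t) * mean qsd f"
proof -
  obtain K where K: "0 < K" "\<And>t x. 0 \<le> t \<Longrightarrow> scaled t \<phi> x \<le> K * \<phi> x" using scaled_phi_bound by blast
  define g where "g z = 1 / K * scaled t f z" for z
  have g: "\<bar>g y\<bar> \<le> \<phi> y" for y
  proof -
    have "\<bar>scaled t f y\<bar> \<le> K * \<phi> y"
      using scaled_abs_le[OF t bounded_dominated[OF f] dominated_phi f, of y] K(2)[OF t, of y] by linarith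
    then show ?thesis using K(1) by (simp add: g_def abs_mult field_simps)
  qed
  have "c g = 1 / K * c f"
  proof (rule c_eqI[OF g])
    have shift: "filterlim (\<lambda>s::real. s + t) at_top at_top"
      using filterlim_tendsto_add_at_top[OF tendsto_const[of t] filterlim_ident] by (simp add: add.commute)
    have lim: "((\<lambda>s. 1 / K * scaled (s + t) f (Some x0)) \<longlongrightarrow> 1 / K * (c f * \<eta> (Some x0))) at_top"
      by (intro tendsto_intros filterlim_compose[OF scaled_tendsto[OF f] shift])
    have "\<forall>\<^sub>F s in at_top. 1 / K * scaled (s + t) f (Some x0) = scaled s g (Some x0)"
      using eventually_ge_at_top[of 0]
    proof eventually_elim
      case (elim s)
      have "scaled s g (Some x0) = 1 / K * scaled s (scaled t f) (Some x0)"
        unfolding g_def by (rule scaled_cmult)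
      then show ?case using scaled_scaled[OF elim t bounded_dominated[OF f]] by simp
    qed
    then show "((\<lambda>s. scaled s g (Some x0)) \<longlongrightarrow> 1 / K * c f * \<eta> (Some x0)) at_top"
      using Lim_transform_eventually[OF lim] by (simp add: mult.assoc)
  qed
  then have "mean qsd g = 1 / K * mean qsd f" by (simp add: mean_qsd[OF g] mean_qsd[OF f])
  moreover have "semi t f = (\<lambda>z. (exp (- lam0 * t) * K) * g z)"
    using K(1) by (auto simp: g_def scaled_def fun_eq_iff exp_minus)
  then have "mean qsd (semi t f) = (exp (- lam0 * t) * K) * mean qsd g"
    using mean_cmult[of qsd "exp (- lam0 * t) * K" g] by simp
  ultimately show ?thesis using K(1) by simp
qed

theorem qsd_is_nu_QSD: "is_nu_QSD P X D0 (\<lambda>x. \<phi> (Some x)) qsd"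
  unfolding is_nu_QSD_def quasi_stationary_iff
proof (intro conjI allI impI)
  fix t :: real and A assume t: "0 \<le> t"
  have iE: "mean qsd iE = 1" using mean_indicator[of qsd UNIV] by simp
  show "mean qsd (semi t (indicator (Some ` A))) / mean qsd (semi t iE) = measure_pmf.prob qsd A"
    using mean_qsd_semi[OF indicator_bounded t] by (simp add: iE mean_indicator)
next
  show "(\<integral>\<^sup>+x. ennreal (\<phi> (Some x)) \<partial>measure_pmf qsd) < \<infinity>" by (rule qsd_phi_finite)
  have "measure_pmf.prob qsd D0 = c iD / c iE"
    unfolding mean_indicator[symmetric] by (rule mean_qsd[OF indicator_bounded])
  then show "0 < measure_pmf.prob qsd D0" using c_iD_pos c_iE_pos by simp
qed

lemma qsd_survival: "0 \<le> t \<Longrightarrow> mean qsd (semi t iE) = exp (- lam0 * t)"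
  using mean_qsd_semi[where f = iE and t = t, OF indicator_bounded] mean_indicator[of qsd UNIV] by simp

lemma eta_D0_pos: assumes "y \<in> D0" shows "0 < \<eta> (Some y)"
proof -
  have "0 < exp lam0 * (pmf (kern 1 (Some y)) (Some x0) * \<eta> (Some x0))"
    using positive[OF assms D0(2)] eta_pos by simp
  also have "\<dots> \<le> scaled 1 \<eta> (Some y)"
    using semi_ge_point[OF _ eta_dominated eta_nonneg, of 1 "Some y" "Some x0"] by (simp add: scaled_def)
  finally show ?thesis by (simp add: eta_invariant)
qed

text \<open>
  Let \<open>\<theta>(t)\<close> be the survival probability from \<open>\<mu>\<close>, so that integrating \<open>P\<^sub>t 1\<^sub>A\<close> against \<open>\<mu>\<close> gives
  \<open>\<theta>(t) \<mu>(A)\<close>.  As \<open>\<mu>\<close> integrates \<open>\<phi>\<close>, the convergence may be integrated: \<open>exp (lam0 t) \<theta>(t) \<mu>(A)\<close> tends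
  to \<open>c(1\<^sub>A) \<mu>(\<eta>)\<close>, and for the whole space \<open>exp (lam0 t) \<theta>(t)\<close> tends to \<open>c(1) \<mu>(\<eta>)\<close>.  The factor
  \<open>\<mu>(\<eta>)\<close> is positive because \<open>\<mu>\<close> charges \<open>D0\<close>, so it cancels.
\<close>

theorem nu_QSD_unique:
  assumes "is_nu_QSD P X D0 (\<lambda>x. \<phi> (Some x)) \<mu>"
  shows "\<mu> = qsd"
proof -
  have qs: "\<And>t A. 0 \<le> t \<Longrightarrow> mean \<mu> (semi t (indicator (Some ` A))) / mean \<mu> (semi t iE) = measure_pmf.prob \<mu> A"
    and fin: "(\<integral>\<^sup>+x. ennreal (\<phi> (Some x)) \<partial>measure_pmf \<mu>) < \<infinity>"
    and D0_pos: "0 < measure_pmf.prob \<mu> D0"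
    using assms unfolding is_nu_QSD_def quasi_stationary_iff by auto
  have mean_lim: "((\<lambda>t. exp (lam0 * t) * mean \<mu> (semi t f)) \<longlongrightarrow> c f * mean \<mu> \<eta>) at_top"
    if f: "\<And>y. \<bar>f y\<bar> \<le> \<phi> y" for f
  proof -
    have "((\<lambda>t. \<epsilon> t * mean \<mu> \<phi>) \<longlongrightarrow> 0 * mean \<mu> \<phi>) at_top" by (intro tendsto_intros eps_tendsto)
    then have e0: "((\<lambda>t. \<epsilon> t * mean \<mu> \<phi>) \<longlongrightarrow> 0) at_top" by simp
    have "((\<lambda>t. exp (lam0 * t) * mean \<mu> (semi t f) - c f * mean \<mu> \<eta>) \<longlongrightarrow> 0) at_top"
    proof (rule Lim_null_comparison[OF _ e0])
      show "\<forall>\<^sub>F t in at_top. norm (exp (lam0 * t) * mean \<mu> (semi t f) - c f * mean \<mu> \<eta>) \<le> \<epsilon> t * mean \<mu> \<phi>"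
        using eventually_ge_at_top[of 0]
      proof eventually_elim
        case (elim t)
        have i1: "integrable (measure_pmf \<mu>) (\<lambda>x. scaled t f (Some x))"
          by (rule integrable_mean[OF fin dominated_scaled[OF elim bounded_dominated[OF f]]])
        have i2: "integrable (measure_pmf \<mu>) (\<lambda>x. c f * \<eta> (Some x))"
          by (intro integrable_mult_right integrable_mean[OF fin eta_dominated])
        have i3: "integrable (measure_pmf \<mu>) (\<lambda>x. \<epsilon> t * \<phi> (Some x))"
          by (intro integrable_mult_right integrable_mean[OF fin dominated_phi])
        have "exp (lam0 * t) * mean \<mu> (semi t f) = mean \<mu> (scaled t f)"
          unfolding mean_def scaled_def by simp
        then have "exp (lam0 * t) * mean \<mu> (semi t f) - c f * mean \<mu> \<eta> =
            measure_pmf.expectation \<mu> (\<lambda>x. scaled t f (Some x) - c f * \<eta> (Some x))"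
          unfolding mean_def using i1 i2 by simp
        also have "norm \<dots> \<le> measure_pmf.expectation \<mu> (\<lambda>x. norm (scaled t f (Some x) - c f * \<eta> (Some x)))"
          by (rule integral_norm_bound)
        also have "\<dots> \<le> measure_pmf.expectation \<mu> (\<lambda>x. \<epsilon> t * \<phi> (Some x))"
        proof (rule integral_mono[OF _ i3])
          show "integrable (measure_pmf \<mu>) (\<lambda>x. norm (scaled t f (Some x) - c f * \<eta> (Some x)))"
            using i1 i2 by simp
          show "norm (scaled t f (Some x) - c f * \<eta> (Some x)) \<le> \<epsilon> t * \<phi> (Some x)" for x
            using scaled_converges[OF f elim, of "Some x"] by simp
        qed
        also have "\<dots> = \<epsilon> t * mean \<mu> \<phi>" unfolding mean_def by simp
        finally show ?case .
      qed
    qed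
    then show ?thesis by (rule LIM_zero_cancel)
  qed
  have eta_mean: "0 < mean \<mu> \<eta>"
  proof -
    have "\<exists>y\<in>D0. pmf \<mu> y \<noteq> 0"
    proof (rule ccontr)
      assume "\<not> ?thesis"
      then have "measure_pmf.prob \<mu> D0 = 0"
        using D0(1) by (simp add: measure_measure_pmf_finite)
      then show False using D0_pos by simp
    qed
    then obtain y where y: "y \<in> D0" "pmf \<mu> y \<noteq> 0" by blast
    then have "0 < pmf \<mu> y * \<eta> (Some y)" using eta_D0_pos[OF y(1)] by (simp add: pmf_pos)
    also have "\<dots> \<le> mean \<mu> \<eta>"
      unfolding mean_def
      by (rule expectation_ge_point[OF integrable_mean[OF fin eta_dominated] eta_nonneg])
    finally show ?thesis .
  qed
  have "measure_pmf.prob \<mu> A = c (indicator (Some ` A)) / c iE" for A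
  proof -
    have "((\<lambda>t. exp (lam0 * t) * mean \<mu> (semi t iE) * measure_pmf.prob \<mu> A) \<longlongrightarrow>
        c iE * mean \<mu> \<eta> * measure_pmf.prob \<mu> A) at_top"
      by (intro tendsto_intros mean_lim indicator_bounded)
    moreover have "\<forall>\<^sub>F t in at_top. exp (lam0 * t) * mean \<mu> (semi t iE) * measure_pmf.prob \<mu> A =
        exp (lam0 * t) * mean \<mu> (semi t (indicator (Some ` A)))"
      using eventually_ge_at_top[of 0]
    proof eventually_elim
      case (elim t)
      \<comment> \<open>With survival probability 0 the quotient for the whole space would be 0 instead of 1.\<close>
      have "mean \<mu> (semi t iE) \<noteq> 0" using qs[OF elim, of UNIV] by auto
      then show ?case using qs[OF elim, of A] by (simp add: field_simps)
    qed
    ultimately have "((\<lambda>t. exp (lam0 * t) * mean \<mu> (semi t (indicator (Some ` A)))) \<longlongrightarrow>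
        c iE * mean \<mu> \<eta> * measure_pmf.prob \<mu> A) at_top"
      by (rule Lim_transform_eventually)
    then have "c iE * mean \<mu> \<eta> * measure_pmf.prob \<mu> A = c (indicator (Some ` A)) * mean \<mu> \<eta>"
      using tendsto_unique[OF trivial_limit_at_top_linorder _ mean_lim[where f = "indicator (Some ` A)", OF indicator_bounded]] by blast
    then show ?thesis using eta_mean c_iE_pos by (simp add: field_simps)
  qed
  from this[of "{_}"] show ?thesis
    by (intro pmf_eqI) (simp add: pmf_qsd measure_pmf_single)
qed

end

section \<open>The theorem\<close>

theorem theorem5p1:
  fixes q :: "'a::countable \<Rightarrow> 'a option \<Rightarrow> real"
    and M :: "'w measure"
    and P :: "'a option \<Rightarrow> 'w measure"
    and X :: "real \<Rightarrow> 'w \<Rightarrow> 'a option"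
    and D0 :: "'a set"
  assumes "absorbed_markov_jump_process q M P X"
    and "finite D0" and "D0 \<noteq> {}"
    and "\<forall>x\<in>D0. \<forall>y\<in>D0. 0 < \<P>(\<omega> in P (Some x). X 1 \<omega> = Some y)"
  shows "\<exists>lam0::real. (\<forall>x\<in>D0. decay_parameter P X x = ereal lam0) \<and>
    (\<forall>C lam1 (\<phi> :: 'a option \<Rightarrow> real).
      0 < C \<and> lam0 < lam1 \<and> (\<forall>x. 1 \<le> \<phi> (Some x)) \<and> \<phi> None = 0 \<and>
      (\<forall>x. (\<lambda>y. q x (Some y) * \<phi> (Some y)) summable_on (UNIV - {x})) \<and>
      (\<forall>x. generator q \<phi> (Some x) \<le> - lam1 * \<phi> (Some x) + C * indicator D0 x) \<longrightarrow>
      (\<forall>\<gamma>2. exp (- lam1) < \<gamma>2 \<and> \<gamma>2 < exp (- lam0) \<longrightarrow>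
        assumption_F P X D0 (exp (- lam1)) \<gamma>2 (\<lambda>x. \<phi> (Some x))) \<and>
      (\<exists>!\<nu>. is_nu_QSD P X D0 (\<lambda>x. \<phi> (Some x)) \<nu>) \<and>
      (\<forall>\<nu>. is_nu_QSD P X D0 (\<lambda>x. \<phi> (Some x)) \<nu> \<longrightarrow>
        (\<forall>t\<ge>0. \<P>(\<omega> in initial_law P \<nu>. ereal t < absorption_time X \<omega>) = exp (- lam0 * t))) \<and>
      (\<exists>\<eta> :: 'a option \<Rightarrow> real. \<eta> None = 0 \<and>
        (\<forall>x. ((\<lambda>t. exp (lam0 * t) * survival P X t (Some x)) \<longlongrightarrow> \<eta> (Some x)) at_top) \<and>
        (\<forall>t\<ge>0. \<forall>x. semigroup_op P X t \<eta> (Some x) = ennreal (exp (- lam0 * t) * \<eta> (Some x))) \<and>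
        (\<forall>x. (\<lambda>y. q x (Some y) * \<eta> (Some y)) summable_on (UNIV - {x})) \<and>
        (\<forall>x. generator q \<eta> (Some x) = - lam0 * \<eta> (Some x))))"
proof -
  interpret absorbed_markov_jump_process q M P X by fact
  obtain x0 where x0: "x0 \<in> D0" using assms(3) by blast
  have positive: "0 < pmf (kern 1 (Some x)) (Some y)" if "x \<in> D0" "y \<in> D0" for x y
    using assms(4) that by (simp add: pmf_kern)
  define lam0 where "lam0 = decay_rate x0"
  have decay: "\<forall>x\<in>D0. decay_parameter P X x = ereal lam0"
  proof
    fix x assume x: "x \<in> D0"
    have "decay_rate x = lam0"
      unfolding lam0_def using x x0 by (intro antisym decay_rate_le positive)
    then show "decay_parameter P X x = ereal lam0" using decay_parameter_eq[OF positive[OF x x]] by simp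
  qed
  show ?thesis
  proof (intro exI[of _ lam0] conjI decay allI impI)
    fix C lam1 :: real and \<phi> :: "'a option \<Rightarrow> real"
    assume "0 < C \<and> lam0 < lam1 \<and> (\<forall>x. 1 \<le> \<phi> (Some x)) \<and> \<phi> None = 0 \<and>
      (\<forall>x. (\<lambda>y. q x (Some y) * \<phi> (Some y)) summable_on (UNIV - {x})) \<and>
      (\<forall>x. generator q \<phi> (Some x) \<le> - lam1 * \<phi> (Some x) + C * indicator D0 x)"
    then interpret lyapunov_jump_process q M P X D0 x0 C lam0 lam1 \<phi>
      using assms(2) x0 positive lam0_def by unfold_locales blast+
    show "assumption_F P X D0 (exp (- lam1)) \<gamma>2 (\<lambda>x. \<phi> (Some x))"
      if "exp (- lam1) < \<gamma>2 \<and> \<gamma>2 < exp (- lam0)" for \<gamma>2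
      using that by (intro assumption_F_holds) auto
    obtain \<eta> B \<epsilon> c where spectral: "\<And>x. 0 \<le> \<eta> x" "0 < B" "\<And>x. \<eta> x \<le> B * \<phi> x" "0 < \<eta> (Some x0)"
      "\<And>t x. 0 \<le> t \<Longrightarrow> scaled t \<eta> x = \<eta> x" "(\<epsilon> \<longlongrightarrow> 0) at_top"
      "\<And>f t x. (\<And>y. \<bar>f y\<bar> \<le> \<phi> y) \<Longrightarrow> 0 \<le> t \<Longrightarrow> \<bar>scaled t f x - c f * \<eta> x\<bar> \<le> \<epsilon> t * \<phi> x"
      using exponential_convergence by blast
    interpret spectral_jump_process q M P X D0 x0 C lam0 lam1 \<phi> \<eta> B \<epsilon> c
      by (unfold_locales; fact spectral)
    show "\<exists>!\<nu>. is_nu_QSD P X D0 (\<lambda>x. \<phi> (Some x)) \<nu>"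
    proof (rule ex1I)
      show "is_nu_QSD P X D0 (\<lambda>x. \<phi> (Some x)) qsd" by (rule qsd_is_nu_QSD)
    qed (rule nu_QSD_unique)
    show "\<P>(\<omega> in initial_law P \<nu>. ereal t < absorption_time X \<omega>) = exp (- lam0 * t)"
      if "is_nu_QSD P X D0 (\<lambda>x. \<phi> (Some x)) \<nu>" "0 \<le> t" for \<nu> t
      using nu_QSD_unique[OF that(1)] qsd_survival[OF that(2)] initial_survival[OF that(2)] by simp
    define h where "h z = c iE * \<eta> z" for z
    have h0: "0 \<le> h z" for z unfolding h_def using c_iE_pos eta_nonneg by simp
    have h_dom: "dominated h" unfolding h_def by (intro dominated_cmult eta_dominated)
    have h_inv: "scaled t h z = h z" if "0 \<le> t" for t z
      unfolding h_def by (simp only: scaled_cmult eta_invariant[OF that])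
    have h_None: "h None = 0" by (rule dominated_None[OF h_dom])
    have h_lim: "((\<lambda>t. exp (lam0 * t) * survival P X t (Some x)) \<longlongrightarrow> h (Some x)) at_top" for x
    proof (rule Lim_transform_eventually)
      show "((\<lambda>t. scaled t iE (Some x)) \<longlongrightarrow> h (Some x)) at_top"
        unfolding h_def by (rule scaled_tendsto[OF indicator_bounded])
      show "\<forall>\<^sub>F t in at_top. scaled t iE (Some x) = exp (lam0 * t) * survival P X t (Some x)"
        using eventually_ge_at_top[of 0] by eventually_elim (simp add: scaled_def survival_semi)
    qed
    have h_semi: "semigroup_op P X t h (Some x) = ennreal (exp (- lam0 * t) * h (Some x))" if t: "0 \<le> t" for t x
    proof -
      have "semi t h (Some x) = exp (- lam0 * t) * scaled t h (Some x)"
        by (simp add: scaled_def exp_minus)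
      then show ?thesis
        by (simp add: semigroup_op_eq[where f = h, OF t h_None] ennreal_semi[OF t h_dom h0] h_inv[OF t])
    qed
    show "\<exists>\<eta> :: 'a option \<Rightarrow> real. \<eta> None = 0 \<and>
        (\<forall>x. ((\<lambda>t. exp (lam0 * t) * survival P X t (Some x)) \<longlongrightarrow> \<eta> (Some x)) at_top) \<and>
        (\<forall>t\<ge>0. \<forall>x. semigroup_op P X t \<eta> (Some x) = ennreal (exp (- lam0 * t) * \<eta> (Some x))) \<and>
        (\<forall>x. (\<lambda>y. q x (Some y) * \<eta> (Some y)) summable_on (UNIV - {x})) \<and>
        (\<forall>x. generator q \<eta> (Some x) = - lam0 * \<eta> (Some x))"
    proof (intro exI[of _ h] conjI allI impI)
      show "(\<lambda>y. q x (Some y) * h (Some y)) summable_on (UNIV - {x})" for x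
        by (rule eigenfunction_generator(1)[OF h0 h_dom h_inv])
      show "generator q h (Some x) = - lam0 * h (Some x)" for x
        by (rule eigenfunction_generator(2)[OF h0 h_dom h_inv])
    qed (fact h_None h_lim | rule h_semi, assumption)+
  qed
qed

end
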